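(* Let $\{(N_k,B_k)\}_{k=1}^m$ be finitely many admissible pairs in $\mathbb{R}$ with $\#B_k<N_k$ for $1\le k\le m$, let $\mathbf n=\{n_k\}_{k=1}^\infty$ be a sequence of positive integers, and let $\Omega=\{1,\dots,m\}^\infty$. For $\omega=\omega_1\omega_2\cdots\in\Omega$ let $$\mu^{\mathbf n}(\omega)=\delta_{N_{\omega_1}^{-n_1}B_{\omega_1}}*\delta_{N_{\omega_1}^{-n_1}N_{\omega_2}^{-n_2}B_{\omega_2}}*\cdots,$$ and let $$\mathcal{E}_m=\{t\in\mathbb{N}_+:\gcd(t,N_k)=1\text{ for all }1\le k\le m\}.$$ Then $\mu^{\mathbf n}$ is a spectral random measure, and $\mathcal{E}_m$ is an $\aleph_1$-spectral eigen set of $\mu^{\mathbf n}$.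
   Context: For a nonempty finite $D\subset\mathbb{R}$, $\delta_D=\frac{1}{\#D}\sum_{a\in D}\delta_a$. Infinite convolutions are weak limits of the corresponding finite convolutions; those above exist for every $\omega\in\Omega$, and $(\omega,B)\mapsto\mu^{\mathbf n}(\omega)(B)$ is a random measure, denoted $\mu^{\mathbf n}$ (i.e. measurable in $\omega$ for each Borel $B\subset\mathbb{R}$ and a measure in $B$ for each $\omega$). Admissible pair: an integer $N\ge2$ and a finite $B\subset\mathbb{Z}$ with $\#B\ge2$ form an admissible pair $(N,B)$ if there is $L\subset\mathbb{Z}$ such that the matrix $\left[\frac{1}{\sqrt{\#B}}e^{-2\pi i bl/N}\right]_{b\in B,\,l\in L}$ is unitary. A Borel probability measure $\eta$ on $\mathbb{R}$ is a spectral measure if there is a countable $\Lambda\subset\mathbb{R}$ (a spectrum of $\eta$) such that $\{e^{-2\pi i\lambda x}:\lambda\in\Lambda\}$ is an orthonormal basis of $L^2(\eta)$. A random measure $M$ on $\mathbb{R}$ is a spectral random measure if $M(\omega)$ is a spectral measure for all $\omega\in\Omega$. A set $\mathcal{E}\subset\mathbb{R}$ containing $1$ is an $\aleph_1$-spectral eigen set of $M$ if for all $\omega\in\Omega$ there exist uncountably many subsets $\Lambda_\omega\subset\mathbb{R}$ such that $t\Lambda_\omega$ is a spectrum of $M(\omega)$ for all $t\in\mathcal{E}$. *)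

theory Defs
  imports "HOL-Probability.Probability"
begin

definition uniform_atomic :: "real set \<Rightarrow> real measure" where
  "uniform_atomic D = distr (measure_pmf (pmf_of_set D)) borel (\<lambda>x. x)"

text \<open>Sequences of factors are indexed from 1, so \<open>finite_convolution \<nu> k\<close> is
  \<open>\<nu> 1 \<star> \<dots> \<star> \<nu> k\<close>; the empty convolution is the unit mass at 0.\<close>

primrec finite_convolution :: "(nat \<Rightarrow> real measure) \<Rightarrow> nat \<Rightarrow> real measure" where
  "finite_convolution \<nu> 0 = return borel 0"
| "finite_convolution \<nu> (Suc k) = convolution (finite_convolution \<nu> k) (\<nu> (Suc k))"

text \<open>The weak limit is unique when it exists; the value is unspecified otherwise.\<close>

definition infinite_convolution :: "(nat \<Rightarrow> real measure) \<Rightarrow> real measure" where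
  "infinite_convolution \<nu> =
     (THE \<mu>. real_distribution \<mu> \<and> weak_conv_m (finite_convolution \<nu>) \<mu>)"

definition unitary_matrix_on :: "'a set \<Rightarrow> 'b set \<Rightarrow> ('a \<Rightarrow> 'b \<Rightarrow> complex) \<Rightarrow> bool" where
  "unitary_matrix_on I J U \<longleftrightarrow> finite I \<and> finite J \<and>
     (\<forall>i\<in>I. \<forall>i'\<in>I. (\<Sum>j\<in>J. U i j * cnj (U i' j)) = (if i = i' then 1 else 0)) \<and>
     (\<forall>j\<in>J. \<forall>j'\<in>J. (\<Sum>i\<in>I. cnj (U i j) * U i j') = (if j = j' then 1 else 0))"

definition admissible_pair :: "nat \<Rightarrow> int set \<Rightarrow> bool" where
  "admissible_pair N B \<longleftrightarrow> N \<ge> 2 \<and> finite B \<and> card B \<ge> 2 \<and>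
     (\<exists>L :: int set. unitary_matrix_on B L
        (\<lambda>b l. complex_of_real (1 / sqrt (real (card B))) *
               exp (- 2 * complex_of_real pi * \<i> * of_int b * of_int l / of_nat N)))"

definition square_integrable :: "'a measure \<Rightarrow> ('a \<Rightarrow> complex) \<Rightarrow> bool" where
  "square_integrable M f \<longleftrightarrow> f \<in> borel_measurable M \<and> integrable M (\<lambda>x. (cmod (f x))\<^sup>2)"

text \<open>An orthonormal basis of the Hilbert space \<open>L\<^sup>2(M)\<close>: an orthonormal family whose
  linear span is dense. It is a family and not just a set of functions, so distinct indices
  give orthogonal elements.\<close>

definition L2_orthonormal_basis :: "'a measure \<Rightarrow> 'i set \<Rightarrow> ('i \<Rightarrow> 'a \<Rightarrow> complex) \<Rightarrow> bool" where
  "L2_orthonormal_basis M I e \<longleftrightarrow>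
     (\<forall>i\<in>I. square_integrable M (e i)) \<and>
     (\<forall>i\<in>I. \<forall>j\<in>I. (\<integral>x. e i x * cnj (e j x) \<partial>M) = (if i = j then 1 else 0)) \<and>
     (\<forall>f. square_integrable M f \<longrightarrow>
        (\<forall>\<epsilon>>0. \<exists>F c. finite F \<and> F \<subseteq> I \<and>
           (\<integral>x. (cmod (f x - (\<Sum>i\<in>F. c i * e i x)))\<^sup>2 \<partial>M) < \<epsilon>))"

definition is_spectrum :: "real measure \<Rightarrow> real set \<Rightarrow> bool" where
  "is_spectrum \<eta> \<Lambda> \<longleftrightarrow> countable \<Lambda> \<and>
     L2_orthonormal_basis \<eta> \<Lambda>
       (\<lambda>l x. exp (- 2 * complex_of_real pi * \<i> * complex_of_real l * complex_of_real x))"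

definition spectral_measure :: "real measure \<Rightarrow> bool" where
  "spectral_measure \<eta> \<longleftrightarrow> real_distribution \<eta> \<and> (\<exists>\<Lambda>. is_spectrum \<eta> \<Lambda>)"

definition random_measure :: "'w measure \<Rightarrow> ('w \<Rightarrow> real measure) \<Rightarrow> bool" where
  "random_measure \<Omega> M \<longleftrightarrow>
     (\<forall>\<omega>\<in>space \<Omega>. sets (M \<omega>) = sets borel) \<and>
     (\<forall>A\<in>sets borel. (\<lambda>\<omega>. emeasure (M \<omega>) A) \<in> borel_measurable \<Omega>)"

definition spectral_random_measure :: "'w measure \<Rightarrow> ('w \<Rightarrow> real measure) \<Rightarrow> bool" where
  "spectral_random_measure \<Omega> M \<longleftrightarrow>
     random_measure \<Omega> M \<and> (\<forall>\<omega>\<in>space \<Omega>. spectral_measure (M \<omega>))"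

definition aleph1_spectral_eigen_set ::
  "'w measure \<Rightarrow> ('w \<Rightarrow> real measure) \<Rightarrow> real set \<Rightarrow> bool" where
  "aleph1_spectral_eigen_set \<Omega> M E \<longleftrightarrow> 1 \<in> E \<and>
     (\<forall>\<omega>\<in>space \<Omega>. uncountable {\<Lambda>. \<forall>t\<in>E. is_spectrum (M \<omega>) ((\<lambda>x. t * x) ` \<Lambda>)})"

text \<open>The symbol space \<open>{1..m}\<close> to the power of the positive integers. Its only structure is
  the product \<open>\<sigma>\<close>-algebra, which is the Borel \<open>\<sigma>\<close>-algebra of the product topology; the measure
  that \<open>Pi\<^sub>M\<close> carries plays no role. The point \<open>\<omega>\<^sub>1\<omega>\<^sub>2\<dots>\<close> is a function on \<open>{1..}\<close>.\<close>

definition symbol_space :: "nat \<Rightarrow> (nat \<Rightarrow> nat) measure" where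
  "symbol_space m = Pi\<^sub>M {1..} (\<lambda>_. count_space {1..m})"

definition random_convolution ::
  "(nat \<Rightarrow> nat) \<Rightarrow> (nat \<Rightarrow> int set) \<Rightarrow> (nat \<Rightarrow> nat) \<Rightarrow> (nat \<Rightarrow> nat) \<Rightarrow> real measure" where
  "random_convolution N B n \<omega> = infinite_convolution (\<lambda>k.
     uniform_atomic ((\<lambda>b. (\<Prod>i=1..k. 1 / real (N (\<omega> i)) ^ n i) * of_int b) ` B (\<omega> k)))"

definition coprime_scalings :: "nat \<Rightarrow> (nat \<Rightarrow> nat) \<Rightarrow> real set" where
  "coprime_scalings m N = {real t |t. t > 0 \<and> (\<forall>k\<in>{1..m}. gcd t (N k) = 1)}"

end

(* The measure mu(omega) is an infinite convolution with Fourier transform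
   prod_k m_k(xi / P_k), where P_k = M_1 ... M_k, M_k is the n_k-th power of N_(omega_k), and
   m_k is the mask of the digit set D_k = B_(omega_k). A Hadamard set L for (N, B) gives
   Hadamard sets for powers of N, and by Galois conjugation of the vanishing sums t L is one for
   every t coprime to N. So a tree of frequencies l_1 + P_1 l_2 + P_2 l_3 + ..., cut at level k,
   is a spectrum of the k-th partial convolution after scaling by any admissible t, and stays
   one when its elements are changed by multiples of P_k.

   By the criterion of Jorgensen and Pedersen the limit set is complete if for infinitely many
   levels the tail transform is bounded below at all t lambda of that level. Suitable multiples
   of P_k exist: either the next M_k is huge and the tail is close to 1 near 0, or the M_k are
   bounded and a block of factors is an exponential sum with prod #D_k frequencies, far fewer
   than the prod M_k points in a period since #D_k < M_k, so by a Vandermonde argument it is not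
   small at all of the points close to 0.

   The scalings t are served one after the other, each infinitely often; each new level is taken
   so deep that the frequencies already fixed lie close to 0 relative to P_k. New frequencies
   can be taken as large as desired, which leaves room for a diagonal argument against any
   countable family. Measurability in omega holds because mu(omega) is the law of a series of
   random digits, drawn from a product space that does not depend on omega, and the series is
   jointly measurable. *)

theory Submission
  imports Defs
begin

text \<open>The exponents \<open>n k\<close> are unrestricted, so infinitely many pairs
  (\<open>M k\<close>, \<open>D k\<close>) may occur. Only two constants are uniform in the level:
  the digit bound \<open>C\<close>, which gives all transforms a common modulus of continuity, and
  the ratio \<rho> < 1, which survives because passing to a power of N only enlarges the
  denominator. A lower bound in terms of \<open>M k\<close>, such as the Vandermonde estimate gives,
  degenerates when the \<open>M k\<close> are unbounded; hence the two cases, and in the unbounded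
  one only levels with large \<open>M k\<close> are usable.

  The other obstacle is that E may be infinite: the lower bound for the tails depends on t, and a
  multiple of \<open>P k\<close> that suits one t need not suit another. Completeness is therefore
  derived from estimates at infinitely many levels only, and these levels may vary with t. What has
  to hold for all t at every level is orthogonality and the Parseval identity, and the choice of
  multiples does not affect them. Coprimality of t serves twice: to conjugate vanishing sums, and to
  keep the frequencies of a block distinct modulo the block product after multiplication by
  t.\<close>

section \<open>Vanishing sums of roots of unity\<close>

text \<open>A stand-in for norms of algebraic numbers: a rational linear functional that does not
  kill \<alpha> already detects which integers can divide \<alpha>. It comes from extending \<alpha>
  to a basis of the complex numbers over the rationals.\<close>

lemma rat_functional_exists:
  fixes \<alpha> :: complex
  assumes "\<alpha> \<noteq> 0"
  obtains \<phi> :: "complex \<Rightarrow> rat"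
  where "\<And>x y. \<phi> (x + y) = \<phi> x + \<phi> y" and "\<And>q x. \<phi> (of_rat q * x) = q * \<phi> x" and "\<phi> \<alpha> = 1"
proof -
  interpret C: vector_space "\<lambda>(q::rat) (x::complex). of_rat q * x"
    by standard (auto simp: algebra_simps of_rat_add of_rat_mult)
  interpret R: vector_space "\<lambda>(q::rat) (x::rat). q * x"
    by standard (auto simp: algebra_simps)
  interpret P: vector_space_pair "\<lambda>(q::rat) (x::complex). of_rat q * x" "\<lambda>(q::rat) (x::rat). q * x" ..
  have "C.independent {\<alpha>}"
    using assms by simp
  then obtain g where g: "Vector_Spaces.linear (\<lambda>(q::rat) (x::complex). of_rat q * x) (\<lambda>(q::rat) (x::rat). q * x) g"
    "\<forall>x\<in>{\<alpha>}. g x = 1"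
    using P.linear_independent_extend[of "{\<alpha>}" "\<lambda>_. 1"] by blast
  interpret g: Vector_Spaces.linear "\<lambda>(q::rat) (x::complex). of_rat q * x" "\<lambda>(q::rat) (x::rat). q * x" g
    by (rule g)
  show ?thesis using that[of g] g(2) g.add g.scale by auto
qed

text \<open>The ring Z[\<zeta>], encoded as an additive span so that an additive map is controlled
  by its values at the powers of \<zeta>.\<close>

inductive_set int_powers_span :: "complex \<Rightarrow> complex set" for \<zeta> where
  monomial: "of_int k * \<zeta> ^ j \<in> int_powers_span \<zeta>"
| add: "x \<in> int_powers_span \<zeta> \<Longrightarrow> y \<in> int_powers_span \<zeta> \<Longrightarrow> x + y \<in> int_powers_span \<zeta>"

lemma int_powers_span_of_int: "of_int k \<in> int_powers_span \<zeta>"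
  using int_powers_span.monomial[of k \<zeta> 0] by simp

lemma int_powers_span_mult:
  assumes "x \<in> int_powers_span \<zeta>" "y \<in> int_powers_span \<zeta>"
  shows "x * y \<in> int_powers_span \<zeta>"
  using assms
proof (induction x rule: int_powers_span.induct)
  case (monomial k j)
  from monomial show ?case
  proof (induction y rule: int_powers_span.induct)
    case (monomial l i)
    show ?case
      using int_powers_span.monomial[of "k * l" \<zeta> "j + i"] by (simp add: power_add mult_ac)
  next
    case (add x y)
    then show ?case by (simp add: distrib_left int_powers_span.add)
  qed
next
  case (add x y)
  then show ?case by (simp add: distrib_right int_powers_span.add)
qed

lemma int_powers_span_power: "x \<in> int_powers_span \<zeta> \<Longrightarrow> x ^ n \<in> int_powers_span \<zeta>"
  by (induction n) (auto intro: int_powers_span_mult simp: int_powers_span_of_int[of 1, simplified])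

lemma int_powers_span_sum:
  "(\<And>i. i \<in> I \<Longrightarrow> f i \<in> int_powers_span \<zeta>) \<Longrightarrow> sum f I \<in> int_powers_span \<zeta>"
  by (induction I rule: infinite_finite_induct)
    (auto intro: int_powers_span.add simp: int_powers_span_of_int[of 0, simplified])

lemma power_mod_root_of_unity:
  fixes \<zeta> :: complex
  assumes "\<zeta> ^ N = 1"
  shows "\<zeta> ^ j = \<zeta> ^ (j mod N)"
proof -
  have "\<zeta> ^ j = \<zeta> ^ (N * (j div N) + j mod N)" by simp
  also have "\<dots> = \<zeta> ^ (j mod N)"
    by (simp only: power_add power_mult assms) simp
  finally show ?thesis .
qed

text \<open>A rational linear functional with value 1 at \<open>\<alpha>\<close> takes values with a common denominator on the
  integral span of the powers of \<open>\<zeta>\<close>, and \<open>p\<close> divides this denominator.\<close>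

lemma prime_divisors_bounded:
  fixes \<zeta> \<alpha> :: complex
  assumes "N > 0" "\<zeta> ^ N = 1" "\<alpha> \<noteq> 0"
  obtains C :: nat where "\<And>p \<beta>. \<beta> \<in> int_powers_span \<zeta> \<Longrightarrow> \<alpha> = of_nat p * \<beta> \<Longrightarrow> p \<le> C"
proof -
  obtain \<phi> :: "complex \<Rightarrow> rat" where \<phi>: "\<And>x y. \<phi> (x + y) = \<phi> x + \<phi> y"
    "\<And>q x. \<phi> (of_rat q * x) = q * \<phi> x" "\<phi> \<alpha> = 1"
    using rat_functional_exists[OF assms(3)] by blast
  define d where "d j = snd (quotient_of (\<phi> (\<zeta> ^ j)))" for j
  have d: "d j > 0" "of_int (d j) * \<phi> (\<zeta> ^ j) \<in> \<int>" for j
  proof -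
    show pos: "d j > 0" by (simp add: d_def quotient_of_denom_pos')
    have "\<phi> (\<zeta> ^ j) = of_int (fst (quotient_of (\<phi> (\<zeta> ^ j)))) / of_int (d j)"
      unfolding d_def using quotient_of_div by (metis prod.collapse)
    then show "of_int (d j) * \<phi> (\<zeta> ^ j) \<in> \<int>"
      using pos by (metis Ints_of_int less_irrefl nonzero_eq_divide_eq mult.commute of_int_eq_0_iff)
  qed
  \<comment> \<open>Exponents below N suffice, since \<zeta> ^ N = 1.\<close>
  define m where "m = (\<Prod>j<N. d j)"
  have m: "m > 0" unfolding m_def by (intro prod_pos) (auto simp: d)
  have mono: "of_int m * \<phi> (\<zeta> ^ j) \<in> \<int>" for j
  proof -
    note eq = power_mod_root_of_unity[OF assms(2), of j]
    have "j mod N < N" using assms(1) by simp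
    then have "m = d (j mod N) * (\<Prod>i\<in>{..<N} - {j mod N}. d i)"
      unfolding m_def by (subst prod.remove[of _ "j mod N"]) auto
    then have "of_int m * \<phi> (\<zeta> ^ j) = of_int (\<Prod>i\<in>{..<N} - {j mod N}. d i) * (of_int (d (j mod N)) * \<phi> (\<zeta> ^ (j mod N)))"
      by (simp add: eq)
    then show ?thesis using d(2) by (simp only: Ints_mult Ints_of_int)
  qed
  have int: "of_int m * \<phi> x \<in> \<int>" if "x \<in> int_powers_span \<zeta>" for x
    using that
  proof (induction x rule: int_powers_span.induct)
    case (monomial k j)
    have "\<phi> (of_int k * \<zeta> ^ j) = of_int k * \<phi> (\<zeta> ^ j)"
      using \<phi>(2)[of "of_int k" "\<zeta> ^ j"] by simp
    then have "of_int m * \<phi> (of_int k * \<zeta> ^ j) = of_int k * (of_int m * \<phi> (\<zeta> ^ j))" by simp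
    then show ?case using mono by (simp only: Ints_mult Ints_of_int)
  next
    case (add x y)
    then show ?case by (simp add: \<phi>(1) distrib_left)
  qed
  show ?thesis
  proof (rule that[of "nat m"])
    fix p \<beta> assume *: "\<beta> \<in> int_powers_span \<zeta>" "\<alpha> = of_nat p * \<beta>"
    have "1 = of_nat p * \<phi> \<beta>" using \<phi>(3) \<phi>(2)[of "of_nat p" \<beta>] by (simp add: * )
    then have "of_int m = of_nat p * (of_int m * \<phi> \<beta>)" by (metis mult.assoc mult.commute mult.right_neutral)
    moreover obtain k where "of_int m * \<phi> \<beta> = of_int k" using int[OF *(1)] by (auto elim: Ints_cases)
    ultimately have "(of_int m :: rat) = of_int (int p * k)" by simp
    then have "m = int p * k" by (simp only: of_int_eq_iff)
    then have "int p \<le> m" using m by (intro zdvd_imp_le) auto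
    then show "p \<le> nat m" by simp
  qed
qed

text \<open>The Frobenius map modulo p in Z[\<zeta>]: the middle binomial coefficients are divisible
  by p. The cofactor \<beta> has to lie in Z[\<zeta>] again for
  \<open>prime_divisors_bounded\<close> to apply.\<close>

lemma frobenius_sum:
  fixes x :: "'i \<Rightarrow> complex"
  assumes "prime p" "finite I" "\<And>i. i \<in> I \<Longrightarrow> x i \<in> int_powers_span \<zeta>"
  shows "\<exists>\<beta>\<in>int_powers_span \<zeta>. (\<Sum>i\<in>I. x i) ^ p = (\<Sum>i\<in>I. x i ^ p) + of_nat p * \<beta>"
  using assms(2,3)
proof (induction I rule: finite_induct)
  case empty
  then show ?case using prime_gt_0_nat[OF assms(1)] int_powers_span_of_int[of 0]
    by (auto simp: power_0_left intro!: bexI[of _ 0])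
next
  case (insert a I)
  let ?s = "\<Sum>i\<in>I. x i"
  obtain \<beta> where \<beta>: "\<beta> \<in> int_powers_span \<zeta>" "?s ^ p = (\<Sum>i\<in>I. x i ^ p) + of_nat p * \<beta>"
    using insert by auto
  have s: "?s \<in> int_powers_span \<zeta>" using insert by (intro int_powers_span_sum) auto
  have p: "p > 1" using assms(1) prime_gt_1_nat by blast
  define \<gamma> where "\<gamma> = (\<Sum>k\<in>{1..<p}. of_nat ((p choose k) div p) * x a ^ k * ?s ^ (p - k))"
  have "\<gamma> \<in> int_powers_span \<zeta>" unfolding \<gamma>_def
    using insert(4) s by (intro int_powers_span_sum int_powers_span_mult int_powers_span_power)
      (auto simp: int_powers_span_of_int[of "int _", simplified])
  moreover have "(x a + ?s) ^ p = x a ^ p + ?s ^ p + of_nat p * \<gamma>"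
  proof -
    have "{..p} = insert 0 (insert p {1..<p})" using p by auto
    then have "(x a + ?s) ^ p = x a ^ p + ?s ^ p + (\<Sum>k\<in>{1..<p}. of_nat (p choose k) * x a ^ k * ?s ^ (p - k))"
      using p unfolding binomial_ring by (simp add: algebra_simps)
    also have "(\<Sum>k\<in>{1..<p}. of_nat (p choose k) * x a ^ k * ?s ^ (p - k)) = of_nat p * \<gamma>"
      unfolding \<gamma>_def sum_distrib_left
    proof (rule sum.cong[OF refl])
      fix k assume "k \<in> {1..<p}"
      then have "p dvd (p choose k)" using assms(1) by (intro dvd_choose_prime) auto
      then have "p choose k = p * ((p choose k) div p)" by simp
      then have "(of_nat (p choose k) :: complex) = of_nat p * of_nat ((p choose k) div p)"
        by (metis of_nat_mult)
      then show "of_nat (p choose k) * x a ^ k * ?s ^ (p - k) = of_nat p * (of_nat ((p choose k) div p) * x a ^ k * ?s ^ (p - k))"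
        by simp
    qed
    finally show ?thesis .
  qed
  ultimately show ?case using insert(1,2) \<beta>
    by (auto intro!: bexI[of _ "\<beta> + \<gamma>"] int_powers_span.add simp: algebra_simps)
qed

text \<open>An elementary replacement for Dirichlet's theorem: add to t the number N times the
  product of all primes up to C that do not divide t. A prime up to C divides exactly one of the two
  summands, hence not s.\<close>

lemma coprime_lift_large_primes:
  fixes t N C :: nat
  assumes "coprime t N" "t > 0"
  obtains s where "s > 0" "s mod N = t mod N" "\<And>p. prime p \<Longrightarrow> p dvd s \<Longrightarrow> p > C"
proof -
  let ?S = "{p. prime p \<and> p \<le> C \<and> \<not> p dvd t}"
  define s where "s = t + N * \<Prod>?S"
  have fin: "finite ?S" by (rule finite_subset[of _ "{..C}"]) auto
  show ?thesis
  proof (rule that[of s])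
    show "s > 0" using assms by (simp add: s_def)
    show "s mod N = t mod N" by (simp add: s_def)
    fix p assume p: "prime p" "p dvd s"
    show "p > C"
    proof (rule ccontr)
      assume "\<not> p > C"
      show False
      proof (cases "p dvd t")
        case True
        then have "\<not> p dvd N" using assms p(1) by (metis coprime_common_divisor_nat not_prime_1)
        moreover have "p dvd N * \<Prod>?S" using True p(2) unfolding s_def by (simp add: dvd_add_right_iff)
        ultimately have "p dvd \<Prod>?S" using p(1) by (simp add: prime_dvd_mult_iff)
        then obtain q where "q \<in> ?S" "p dvd q" using prime_dvd_prod_iff[OF fin p(1), of "\<lambda>x. x"] by auto
        then show False using True p(1) primes_dvd_imp_eq by blast
      next
        case False
        then have "p \<in> ?S" using p(1) \<open>\<not> p > C\<close> by auto
        then have "p dvd \<Prod>?S" using fin by (intro dvd_prodI[of _ _ "\<lambda>x. x", simplified]) auto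
        then have "p dvd t" using p(2) unfolding s_def by (simp add: dvd_add_left_iff)
        then show False using False by simp
      qed
    qed
  qed
qed

text \<open>Landau's argument: the \<open>p\<close>-th power of a vanishing sum, for a prime \<open>p\<close>, shows that \<open>p\<close> divides the sum of
  \<open>p\<close>-th powers, which is then 0 when \<open>p\<close> is large; and \<open>t\<close> may be replaced by a number congruent to
  it that has only large prime factors.\<close>

theorem vanishing_root_sum_galois:
  fixes \<zeta> :: complex and a :: "'i \<Rightarrow> nat"
  assumes N: "N > 0" "\<zeta> ^ N = 1" and I: "finite I" and t: "coprime t N" "t > 0"
    and zero: "(\<Sum>i\<in>I. \<zeta> ^ a i) = 0"
  shows "(\<Sum>i\<in>I. \<zeta> ^ (t * a i)) = 0"
proof -
  define \<alpha> where "\<alpha> r = (\<Sum>i\<in>I. \<zeta> ^ (r * a i))" for r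
  note red = power_mod_root_of_unity[OF N(2)]
  have \<alpha>_cong: "\<alpha> r = \<alpha> s" if "r mod N = s mod N" for r s
    unfolding \<alpha>_def
  proof (rule sum.cong[OF refl])
    fix i
    have "(r * a i) mod N = (s * a i) mod N" using that by (metis mod_mult_left_eq)
    then show "\<zeta> ^ (r * a i) = \<zeta> ^ (s * a i)" using red by metis
  qed
  have "\<exists>C. \<forall>p \<beta>. \<beta> \<in> int_powers_span \<zeta> \<longrightarrow> \<alpha> r \<noteq> 0 \<longrightarrow> \<alpha> r = of_nat p * \<beta> \<longrightarrow> p \<le> C" for r
    using prime_divisors_bounded[OF N, of "\<alpha> r"] by metis
  then obtain c where c: "\<And>r p \<beta>. \<beta> \<in> int_powers_span \<zeta> \<Longrightarrow> \<alpha> r \<noteq> 0 \<Longrightarrow> \<alpha> r = of_nat p * \<beta> \<Longrightarrow> p \<le> c r"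
    by metis
  \<comment> \<open>\<open>\<alpha> r\<close> depends only on r mod N, so finitely many bounds cover
    every r. The induction on the prime factors of s passes through many such r.\<close>
  define C where "C = Max (c ` {..<N})"
  have C: "p \<le> C" if "\<beta> \<in> int_powers_span \<zeta>" "\<alpha> r \<noteq> 0" "\<alpha> r = of_nat p * \<beta>" for r p \<beta>
  proof -
    have "\<alpha> r = \<alpha> (r mod N)" by (rule \<alpha>_cong) simp
    then have "p \<le> c (r mod N)" using c that by metis
    also have "\<dots> \<le> C" unfolding C_def using N by (intro Max_ge) auto
    finally show ?thesis .
  qed
  have step: "\<alpha> (p * r) = 0" if pr: "prime p" "p > C" "\<alpha> r = 0" for p r
  proof (rule ccontr)
    assume nz: "\<alpha> (p * r) \<noteq> 0"
    obtain \<beta> where \<beta>: "\<beta> \<in> int_powers_span \<zeta>"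
      "(\<Sum>i\<in>I. \<zeta> ^ (r * a i)) ^ p = (\<Sum>i\<in>I. (\<zeta> ^ (r * a i)) ^ p) + of_nat p * \<beta>"
      using frobenius_sum[OF pr(1) I, of "\<lambda>i. \<zeta> ^ (r * a i)" \<zeta>] int_powers_span.monomial[of 1 \<zeta>] by auto
    have "(\<Sum>i\<in>I. (\<zeta> ^ (r * a i)) ^ p) = \<alpha> (p * r)"
      unfolding \<alpha>_def by (simp add: mult_ac flip: power_mult)
    moreover have "(\<Sum>i\<in>I. \<zeta> ^ (r * a i)) ^ p = 0"
      using pr by (simp add: \<alpha>_def prime_gt_0_nat)
    ultimately have "\<alpha> (p * r) = of_nat p * (of_int (- 1) * \<beta>)"
      using \<beta>(2) by (simp add: eq_neg_iff_add_eq_0)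
    moreover have "of_int (- 1) * \<beta> \<in> int_powers_span \<zeta>"
      using \<beta>(1) int_powers_span_mult int_powers_span_of_int by blast
    ultimately have "p \<le> C" using C nz by blast
    then show False using pr by simp
  qed
  obtain s where s: "s > 0" "s mod N = t mod N" "\<And>p. prime p \<Longrightarrow> p dvd s \<Longrightarrow> p > C"
    using coprime_lift_large_primes[OF t] by blast
  have "\<alpha> s = 0" using s(1,3)
  proof (induction s rule: prime_divisors_induct)
    case (factor p x)
    then show ?case by (auto intro!: step)
  next
    case (unit x)
    then show ?case using zero by (simp add: \<alpha>_def)
  qed auto
  then have "\<alpha> t = 0" using \<alpha>_cong[OF s(2)] by simp
  then show ?thesis by (simp add: \<alpha>_def)
qed

section \<open>Masks and truncated Fourier transforms\<close>

text \<open>The sign is that of \<open>is_spectrum\<close>, whose exponential at frequency l is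
  \<open>ec (l * x)\<close>.\<close>

definition ec :: "real \<Rightarrow> complex" where
  "ec x = exp (- 2 * complex_of_real pi * \<i> * complex_of_real x)"

lemma ec_iexp: "ec x = iexp (- 2 * pi * x)"
  by (simp add: ec_def algebra_simps)

lemma ec_0 [simp]: "ec 0 = 1"
  by (simp add: ec_def)

lemma ec_add: "ec (x + y) = ec x * ec y"
  by (simp add: ec_def distrib_left flip: exp_add)

lemma ec_uminus: "ec (- x) = cnj (ec x)"
  by (simp add: ec_def exp_cnj)

lemma ec_diff: "ec (x - y) = ec x * cnj (ec y)"
  using ec_add[of x "- y"] by (simp add: ec_uminus)

lemma norm_ec [simp]: "norm (ec x) = 1"
  by (simp add: ec_iexp)

lemma ec_mult_nat: "ec (real n * x) = ec x ^ n"
  by (induction n) (auto simp: ec_add distrib_right)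

lemma ec_eq_1_iff: "ec x = 1 \<longleftrightarrow> x \<in> \<int>"
proof
  assume "ec x = 1"
  then obtain n :: int where "-2 * pi * x = real_of_int (2 * n) * pi"
    by (auto simp: ec_def exp_eq_1)
  then have "pi * x = pi * (- real_of_int n)" by simp
  then have "x = - real_of_int n" by (simp only: mult_left_cancel[OF pi_neq_zero])
  then show "x \<in> \<int>" by simp
next
  assume "x \<in> \<int>"
  then obtain n where "x = of_int n" by (auto elim: Ints_cases)
  then have "Im (- 2 * complex_of_real pi * \<i> * complex_of_real x) = real_of_int (2 * (- n)) * pi" by simp
  then show "ec x = 1" unfolding ec_def exp_eq_1 by (intro conjI exI[of _ "- n"]) auto
qed

lemma ec_of_int [simp]: "ec (of_int n) = 1"
  by (simp add: ec_eq_1_iff)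

lemma ec_add_Ints: "y \<in> \<int> \<Longrightarrow> ec (x + y) = ec x"
  by (simp add: ec_add ec_eq_1_iff[THEN iffD2])

lemma norm_ec_diff_le: "norm (ec x - ec y) \<le> 2 * pi * \<bar>x - y\<bar>"
proof -
  have "ec x - ec y = (ec (x - y) - 1) * ec y"
    using ec_add[of "x - y" y] by (simp add: algebra_simps)
  then have "norm (ec x - ec y) = norm (ec (x - y) - 1)" by (simp add: norm_mult)
  also have "\<dots> \<le> \<bar>- 2 * pi * (x - y)\<bar>"
    using iexp_approx1[of "- 2 * pi * (x - y)" 0] by (simp add: ec_iexp)
  finally show ?thesis by (simp add: abs_mult)
qed

text \<open>A quantitative form of the invertibility of Vandermonde matrices. A node
  \<open>z c\<close> is eliminated by subtracting \<open>z c\<close> times each power sum from the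
  next one: this kills the weight of c and multiplies \<open>w b\<close> by
  \<open>z b - z c\<close>. The bound at most doubles each time, whence the power of 2.\<close>

lemma power_sum_weight_bound:
  fixes w z :: "'a \<Rightarrow> complex"
  assumes "finite S" "a \<notin> S" "\<And>b. b \<in> S \<Longrightarrow> norm (z b) \<le> 1"
    and "\<And>l. l \<le> card S \<Longrightarrow> norm (\<Sum>b\<in>insert a S. w b * z b ^ l) \<le> \<eta>"
  shows "norm (w a) * (\<Prod>b\<in>S. norm (z a - z b)) \<le> 2 ^ card S * \<eta>"
  using assms
proof (induction S arbitrary: w \<eta> rule: finite_induct)
  case empty
  then show ?case using empty(3)[of 0] by simp
next
  case (insert c S)
  define w' where "w' b = w b * (z b - z c)" for b
  have "norm (w' a) * (\<Prod>b\<in>S. norm (z a - z b)) \<le> 2 ^ card S * (2 * \<eta>)"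
  proof (rule insert.IH)
    fix l assume l: "l \<le> card S"
    have fin: "finite (insert a S)" "c \<notin> insert a S" using insert by auto
    have "(\<Sum>b\<in>insert a S. w' b * z b ^ l) = (\<Sum>b\<in>insert c (insert a S). w' b * z b ^ l)"
      using fin by (simp add: w'_def)
    also have "\<dots> = (\<Sum>b\<in>insert a (insert c S). w b * z b ^ Suc l) - z c * (\<Sum>b\<in>insert a (insert c S). w b * z b ^ l)"
      unfolding w'_def sum_distrib_left sum_subtractf[symmetric]
      by (rule sum.cong) (auto simp: algebra_simps)
    also have "norm \<dots> \<le> \<eta> + 1 * \<eta>"
    proof (rule order.trans[OF norm_triangle_ineq4], rule add_mono)
      show "norm (\<Sum>b\<in>insert a (insert c S). w b * z b ^ Suc l) \<le> \<eta>"
        using l insert by (intro insert.prems(3)) auto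
      show "norm (z c * (\<Sum>b\<in>insert a (insert c S). w b * z b ^ l)) \<le> 1 * \<eta>"
        unfolding norm_mult using l insert by (intro mult_mono insert.prems(3)) auto
    qed
    finally show "norm (\<Sum>b\<in>insert a S. w' b * z b ^ l) \<le> 2 * \<eta>" by simp
  qed (use insert in auto)
  then show ?case using insert by (simp add: w'_def norm_mult mult_ac)
qed

text \<open>The powers of z sum to 0, so the n numbers 1 - z ^ i sum to n, while each has norm at
  most n * norm (1 - z).\<close>

lemma root_of_unity_gap:
  fixes z :: complex
  assumes "z ^ n = 1" "z \<noteq> 1" "n > 0"
  shows "1 / real n \<le> norm (1 - z)"
proof -
  have nz: "norm z = 1" using assms by (metis norm_one norm_power power_eq_1_iff norm_ge_zero neq0_conv)
  have pow: "norm (1 - z ^ i) \<le> real i * norm (1 - z)" for i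
  proof (induction i)
    case (Suc i)
    have "1 - z ^ Suc i = (1 - z ^ i) + z ^ i * (1 - z)" by (simp add: algebra_simps)
    then have "norm (1 - z ^ Suc i) \<le> norm (1 - z ^ i) + norm (z ^ i * (1 - z))"
      by (metis norm_triangle_ineq)
    also have "norm (z ^ i * (1 - z)) = norm (1 - z)" using nz by (simp add: norm_mult norm_power)
    finally show ?case using Suc by (simp add: distrib_right)
  qed auto
  have "(\<Sum>i<n. z ^ i) = 0" using assms by (simp add: sum_gp_strict)
  then have "of_nat n = (\<Sum>i<n. 1 - z ^ i)" by (simp add: sum_subtractf)
  then have "real n = norm (\<Sum>i<n. 1 - z ^ i)" by (metis norm_of_nat)
  also have "\<dots> \<le> (\<Sum>i<n. norm (1 - z ^ i))" by (rule norm_sum)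
  also have "\<dots> \<le> (\<Sum>i<n. real n * norm (1 - z))"
    by (intro sum_mono order.trans[OF pow] mult_right_mono) auto
  finally have "real n * 1 \<le> real n * (real n * norm (1 - z))" by simp
  then have "1 \<le> real n * norm (1 - z)" using assms(3) by (simp only: mult_le_cancel_left)
  then show ?thesis using assms(3) by (simp add: field_simps)
qed

section \<open>Masks of digit sets and their products\<close>

text \<open>The Fourier transform of the uniform measure on D.\<close>

definition digit_mask :: "int set \<Rightarrow> real \<Rightarrow> complex" where
  "digit_mask D x = (\<Sum>d\<in>D. ec (of_int d * x)) / of_nat (card D)"

lemma digit_mask_0: "finite D \<Longrightarrow> D \<noteq> {} \<Longrightarrow> digit_mask D 0 = 1"
  by (simp add: digit_mask_def)

lemma digit_mask_add_Ints:
  assumes "y \<in> \<int>" shows "digit_mask D (x + y) = digit_mask D x"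
  unfolding digit_mask_def distrib_left using assms by (simp add: ec_add_Ints)

lemma norm_digit_mask_le: "norm (digit_mask D x) \<le> 1"
proof -
  have "norm (\<Sum>d\<in>D. ec (of_int d * x)) \<le> real (card D)"
    using norm_sum[of "\<lambda>d. ec (of_int d * x)" D] by simp
  then show ?thesis by (auto simp: digit_mask_def norm_divide divide_le_eq_1)
qed

lemma norm_digit_mask_diff_le:
  assumes "\<And>d. d \<in> D \<Longrightarrow> \<bar>real_of_int d\<bar> \<le> C" "finite D" "D \<noteq> {}"
  shows "norm (digit_mask D x - digit_mask D y) \<le> 2 * pi * C * \<bar>x - y\<bar>"
proof -
  have c: "card D > 0" using assms by (simp add: card_gt_0_iff)
  have "norm (\<Sum>d\<in>D. ec (of_int d * x) - ec (of_int d * y)) \<le> (\<Sum>d\<in>D. 2 * pi * C * \<bar>x - y\<bar>)"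
  proof (rule sum_norm_le)
    fix d assume "d \<in> D"
    have "norm (ec (of_int d * x) - ec (of_int d * y)) \<le> 2 * pi * \<bar>of_int d * x - of_int d * y\<bar>"
      by (rule norm_ec_diff_le)
    also have "\<dots> = 2 * pi * (\<bar>real_of_int d\<bar> * \<bar>x - y\<bar>)"
      by (simp add: abs_mult flip: right_diff_distrib)
    also have "\<dots> \<le> 2 * pi * (C * \<bar>x - y\<bar>)"
      using assms(1)[OF \<open>d \<in> D\<close>] by (intro mult_left_mono mult_right_mono) auto
    finally show "norm (ec (of_int d * x) - ec (of_int d * y)) \<le> 2 * pi * C * \<bar>x - y\<bar>" by simp
  qed
  then have "norm (\<Sum>d\<in>D. ec (of_int d * x) - ec (of_int d * y)) / real (card D) \<le> 2 * pi * C * \<bar>x - y\<bar>"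
    using c by (simp add: divide_le_eq mult.commute)
  moreover have "digit_mask D x - digit_mask D y = (\<Sum>d\<in>D. ec (of_int d * x) - ec (of_int d * y)) / of_nat (card D)"
    by (simp add: digit_mask_def sum_subtractf diff_divide_distrib)
  ultimately show ?thesis by (simp add: norm_divide)
qed

text \<open>In the application \<open>D k = B\<^bsub>\<omega>(k+1)\<^esub>\<close> and \<open>M k\<close> is the \<open>n\<^bsub>k+1\<^esub>\<close>-th power of \<open>N\<^bsub>\<omega>(k+1)\<^esub>\<close>: indices
  start at 0 here. The factors \<open>k, \<dots>, j - 1\<close> of the convolution have Fourier transform \<open>G k j\<close>.\<close>

locale moran =
  fixes D :: "nat \<Rightarrow> int set" and M :: "nat \<Rightarrow> nat" and L :: "nat \<Rightarrow> int set" and E :: "nat set"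
    and C \<rho> :: real
  assumes finite_D: "finite (D k)" and card_D: "card (D k) \<ge> 2"
    and D_bound: "d \<in> D k \<Longrightarrow> \<bar>real_of_int d\<bar> \<le> C"
    and M_ge: "M k \<ge> 2"
    and card_D_le: "real (card (D k)) \<le> \<rho> * real (M k)" and \<rho>: "\<rho> < 1"
    and D_distinct: "inj_on (\<lambda>d. d mod int (M k)) (D k)"
    and finite_L: "finite (L k)" and zero_L: "0 \<in> L k"
    and E: "t \<in> E \<Longrightarrow> coprime t (M k)" "t \<in> E \<Longrightarrow> t > 0" and one_E: "1 \<in> E"
    and row: "t \<in> E \<Longrightarrow> d \<in> D k \<Longrightarrow> d' \<in> D k \<Longrightarrow>
      (\<Sum>l\<in>L k. ec (real t * of_int (d - d') * of_int l / real (M k))) = (if d = d' then of_nat (card (D k)) else 0)"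
    and col: "t \<in> E \<Longrightarrow> l \<in> L k \<Longrightarrow> l' \<in> L k \<Longrightarrow> l \<noteq> l' \<Longrightarrow>
      digit_mask (D k) (real t * of_int (l - l') / real (M k)) = 0"
begin

definition P :: "nat \<Rightarrow> nat" where "P k = (\<Prod>i<k. M i)"

definition G :: "nat \<Rightarrow> nat \<Rightarrow> real \<Rightarrow> complex" where
  "G k j \<xi> = (\<Prod>i\<in>{k..<j}. digit_mask (D i) (\<xi> / real (P (Suc i))))"

lemma D_nonempty: "D k \<noteq> {}"
  using card_D[of k] by auto

lemma C_ge: "C \<ge> 0"
  using D_bound D_nonempty[of 0] by (meson abs_ge_zero ex_in_conv order.trans)

lemma \<rho>_pos: "\<rho> > 0"
proof -
  have "0 < real (card (D 0))" using card_D[of 0] by simp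
  also have "\<dots> \<le> \<rho> * real (M 0)" by (rule card_D_le)
  finally show ?thesis by (simp add: zero_less_mult_iff)
qed

lemma P_Suc: "P (Suc k) = P k * M k"
  by (simp add: P_def)

lemma P_0 [simp]: "P 0 = 1"
  by (simp add: P_def)

lemma P_pos: "P k > 0"
  unfolding P_def using M_ge by (intro prod_pos) (metis not_numeral_le_zero gr0I)

lemma P_split: "k \<le> j \<Longrightarrow> P j = P k * (\<Prod>i\<in>{k..<j}. M i)"
  unfolding P_def lessThan_atLeast0 by (rule prod.atLeastLessThan_concat[symmetric]) auto

lemma P_dvd: "k \<le> j \<Longrightarrow> P k dvd P j"
  by (simp add: P_split)

lemma P_growth: "P k * 2 ^ j \<le> P (k + j)"
proof (induction j)
  case (Suc j)
  have "P k * 2 ^ Suc j \<le> P (k + j) * 2" using Suc by simp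
  also have "\<dots> \<le> P (k + j) * M (k + j)" using M_ge by simp
  finally show ?case by (simp add: P_Suc)
qed simp

lemma P_mono: "k \<le> j \<Longrightarrow> P k \<le> P j"
  using P_dvd P_pos by (simp add: dvd_imp_le)

lemma P_ge: "k < P k"
  using P_growth[of 0 k] less_exp[of k] by (simp del: less_exp)

lemma coprime_prod_M: "t \<in> E \<Longrightarrow> coprime t (\<Prod>i\<in>{k..<j}. M i)"
  by (intro prod_coprime_right E)

lemma G_refl [simp]: "G k k \<xi> = 1"
  by (simp add: G_def)

lemma G_Suc: "k \<le> j \<Longrightarrow> G k (Suc j) \<xi> = G k j \<xi> * digit_mask (D j) (\<xi> / real (P (Suc j)))"
  by (simp add: G_def)

lemma G_split: "k \<le> j \<Longrightarrow> j \<le> l \<Longrightarrow> G k l \<xi> = G k j \<xi> * G j l \<xi>"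
  unfolding G_def by (rule prod.atLeastLessThan_concat[symmetric])

lemma G_0 [simp]: "G k j 0 = 1"
  by (simp add: G_def digit_mask_0 finite_D D_nonempty)

lemma G_add_period: "G k j (\<xi> + real (P j) * of_int z) = G k j \<xi>"
  unfolding G_def
proof (rule prod.cong[OF refl])
  fix i assume "i \<in> {k..<j}"
  then obtain q where q: "P j = P (Suc i) * q" using P_dvd[of "Suc i" j] by (auto elim: dvdE)
  have "(\<xi> + real (P j) * of_int z) / real (P (Suc i)) = \<xi> / real (P (Suc i)) + of_int (int q * z)"
    using P_pos[of "Suc i"] by (simp add: q field_simps)
  then show "digit_mask (D i) ((\<xi> + real (P j) * of_int z) / real (P (Suc i))) = digit_mask (D i) (\<xi> / real (P (Suc i)))"
    by (simp only: digit_mask_add_Ints[OF Ints_of_int])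
qed

text \<open>\<open>P\<close> at least doubles at every level, so the Lipschitz constants of the
  factors form a series dominated by a geometric one with sum 2. The bound is uniform in j and thus
  passes to infinite products.\<close>

lemma norm_G_diff_le: "norm (G k j \<xi> - G k j \<eta>) \<le> 4 * pi * C * \<bar>\<xi> - \<eta>\<bar> / real (P (Suc k))"
proof -
  let ?B = "2 * pi * C * \<bar>\<xi> - \<eta>\<bar>"
  have B: "?B \<ge> 0" using C_ge by simp
  have "norm (G k j \<xi> - G k j \<eta>) \<le> (\<Sum>i\<in>{k..<j}. norm (digit_mask (D i) (\<xi> / real (P (Suc i))) - digit_mask (D i) (\<eta> / real (P (Suc i)))))"
    unfolding G_def by (intro norm_prod_diff norm_digit_mask_le)
  also have "\<dots> \<le> (\<Sum>i\<in>{k..<j}. ?B / real (P (Suc k)) * (1/2) ^ (i - k))"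
  proof (rule sum_mono)
    fix i assume i: "i \<in> {k..<j}"
    have "norm (digit_mask (D i) (\<xi> / real (P (Suc i))) - digit_mask (D i) (\<eta> / real (P (Suc i)))) \<le> 2 * pi * C * \<bar>\<xi> / real (P (Suc i)) - \<eta> / real (P (Suc i))\<bar>"
      by (intro norm_digit_mask_diff_le D_bound finite_D D_nonempty)
    also have "\<dots> = ?B / real (P (Suc i))"
      by (simp add: abs_divide flip: diff_divide_distrib)
    also have "\<dots> \<le> ?B / (real (P (Suc k)) * 2 ^ (i - k))"
    proof (rule divide_left_mono)
      have "P (Suc k) * 2 ^ (i - k) \<le> P (Suc k + (i - k))" by (rule P_growth)
      also have "Suc k + (i - k) = Suc i" using i by simp
      finally have "real (P (Suc k) * 2 ^ (i - k)) \<le> real (P (Suc i))" by (rule of_nat_mono)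
      then show "real (P (Suc k)) * 2 ^ (i - k) \<le> real (P (Suc i))" by simp
    qed (use B P_pos in auto)
    also have "\<dots> = ?B / real (P (Suc k)) * (1/2) ^ (i - k)"
      by (simp add: power_divide)
    finally show "norm (digit_mask (D i) (\<xi> / real (P (Suc i))) - digit_mask (D i) (\<eta> / real (P (Suc i)))) \<le> \<dots>" .
  qed
  also have "\<dots> = ?B / real (P (Suc k)) * (\<Sum>i\<in>{k..<j}. (1/2) ^ (i - k))"
    by (simp add: sum_distrib_left)
  also have "(\<Sum>i\<in>{k..<j}. (1/2::real) ^ (i - k)) = (\<Sum>i<j-k. (1/2) ^ i)"
    by (rule sum.reindex_bij_witness[of _ "\<lambda>i. i + k" "\<lambda>i. i - k"]) auto
  also have "?B / real (P (Suc k)) * (\<Sum>i<j-k. (1/2) ^ i) \<le> ?B / real (P (Suc k)) * 2"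
    using B by (intro mult_left_mono) (auto simp: sum_gp_strict)
  finally show ?thesis by simp
qed

lemma norm_G_diff_1_le: "norm (G k j \<xi> - 1) \<le> 4 * pi * C * \<bar>\<xi>\<bar> / real (P (Suc k))"
  using norm_G_diff_le[of k j \<xi> 0] by simp

text \<open>The constant is twice that of \<open>norm_G_diff_1_le\<close>, which keeps the deviation
  from 1 below 1/2.\<close>

lemma norm_G_ge_half:
  assumes "8 * pi * C * \<bar>\<xi>\<bar> \<le> real (P (Suc k))"
  shows "norm (G k j \<xi>) \<ge> 1/2"
proof -
  have "4 * pi * C * \<bar>\<xi>\<bar> / real (P (Suc k)) \<le> 1/2"
    using assms P_pos[of "Suc k"] by (simp add: field_simps)
  then have "norm (G k j \<xi> - 1) \<le> 1/2" using norm_G_diff_1_le[of k j \<xi>] by linarith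
  moreover have "1 \<le> norm (G k j \<xi>) + norm (G k j \<xi> - 1)"
    using norm_triangle_ineq4[of "G k j \<xi>" "G k j \<xi> - 1"] by simp
  ultimately show ?thesis by linarith
qed

section \<open>Equi-positivity of the tails\<close>

text \<open>The frequencies are the numbers with digits from the \<open>D i\<close> in the mixed
  radix of the \<open>M i\<close>; each new level appends a lowest digit, a \<mapsto>
  \<open>?m * a + d\<close>. Residues modulo \<open>?m\<close> recover d, and then a is recovered
  modulo the earlier product.\<close>

lemma G_expansion:
  "\<exists>A. finite A \<and> card A = (\<Prod>i\<in>{k..<k+J}. card (D i)) \<and>
     inj_on (\<lambda>a. a mod int (\<Prod>i\<in>{k..<k+J}. M i)) A \<and>
     (\<forall>\<xi>. G k (k + J) \<xi> = (\<Sum>a\<in>A. ec (of_int a * \<xi> / real (P (k + J)))) / of_nat (card A))"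
proof (induction J)
  case 0
  show ?case by (intro exI[of _ "{0}"]) auto
next
  case (Suc J)
  let ?Q = "int (\<Prod>i\<in>{k..<k+J}. M i)" and ?m = "int (M (k + J))"
  obtain A where A: "finite A" "card A = (\<Prod>i\<in>{k..<k+J}. card (D i))"
    "inj_on (\<lambda>a. a mod ?Q) A"
    "\<And>\<xi>. G k (k + J) \<xi> = (\<Sum>a\<in>A. ec (of_int a * \<xi> / real (P (k + J)))) / of_nat (card A)"
    using Suc.IH by blast
  define f where "f = (\<lambda>(a, d). ?m * a + d)"
  have eq: "a = a' \<and> d = d'"
    if "a \<in> A" "a' \<in> A" "d \<in> D (k + J)" "d' \<in> D (k + J)"
      "(?m * a + d) mod (?m * ?Q) = (?m * a' + d') mod (?m * ?Q)" for a a' d d'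
  proof -
    have dv: "?m * ?Q dvd (?m * a + d) - (?m * a' + d')" using that(5) by (simp only: mod_eq_dvd_iff)
    then have "?m dvd (?m * a + d) - (?m * a' + d')" by (rule dvd_mult_left)
    then have "?m dvd ?m * (a - a') + (d - d')" by (simp add: algebra_simps)
    then have "?m dvd d - d'" by (simp add: dvd_add_right_iff)
    then have d: "d = d'" using D_distinct[of "k + J"] that(3,4) by (auto simp: inj_on_def mod_eq_dvd_iff)
    then have "?m * ?Q dvd ?m * (a - a')" using dv by (simp add: algebra_simps)
    moreover have "?m \<noteq> 0" using M_ge[of "k + J"] by auto
    ultimately have "?Q dvd a - a'" by (simp only: dvd_mult_cancel_left) auto
    then have "a = a'" using A(3) that(1,2) by (auto simp: inj_on_def mod_eq_dvd_iff)
    then show ?thesis using d by simp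
  qed
  have inj: "inj_on f (A \<times> D (k + J))"
  proof (rule inj_onI)
    fix u v assume uv: "u \<in> A \<times> D (k + J)" "v \<in> A \<times> D (k + J)" "f u = f v"
    obtain a d a' d' where "u = (a, d)" "v = (a', d')" by (cases u, cases v)
    then show "u = v" using uv eq[of a a' d d'] by (simp add: f_def)
  qed
  have card: "card (f ` (A \<times> D (k + J))) = card A * card (D (k + J))"
    using card_image[OF inj] by (simp add: card_cartesian_product)
  show ?case
  proof (intro exI[of _ "f ` (A \<times> D (k + J))"] conjI allI)
    show "finite (f ` (A \<times> D (k + J)))" using A(1) finite_D by simp
    show "card (f ` (A \<times> D (k + J))) = (\<Prod>i\<in>{k..<k+Suc J}. card (D i))"
      using card A(2) by simp
    show "inj_on (\<lambda>a. a mod int (\<Prod>i\<in>{k..<k+Suc J}. M i)) (f ` (A \<times> D (k + J)))"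
    proof (rule inj_onI)
      fix u v assume uv: "u \<in> f ` (A \<times> D (k + J))" "v \<in> f ` (A \<times> D (k + J))"
        "u mod int (\<Prod>i\<in>{k..<k+Suc J}. M i) = v mod int (\<Prod>i\<in>{k..<k+Suc J}. M i)"
      obtain a d a' d' where *: "a \<in> A" "a' \<in> A" "d \<in> D (k + J)" "d' \<in> D (k + J)"
        "u = ?m * a + d" "v = ?m * a' + d'" using uv(1,2) by (auto simp: f_def)
      have "int (\<Prod>i\<in>{k..<k+Suc J}. M i) = ?m * ?Q" by simp
      then show "u = v" using eq[OF *(1-4)] uv(3) *(5,6) by (simp add: mult.commute)
    qed
    fix \<xi>
    have "G k (k + Suc J) \<xi> = ((\<Sum>a\<in>A. ec (of_int a * \<xi> / real (P (k + J)))) * (\<Sum>d\<in>D (k + J). ec (of_int d * (\<xi> / real (P (Suc (k + J))))))) / of_nat (card A * card (D (k + J)))"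
      by (simp add: G_Suc A(4) digit_mask_def)
    also have "(\<Sum>a\<in>A. ec (of_int a * \<xi> / real (P (k + J)))) * (\<Sum>d\<in>D (k + J). ec (of_int d * (\<xi> / real (P (Suc (k + J))))))
      = (\<Sum>(a, d)\<in>A \<times> D (k + J). ec (of_int (f (a, d)) * \<xi> / real (P (k + Suc J))))"
      unfolding sum_product sum.cartesian_product
    proof (rule sum.cong[OF refl], clarify)
      fix a d
      have "real_of_int (f (a, d)) * \<xi> / real (P (k + Suc J)) = of_int a * \<xi> / real (P (k + J)) + of_int d * (\<xi> / real (P (Suc (k + J))))"
        using M_ge[of "k + J"] P_pos[of "k + J"] by (simp add: f_def P_Suc field_simps)
      then show "ec (of_int a * \<xi> / real (P (k + J))) * ec (of_int d * (\<xi> / real (P (Suc (k + J))))) = ec (of_int (f (a, d)) * \<xi> / real (P (k + Suc J)))"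
        by (simp only: ec_add)
    qed
    also have "\<dots> = (\<Sum>a\<in>f ` (A \<times> D (k + J)). ec (of_int a * \<xi> / real (P (k + Suc J))))"
      using sum.reindex[OF inj, of "\<lambda>a. ec (of_int a * \<xi> / real (P (k + Suc J)))"] by (simp add: o_def split_beta)
    finally show "G k (k + Suc J) \<xi> = (\<Sum>a\<in>f ` (A \<times> D (k + J)). ec (of_int a * \<xi> / real (P (k + Suc J)))) / of_nat (card (f ` (A \<times> D (k + J))))"
      by (simp add: card)
  qed
qed

text \<open>On a progression with step \<open>t * P k\<close> the transform \<open>G k (k + J)\<close> is an exponential sum with \<open>n\<close>
  distinct frequencies, so it cannot be small at \<open>n\<close> consecutive points. Since \<open>n\<close> is much smaller than \<open>Q\<close>
  for large \<open>J\<close>, all these points lie where the remaining factors are close to 1.\<close>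

lemma block_lower_bound:
  fixes \<xi> :: real and k J :: nat
  assumes t: "t \<in> E"
  defines "Q \<equiv> (\<Prod>i\<in>{k..<k+J}. M i)" and "n \<equiv> (\<Prod>i\<in>{k..<k+J}. card (D i))"
  obtains l where "l < n" "norm (G k (k + J) (\<xi> + real t * real (P k) * real l)) \<ge> (1 / (2 * real Q)) ^ Q"
proof -
  obtain A where A: "finite A" "card A = n" "inj_on (\<lambda>a. a mod int Q) A"
    "\<And>\<xi>. G k (k + J) \<xi> = (\<Sum>a\<in>A. ec (of_int a * \<xi> / real (P (k + J)))) / of_nat (card A)"
    using G_expansion[of k J] unfolding Q_def n_def by blast
  have Q: "Q > 0" unfolding Q_def using M_ge by (intro prod_pos) (metis not_numeral_le_zero gr0I)
  have PQ: "P (k + J) = P k * Q" unfolding Q_def by (rule P_split) simp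
  have n: "n > 0" unfolding n_def using card_D by (intro prod_pos) (metis not_numeral_le_zero gr0I)
  have nQ: "n \<le> Q"
  proof -
    have "real n \<le> (\<Prod>i\<in>{k..<k+J}. real (M i))" unfolding n_def of_nat_prod
    proof (rule prod_mono)
      fix i
      have "real (card (D i)) \<le> \<rho> * real (M i)" by (rule card_D_le)
      also have "\<dots> \<le> 1 * real (M i)" using \<rho> by (intro mult_right_mono) auto
      finally show "0 \<le> real (card (D i)) \<and> real (card (D i)) \<le> real (M i)" by simp
    qed
    then show ?thesis by (simp add: Q_def flip: of_nat_prod)
  qed
  \<comment> \<open>Moving \<xi> by \<open>t * P k\<close> multiplies the exponential with frequency
    a by the Q-th root of unity \<open>z a\<close>, so the values along the progression are power
    sums in these nodes.\<close>
  define z where "z a = ec (of_int a * (real t / real Q))" for a :: int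
  define w where "w a = ec (of_int a * \<xi> / real (P (k + J))) / of_nat n" for a
  have expand: "G k (k + J) (\<xi> + real t * real (P k) * real l) = (\<Sum>a\<in>A. w a * z a ^ l)" for l
    unfolding A(4) A(2) sum_divide_distrib
  proof (rule sum.cong[OF refl])
    fix a
    have "of_int a * (\<xi> + real t * real (P k) * real l) / real (P (k + J)) = of_int a * \<xi> / real (P (k + J)) + real l * (of_int a * (real t / real Q))"
      using P_pos[of k] Q unfolding PQ by (simp add: field_simps)
    then show "ec (of_int a * (\<xi> + real t * real (P k) * real l) / real (P (k + J))) / of_nat n = w a * z a ^ l"
      by (simp only: w_def z_def ec_add ec_mult_nat times_divide_eq_left)
  qed
  have gap: "1 / real Q \<le> norm (z a - z b)" if "a \<in> A" "b \<in> A" "a \<noteq> b" for a b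
  proof -
    define u where "u = ec (of_int (b - a) * (real t / real Q))"
    have "of_int b * (real t / real Q) = of_int a * (real t / real Q) + of_int (b - a) * (real t / real Q)"
      unfolding distrib_right[symmetric] by simp
    then have "z b = z a * u" unfolding z_def u_def by (simp only: ec_add)
    then have "z a - z b = z a * (1 - u)" by (simp add: right_diff_distrib)
    then have "norm (z a - z b) = norm (1 - u)" by (simp add: norm_mult z_def)
    moreover have "1 / real Q \<le> norm (1 - u)"
    proof (rule root_of_unity_gap)
      have "u ^ Q = ec (of_int ((b - a) * int t))"
        unfolding u_def ec_mult_nat[symmetric] using Q by simp
      then show "u ^ Q = 1" by (simp only: ec_of_int)
      \<comment> \<open>Multiplication by t keeps the frequencies distinct modulo Q because t is
        coprime to Q.\<close>
      show "u \<noteq> 1"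
      proof
        assume "u = 1"
        then obtain m where m: "of_int (b - a) * (real t / real Q) = of_int m"
          unfolding u_def ec_eq_1_iff by (auto elim: Ints_cases)
        then have "real_of_int ((b - a) * int t) = real_of_int (m * int Q)" using Q by (simp add: field_simps)
        then have "(b - a) * int t = m * int Q" by (simp only: of_int_eq_iff)
        then have "int Q dvd (b - a) * int t" by simp
        moreover have "coprime (int Q) (int t)"
          using coprime_prod_M[OF t, of k "k + J"] by (simp add: Q_def coprime_commute del: of_nat_prod)
        ultimately have "int Q dvd b - a" by (simp add: coprime_dvd_mult_left_iff)
        then show False using A(3) that by (auto simp: inj_on_def mod_eq_dvd_iff)
      qed
    qed (use Q in auto)
    ultimately show ?thesis by simp
  qed
  have "\<exists>l<n. norm (G k (k + J) (\<xi> + real t * real (P k) * real l)) \<ge> (1 / (2 * real Q)) ^ n"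
  proof (rule ccontr)
    assume contra: "\<not> ?thesis"
    \<comment> \<open>If all n values were below (1 / (2 * Q)) ^ n, the Vandermonde bound would
      force the weight of a, of modulus 1 / n, down to at most 1 / (2 * Q), against n \<le>
      Q.\<close>
    obtain a where a: "a \<in> A" using A(2) n by fastforce
    define S where "S = A - {a}"
    have S: "finite S" "a \<notin> S" "insert a S = A" "card S = n - 1" using A(1,2) a by (auto simp: S_def)
    have weight: "norm (w a) * (\<Prod>b\<in>S. norm (z a - z b)) \<le> 2 ^ card S * (1 / (2 * real Q)) ^ n"
    proof (rule power_sum_weight_bound[OF S(1,2)])
      fix l assume "l \<le> card S"
      then have "l < n" using n S(4) by simp
      then show "norm (\<Sum>b\<in>insert a S. w b * z b ^ l) \<le> (1 / (2 * real Q)) ^ n"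
        using contra unfolding S(3) expand[symmetric] by force
    qed (simp add: z_def)
    have wa: "norm (w a) = 1 / real n" by (simp add: w_def norm_divide)
    have "(1 / real Q) ^ (n - 1) = (\<Prod>b\<in>S. 1 / real Q)" using S(4) by simp
    also have "\<dots> \<le> (\<Prod>b\<in>S. norm (z a - z b))"
      using a by (intro prod_mono) (auto simp: S_def intro!: gap)
    finally have "1 / real n * (1 / real Q) ^ (n - 1) \<le> 1 / real n * (\<Prod>b\<in>S. norm (z a - z b))"
      by (rule mult_left_mono) simp
    also have "\<dots> \<le> 2 ^ (n - 1) * (1 / (2 * real Q)) ^ n"
      using weight unfolding wa S(4) .
    also have "2 ^ (n - 1) * (1 / (2 * real Q)) ^ n = (1 / (2 * real Q)) * (1 / real Q) ^ (n - 1)"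
      using n by (cases n) (auto simp: power_divide power_mult_distrib)
    finally have "1 / real n \<le> 1 / (2 * real Q)"
      by (rule mult_right_le_imp_le) (use Q in simp)
    then have "2 * real Q \<le> real n" using n Q by (simp add: field_simps)
    then show False using nQ Q by linarith
  qed
  then obtain l where l: "l < n" "norm (G k (k + J) (\<xi> + real t * real (P k) * real l)) \<ge> (1 / (2 * real Q)) ^ n" by blast
  \<comment> \<open>The exponent n is weakened to Q so that the bound depends on Q alone, and can
    later be replaced by one that does not depend on k.\<close>
  have "(1 / (2 * real Q)) ^ Q \<le> (1 / (2 * real Q)) ^ n"
    using Q by (intro power_decreasing nQ) auto
  then show ?thesis using that[OF l(1)] l(2) by linarith
qed

text \<open>A lower bound for the transform of the tail beyond level k, phrased through partial
  products because no limit is at hand inside the locale.\<close>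

definition good :: "nat \<Rightarrow> real \<Rightarrow> nat \<Rightarrow> real \<Rightarrow> bool" where
  "good t \<epsilon> k x \<longleftrightarrow> (\<forall>\<^sub>F j in sequentially. norm (G k j (real t * x)) \<ge> \<epsilon>)"

text \<open>A residue is represented in [P k, 2 * P k) and not in [0, P k): the lower end makes new
  frequencies large, as the diagonal argument requires, and costs only a factor 2 in size.\<close>

lemma int_shift: obtains z :: int where "lam + int (P k) * z \<ge> int (P k)" "lam + int (P k) * z < 2 * int (P k)"
proof (rule that[of "1 - lam div int (P k)"])
  have "lam + int (P k) * (1 - lam div int (P k)) = int (P k) + lam mod int (P k)"
    by (simp add: algebra_simps minus_mult_div_eq_mod)
  moreover have "0 \<le> lam mod int (P k)" "lam mod int (P k) < int (P k)" using P_pos[of k] by simp_all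
  ultimately show "lam + int (P k) * (1 - lam div int (P k)) \<ge> int (P k)"
    "lam + int (P k) * (1 - lam div int (P k)) < 2 * int (P k)" by auto
qed

lemma equi_positive_unbounded:
  assumes "t \<in> E" and unb: "\<And>B. \<exists>k. M k > B"
  shows "\<exists>k\<ge>k0. \<forall>lam::int. \<exists>z::int. lam + int (P k) * z \<ge> int (P k) \<and> good t (1/2) k (of_int (lam + int (P k) * z))"
proof -
  \<comment> \<open>The first summand forces k \<ge> k0. The second makes P (Suc k) = P k * M k
    exceed 8 * pi * C times t * (2 * P k), where 2 * P k bounds the representative from
    \<open>int_shift\<close>.\<close>
  define B where "B = Max (M ` {..k0}) + nat \<lceil>8 * pi * C * real t * 2\<rceil>"
  obtain k where k: "M k > B" using unb by blast
  have "k \<ge> k0"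
  proof (rule ccontr)
    assume "\<not> k \<ge> k0"
    then have "M k \<le> Max (M ` {..k0})" by (intro Max_ge) auto
    then show False using k by (simp add: B_def)
  qed
  moreover have "\<exists>z::int. lam + int (P k) * z \<ge> int (P k) \<and> good t (1/2) k (of_int (lam + int (P k) * z))" for lam
  proof -
    obtain z where z: "lam + int (P k) * z \<ge> int (P k)" "lam + int (P k) * z < 2 * int (P k)"
      using int_shift by blast
    have "8 * pi * C * real t * 2 \<le> real (M k)" using k unfolding B_def by linarith
    then have "8 * pi * C * real t * 2 * real (P k) \<le> real (P (Suc k))"
      unfolding P_Suc of_nat_mult by (simp only: mult.commute[of "real (P k)"] mult_right_mono of_nat_0_le_iff)
    moreover have "\<bar>real t * of_int (lam + int (P k) * z)\<bar> \<le> real t * (2 * real (P k))"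
    proof -
      have "0 \<le> lam + int (P k) * z" using z(1) by linarith
      then have "\<bar>real_of_int (lam + int (P k) * z)\<bar> = of_int (lam + int (P k) * z)" by linarith
      also have "\<dots> \<le> of_int (2 * int (P k))" using z(2) by (simp only: of_int_le_iff)
      finally show ?thesis by (simp only: abs_mult) (simp add: mult_left_mono)
    qed
    then have "8 * pi * C * \<bar>real t * of_int (lam + int (P k) * z)\<bar> \<le> 8 * pi * C * (real t * (2 * real (P k)))"
      using C_ge by (intro mult_left_mono) auto
    ultimately have "8 * pi * C * \<bar>real t * of_int (lam + int (P k) * z)\<bar> \<le> real (P (Suc k))"
      by (simp add: algebra_simps)
    then show ?thesis using z(1) norm_G_ge_half by (auto simp: good_def)
  qed
  ultimately show ?thesis by blast
qed

lemma equi_positive_bounded: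
  assumes t: "t \<in> E" and B: "\<And>k. M k \<le> B"
  shows "\<exists>\<epsilon>>0. \<forall>k. \<forall>lam::int. \<exists>z::int. lam + int (P k) * z \<ge> int (P k) \<and> good t \<epsilon> k (of_int (lam + int (P k) * z))"
proof -
  have B2: "B \<ge> 2" using M_ge[of 0] B[of 0] by linarith
  \<comment> \<open>The point y found below satisfies y \<le> P k * (2 + l) \<le> 3 * n * P k, and n
    \<le> \<rho> ^ J * Q, so y \<le> 3 * \<rho> ^ J * P (k + J). This J brings t * y into the range
    of \<open>norm_G_ge_half\<close> for the factors after the block.\<close>
  obtain J where J: "8 * pi * C * (3 * real t) * \<rho> ^ J \<le> 1"
  proof (cases "C = 0")
    case False
    then have "8 * pi * C * (3 * real t) > 0" using C_ge E(2)[OF t] by simp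
    moreover obtain J where "\<rho> ^ J < 1 / (8 * pi * C * (3 * real t))"
      using real_arch_pow_inv[OF _ \<rho>] calculation by (meson divide_pos_pos zero_less_one)
    ultimately show ?thesis using that[of J] by (simp add: field_simps)
  qed (use that[of 0] in simp)
  \<comment> \<open>\<open>R\<close> bounds the block product Q at every k, which makes \<epsilon>
    independent of k. The last division by 2 in \<epsilon> pays for the factors after the
    block.\<close>
  define R where "R = B ^ J"
  have R: "R > 0" using B2 by (simp add: R_def)
  define \<epsilon> where "\<epsilon> = (1 / (2 * real R)) ^ R / 2"
  have "\<exists>z::int. lam + int (P k) * z \<ge> int (P k) \<and> good t \<epsilon> k (of_int (lam + int (P k) * z))" for k lam
  proof -
    define Q where "Q = (\<Prod>i\<in>{k..<k+J}. M i)"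
    define n where "n = (\<Prod>i\<in>{k..<k+J}. card (D i))"
    have Q: "Q > 0" unfolding Q_def using M_ge by (intro prod_pos) (metis not_numeral_le_zero gr0I)
    have n: "n > 0" unfolding n_def using card_D by (intro prod_pos) (metis not_numeral_le_zero gr0I)
    have PQ: "P (k + J) = P k * Q" unfolding Q_def by (rule P_split) simp
    have QR: "Q \<le> R" unfolding Q_def R_def using prod_mono[of "{k..<k+J}" M "\<lambda>_. B"] B by simp
    have nQ: "real n \<le> \<rho> ^ J * real Q"
    proof -
      have "real n \<le> (\<Prod>i\<in>{k..<k+J}. \<rho> * real (M i))" unfolding n_def of_nat_prod
        by (rule prod_mono) (auto intro: card_D_le)
      then show ?thesis by (simp add: Q_def prod.distrib)
    qed
    obtain z where z: "lam + int (P k) * z \<ge> int (P k)" "lam + int (P k) * z < 2 * int (P k)"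
      using int_shift by blast
    obtain l where l: "l < n" "norm (G k (k + J) (real t * of_int (lam + int (P k) * z) + real t * real (P k) * real l)) \<ge> (1 / (2 * real Q)) ^ Q"
      using block_lower_bound[OF t, where k = k and J = J] unfolding Q_def n_def by blast
    define y where "y = lam + int (P k) * (z + int l)"
    have y: "real t * of_int y = real t * of_int (lam + int (P k) * z) + real t * real (P k) * real l"
      by (simp add: y_def algebra_simps)
    have y_ge: "y \<ge> int (P k)" unfolding y_def distrib_left
      using z(1) mult_nonneg_nonneg[of "int (P k)" "int l"] by linarith
    have "y \<le> 2 * int (P k) + int (P k) * int l" using z(2) by (simp add: y_def distrib_left)
    also have "\<dots> = int (P k) * (2 + int l)" by (simp add: algebra_simps)
    also have "\<dots> \<le> int (P k) * (3 * int n)" using l(1) by (intro mult_left_mono) auto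
    finally have "real_of_int y \<le> of_int (int (P k) * (3 * int n))" by (simp only: of_int_le_iff)
    then have "real_of_int y \<le> real (P k) * (3 * real n)" by simp
    also have "\<dots> \<le> real (P k) * (3 * (\<rho> ^ J * real Q))" using nQ by (intro mult_left_mono) auto
    also have "\<dots> = 3 * \<rho> ^ J * real (P (k + J))" by (simp add: PQ)
    also have "\<dots> \<le> 3 * \<rho> ^ J * real (P (Suc (k + J)))"
      using P_mono[of "k + J" "Suc (k + J)"] \<rho>_pos by (intro mult_left_mono) auto
    finally have "8 * pi * C * real t * of_int y \<le> 8 * pi * C * real t * (3 * \<rho> ^ J * real (P (Suc (k + J))))"
      using C_ge by (intro mult_left_mono) auto
    also have "\<dots> = 8 * pi * C * (3 * real t) * \<rho> ^ J * real (P (Suc (k + J)))" by simp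
    also have "\<dots> \<le> 1 * real (P (Suc (k + J)))" by (intro mult_right_mono J) auto
    finally have small: "8 * pi * C * \<bar>real t * of_int y\<bar> \<le> real (P (Suc (k + J)))"
      using y_ge by (simp add: abs_mult mult_ac)
    have "norm (G k j (real t * of_int y)) \<ge> \<epsilon>" if "j \<ge> k + J" for j
    proof -
      have "(1 / (2 * real R)) ^ R \<le> (1 / (2 * real R)) ^ Q"
        using R by (intro power_decreasing QR) auto
      also have "\<dots> \<le> (1 / (2 * real Q)) ^ Q"
        using QR Q by (intro power_mono) (auto simp: field_simps)
      also have "\<dots> \<le> norm (G k (k + J) (real t * of_int y))" using l(2) y by simp
      finally have 1: "(1 / (2 * real R)) ^ R \<le> norm (G k (k + J) (real t * of_int y))" .
      have 2: "1 / 2 \<le> norm (G (k + J) j (real t * of_int y))"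
        by (rule norm_G_ge_half[OF small])
      have "G k j (real t * of_int y) = G k (k + J) (real t * of_int y) * G (k + J) j (real t * of_int y)"
        using that by (intro G_split) auto
      then show ?thesis using mult_mono[OF 1 2] by (simp add: \<epsilon>_def norm_mult)
    qed
    then have "good t \<epsilon> k (of_int y)" unfolding good_def eventually_sequentially by blast
    then show ?thesis using y_ge unfolding y_def by blast
  qed
  moreover have "\<epsilon> > 0" using R by (simp add: \<epsilon>_def)
  ultimately show ?thesis by blast
qed

lemma equi_positive:
  assumes "t \<in> E"
  shows "\<exists>\<epsilon>>0. \<forall>k0. \<exists>k\<ge>k0. \<forall>lam::int. \<exists>z::int. lam + int (P k) * z \<ge> int (P k) \<and> good t \<epsilon> k (of_int (lam + int (P k) * z))"
proof (cases "\<exists>B. \<forall>k. M k \<le> B")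
  case True
  then show ?thesis using equi_positive_bounded[OF assms] by (meson order_refl)
next
  case False
  then show ?thesis using equi_positive_unbounded[OF assms]
    by (intro exI[of _ "1/2"]) (auto simp: not_le)
qed

section \<open>Finite spectra\<close>

text \<open>For all t in E at once, t times \<Lambda> is a spectrum of the K-th partial convolution,
  expressed through its Fourier transform: the first condition is Parseval's identity for
  exponentials, the second is orthogonality.\<close>

definition finite_spectrum :: "nat \<Rightarrow> int set \<Rightarrow> bool" where
  "finite_spectrum K \<Lambda> \<longleftrightarrow> finite \<Lambda> \<and> (\<forall>t\<in>E. (\<forall>\<xi>. (\<Sum>a\<in>\<Lambda>. (norm (G 0 K (\<xi> + real t * of_int a)))\<^sup>2) = 1) \<and>
     (\<forall>a\<in>\<Lambda>. \<forall>b\<in>\<Lambda>. a \<noteq> b \<longrightarrow> G 0 K (real t * of_int (a - b)) = 0))"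

lemma finite_spectrum_imp_finite: "finite_spectrum K \<Lambda> \<Longrightarrow> finite \<Lambda>"
  by (simp add: finite_spectrum_def)

lemma finite_spectrum_sum: "finite_spectrum K \<Lambda> \<Longrightarrow> t \<in> E \<Longrightarrow> (\<Sum>a\<in>\<Lambda>. (norm (G 0 K (\<xi> + real t * of_int a)))\<^sup>2) = 1"
  by (simp add: finite_spectrum_def)

lemma finite_spectrum_orthogonal: "finite_spectrum K \<Lambda> \<Longrightarrow> t \<in> E \<Longrightarrow> a \<in> \<Lambda> \<Longrightarrow> b \<in> \<Lambda> \<Longrightarrow> a \<noteq> b \<Longrightarrow> G 0 K (real t * of_int (a - b)) = 0"
  by (simp add: finite_spectrum_def)

lemma finite_spectrum_0: "finite_spectrum 0 {0}"
  by (simp add: finite_spectrum_def)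

text \<open>Expanding the square gives a double sum over the digits. The shift x contributes a
  factor that does not depend on l, so \<open>row\<close> kills everything off the diagonal.\<close>

lemma digit_mask_row_sum:
  assumes t: "t \<in> E"
  shows "(\<Sum>l\<in>L k. (norm (digit_mask (D k) (x + real t * of_int l / real (M k))))\<^sup>2) = 1"
proof -
  let ?n = "of_nat (card (D k)) :: complex"
  have n: "?n \<noteq> 0" using card_D[of k] by auto
  have "complex_of_real (\<Sum>l\<in>L k. (norm (digit_mask (D k) (x + real t * of_int l / real (M k))))\<^sup>2)
     = (\<Sum>l\<in>L k. \<Sum>d\<in>D k. \<Sum>d'\<in>D k. ec (of_int (d - d') * x) * ec (real t * of_int (d - d') * of_int l / real (M k)) / (?n * ?n))"
    unfolding of_real_sum
  proof (rule sum.cong[OF refl])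
    fix l
    let ?y = "x + real t * of_int l / real (M k)"
    have "complex_of_real ((norm (digit_mask (D k) ?y))\<^sup>2) = digit_mask (D k) ?y * cnj (digit_mask (D k) ?y)"
      by (rule complex_norm_square)
    also have "\<dots> = (\<Sum>d\<in>D k. \<Sum>d'\<in>D k. ec (of_int d * ?y) * cnj (ec (of_int d' * ?y))) / (?n * ?n)"
      by (simp add: digit_mask_def sum_product)
    also have "\<dots> = (\<Sum>d\<in>D k. \<Sum>d'\<in>D k. ec (of_int d * ?y) * cnj (ec (of_int d' * ?y)) / (?n * ?n))"
      by (simp add: sum_divide_distrib)
    also have "\<dots> = (\<Sum>d\<in>D k. \<Sum>d'\<in>D k. ec (of_int (d - d') * x) * ec (real t * of_int (d - d') * of_int l / real (M k)) / (?n * ?n))"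
      unfolding ec_diff[symmetric] ec_add[symmetric] by (simp add: algebra_simps diff_divide_distrib)
    finally show "complex_of_real ((norm (digit_mask (D k) ?y))\<^sup>2) = \<dots>" .
  qed
  also have "\<dots> = (\<Sum>d\<in>D k. \<Sum>d'\<in>D k. \<Sum>l\<in>L k. ec (of_int (d - d') * x) * ec (real t * of_int (d - d') * of_int l / real (M k)) / (?n * ?n))"
    by (subst sum.swap) (rule sum.cong[OF refl], rule sum.swap)
  also have "\<dots> = (\<Sum>d\<in>D k. \<Sum>d'\<in>D k. ec (of_int (d - d') * x) * (if d = d' then ?n else 0) / (?n * ?n))"
    by (intro sum.cong refl)
      (simp only: row[OF t] sum_divide_distrib[symmetric] sum_distrib_left[symmetric])
  also have "\<dots> = (\<Sum>d\<in>D k. \<Sum>d'\<in>D k. (if d = d' then 1 / ?n else 0))"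
    by (intro sum.cong refl) auto
  also have "\<dots> = (\<Sum>d\<in>D k. 1 / ?n)"
    using finite_D by (intro sum.cong refl) simp
  also have "\<dots> = complex_of_real 1" using n by simp
  finally show ?thesis by (simp only: of_real_eq_iff)
qed

text \<open>With \<open>L k\<close> = {0} the \<open>row\<close> sum of two distinct digits would be
  1. This is what makes finite spectra grow strictly.\<close>

lemma nonzero_L: "\<exists>l\<in>L k. l \<noteq> 0"
proof (rule ccontr)
  assume "\<not> ?thesis"
  then have L: "L k = {0}" using zero_L by blast
  obtain d d' where d: "d \<in> D k" "d' \<in> D k" "d \<noteq> d'"
    using card_D[of k] by (metis card_2_iff' card_le_Suc0_iff_eq finite_D not_less_eq_eq numeral_2_eq_2)
  show False using row[OF one_E d(1,2)] d(3) by (simp add: L)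
qed

text \<open>\<open>G 0 K\<close> has period \<open>P K\<close> and value 1 at 0, so orthogonal
  frequencies are incongruent modulo \<open>P K\<close>. Multiples of \<open>P K\<close> can thus be
  added to each element separately without collisions.\<close>

lemma finite_spectrum_inj:
  assumes "finite_spectrum K \<Lambda>" "a \<in> \<Lambda>" "b \<in> \<Lambda>" "a + int (P K) * y = b + int (P K) * z"
  shows "a = b"
proof (rule ccontr)
  assume "a \<noteq> b"
  then have "G 0 K (real 1 * of_int (a - b)) = 0" using assms one_E by (intro finite_spectrum_orthogonal)
  moreover have "a - b = int (P K) * (z - y)" using assms(4) by (simp add: algebra_simps)
  then have "real 1 * of_int (a - b) = 0 + real (P K) * of_int (z - y)" by simp
  ultimately show False using G_add_period[of 0 K 0 "z - y"] by simp
qed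

lemma finite_spectrum_Suc:
  assumes S: "finite_spectrum K \<Lambda>"
  shows "\<exists>\<Lambda>'. finite_spectrum (Suc K) \<Lambda>' \<and> \<Lambda> \<subset> \<Lambda>'"
proof -
  define f where "f = (\<lambda>(a, l). a + int (P K) * l)"
  define \<Lambda>' where "\<Lambda>' = f ` (\<Lambda> \<times> L K)"
  have inj: "inj_on f (\<Lambda> \<times> L K)"
  proof (rule inj_onI, clarify)
    fix a l b m assume *: "a \<in> \<Lambda>" "b \<in> \<Lambda>" "f (a, l) = f (b, m)"
    then have "a = b" using finite_spectrum_inj[OF S] by (simp add: f_def)
    then show "a = b \<and> l = m" using * P_pos[of K] by (auto simp: f_def)
  qed
  have fin: "finite \<Lambda>'" using finite_spectrum_imp_finite[OF S] finite_L by (simp add: \<Lambda>'_def)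
  \<comment> \<open>The old factors have period \<open>P K\<close> and do not see l; the new mask
    sees it as t * l / M K, which is where the Hadamard property of \<open>L K\<close>
    enters.\<close>
  have factor: "G 0 (Suc K) (\<xi> + real t * of_int (f (a, l))) =
      G 0 K (\<xi> + real t * of_int a) * digit_mask (D K) ((\<xi> + real t * of_int a) / real (P (Suc K)) + real t * of_int l / real (M K))"
    for \<xi> t a l
  proof -
    have 1: "\<xi> + real t * of_int (f (a, l)) = \<xi> + real t * of_int a + real (P K) * of_int (int t * l)"
      by (simp add: f_def algebra_simps)
    have 2: "(\<xi> + real t * of_int (f (a, l))) / real (P (Suc K)) = (\<xi> + real t * of_int a) / real (P (Suc K)) + real t * of_int l / real (M K)"
      using P_pos[of K] M_ge[of K] by (simp add: f_def P_Suc field_simps)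
    show ?thesis unfolding G_Suc[OF le0] 2 unfolding 1 G_add_period ..
  qed
  have "finite_spectrum (Suc K) \<Lambda>'"
    unfolding finite_spectrum_def
  proof (intro conjI ballI allI impI fin)
    fix t \<xi> assume t: "t \<in> E"
    have "(\<Sum>a\<in>\<Lambda>'. (norm (G 0 (Suc K) (\<xi> + real t * of_int a)))\<^sup>2) = (\<Sum>(a, l)\<in>\<Lambda> \<times> L K. (norm (G 0 (Suc K) (\<xi> + real t * of_int (f (a, l)))))\<^sup>2)"
      unfolding \<Lambda>'_def sum.reindex[OF inj] by (simp add: o_def split_beta)
    also have "\<dots> = (\<Sum>a\<in>\<Lambda>. (norm (G 0 K (\<xi> + real t * of_int a)))\<^sup>2 *
        (\<Sum>l\<in>L K. (norm (digit_mask (D K) ((\<xi> + real t * of_int a) / real (P (Suc K)) + real t * of_int l / real (M K))))\<^sup>2))"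
      unfolding factor by (simp add: norm_mult power_mult_distrib sum_distrib_left flip: sum.cartesian_product)
    also have "\<dots> = 1" by (simp add: digit_mask_row_sum[OF t] finite_spectrum_sum[OF S t])
    finally show "(\<Sum>a\<in>\<Lambda>'. (norm (G 0 (Suc K) (\<xi> + real t * of_int a)))\<^sup>2) = 1" .
  next
    fix t u v assume t: "t \<in> E" and uv: "u \<in> \<Lambda>'" "v \<in> \<Lambda>'" "u \<noteq> v"
    obtain a l where u: "u = f (a, l)" "a \<in> \<Lambda>" "l \<in> L K" using uv by (auto simp: \<Lambda>'_def)
    obtain b m where v: "v = f (b, m)" "b \<in> \<Lambda>" "m \<in> L K" using uv by (auto simp: \<Lambda>'_def)
    have diff: "f (a, l) - f (b, m) = f (a - b, l - m)" by (simp add: f_def algebra_simps)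
    have eq: "G 0 (Suc K) (real t * of_int (u - v)) = G 0 K (real t * of_int (a - b)) *
        digit_mask (D K) (real t * of_int (a - b) / real (P (Suc K)) + real t * of_int (l - m) / real (M K))"
      unfolding u v diff using factor[of 0 t "a - b" "l - m"] by simp
    show "G 0 (Suc K) (real t * of_int (u - v)) = 0"
    proof (cases "a = b")
      case True
      then have "l \<noteq> m" using uv u v by auto
      then have "digit_mask (D K) (real t * of_int (l - m) / real (M K)) = 0" using u v by (intro col[OF t])
      then show ?thesis unfolding eq by (simp add: True)
    next
      case False
      then show ?thesis unfolding eq using finite_spectrum_orthogonal[OF S t u(2) v(2)] by simp
    qed
  qed
  moreover have "\<Lambda> \<subseteq> \<Lambda>'"
    using zero_L by (force simp: \<Lambda>'_def f_def)
  moreover have "\<Lambda> \<noteq> \<Lambda>'"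
  proof
    assume eq: "\<Lambda> = \<Lambda>'"
    have "card \<Lambda>' = card \<Lambda> * card (L K)"
      unfolding \<Lambda>'_def using card_image[OF inj] by (simp add: card_cartesian_product)
    then have "card \<Lambda> * card (L K) = card \<Lambda>" using eq by metis
    moreover have "\<Lambda> \<noteq> {}" using finite_spectrum_sum[OF S one_E] by auto
    then have "card \<Lambda> > 0" using finite_spectrum_imp_finite[OF S] by (simp add: card_gt_0_iff)
    ultimately have "card (L K) = 1" by auto
    then show False using nonzero_L[of K] zero_L[of K] by (metis card_1_singletonE singletonD)
  qed
  ultimately show ?thesis by blast
qed

lemma finite_spectrum_extend: "finite_spectrum K \<Lambda> \<Longrightarrow> \<exists>\<Lambda>'. finite_spectrum (Suc (K + j)) \<Lambda>' \<and> \<Lambda> \<subset> \<Lambda>'"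
proof (induction j)
  case (Suc j)
  then obtain \<Lambda>' where "finite_spectrum (Suc (K + j)) \<Lambda>'" "\<Lambda> \<subset> \<Lambda>'" by blast
  then show ?case using finite_spectrum_Suc[of "Suc (K + j)" \<Lambda>'] by auto
qed (use finite_spectrum_Suc in simp)

section \<open>Growing frequency sets shared by all scalings\<close>

lemma finite_spectrum_modify:
  assumes S: "finite_spectrum K \<Lambda>"
  shows "finite_spectrum K ((\<lambda>a. a + int (P K) * f a) ` \<Lambda>)"
proof -
  let ?g = "\<lambda>a. a + int (P K) * f a"
  have inj: "inj_on ?g \<Lambda>" using finite_spectrum_inj[OF S] by (auto simp: inj_on_def)
  show ?thesis unfolding finite_spectrum_def
  proof (intro conjI ballI allI impI)
    fix t \<xi> assume t: "t \<in> E"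
    have "\<xi> + real t * of_int (?g a) = \<xi> + real t * of_int a + real (P K) * of_int (int t * f a)" for a
      by (simp add: algebra_simps)
    then have "(\<Sum>a\<in>?g ` \<Lambda>. (norm (G 0 K (\<xi> + real t * of_int a)))\<^sup>2) = (\<Sum>a\<in>\<Lambda>. (norm (G 0 K (\<xi> + real t * of_int a)))\<^sup>2)"
      unfolding sum.reindex[OF inj] o_def by (simp only: G_add_period)
    then show "(\<Sum>a\<in>?g ` \<Lambda>. (norm (G 0 K (\<xi> + real t * of_int a)))\<^sup>2) = 1"
      using finite_spectrum_sum[OF S t] by simp
  next
    fix t u v assume t: "t \<in> E" and uv: "u \<in> ?g ` \<Lambda>" "v \<in> ?g ` \<Lambda>" "u \<noteq> v"
    then obtain a b where ab: "a \<in> \<Lambda>" "b \<in> \<Lambda>" "u = ?g a" "v = ?g b" "a \<noteq> b" by auto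
    have "real t * of_int (u - v) = real t * of_int (a - b) + real (P K) * of_int (int t * (f a - f b))"
      by (simp add: ab algebra_simps)
    then show "G 0 K (real t * of_int (u - v)) = 0"
      using finite_spectrum_orthogonal[OF S t ab(1,2,5)] by (simp only: G_add_period)
  qed (use finite_spectrum_imp_finite[OF S] in simp)
qed

text \<open>Old frequencies \<open>a\<close> need no modification: \<open>K'\<close> is so large that \<open>t * a / P K'\<close> is close to 0. This is
  what allows the scalings \<open>t\<close> to be treated one at a time.\<close>

lemma spectrum_step:
  fixes R :: real
  assumes S: "finite_spectrum K \<Lambda>" and t: "t \<in> E" and c: "c \<le> 1/2"
    and pos: "\<forall>k0. \<exists>k\<ge>k0. \<forall>lam::int. \<exists>z::int. lam + int (P k) * z \<ge> int (P k) \<and> good t c k (of_int (lam + int (P k) * z))"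
  shows "\<exists>K' \<Lambda>'. K < K' \<and> finite_spectrum K' \<Lambda>' \<and> \<Lambda> \<subset> \<Lambda>' \<and> (\<forall>a\<in>\<Lambda>' - \<Lambda>. a \<ge> int (P K')) \<and>
     real (P K') > R \<and> (\<forall>a\<in>\<Lambda>'. good t c K' (of_int a))"
proof -
  \<comment> \<open>Once \<open>P K'\<close> is at least \<open>B1\<close>,
    \<open>norm_G_ge_half\<close> applies to every old frequency; \<open>P_ge\<close> turns this
    into a demand on \<open>K'\<close>.\<close>
  define B1 where "B1 = (\<Sum>a\<in>\<Lambda>. 8 * pi * C * \<bar>real t * of_int a\<bar>)"
  obtain K' where K': "K' \<ge> K + nat \<lceil>\<bar>B1\<bar>\<rceil> + nat \<lceil>\<bar>R\<bar>\<rceil> + 1"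
    "\<And>lam::int. \<exists>z::int. lam + int (P K') * z \<ge> int (P K') \<and> good t c K' (of_int (lam + int (P K') * z))"
    using pos by blast
  have "real K' < real (P K')" using P_ge by simp
  then have big: "R < real (P K')" "B1 \<le> real (P K')" "K < K'" using K'(1) by linarith+
  obtain \<Lambda>1 where \<Lambda>1: "finite_spectrum K' \<Lambda>1" "\<Lambda> \<subset> \<Lambda>1"
    using finite_spectrum_extend[OF S, of "K' - Suc K"] big(3) by auto
  obtain z where z: "\<And>lam::int. lam + int (P K') * z lam \<ge> int (P K')"
    "\<And>lam. good t c K' (of_int (lam + int (P K') * z lam))"
    using K'(2) by metis
  define f where "f a = (if a \<in> \<Lambda> then 0 else z a)" for a
  let ?g = "\<lambda>a. a + int (P K') * f a"
  define \<Lambda>' where "\<Lambda>' = ?g ` \<Lambda>1"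
  have S': "finite_spectrum K' \<Lambda>'" unfolding \<Lambda>'_def by (rule finite_spectrum_modify[OF \<Lambda>1(1)])
  have sub: "\<Lambda> \<subseteq> \<Lambda>'" using \<Lambda>1(2) by (force simp: \<Lambda>'_def f_def)
  have inj: "inj_on ?g \<Lambda>1" using finite_spectrum_inj[OF \<Lambda>1(1)] by (auto simp: inj_on_def)
  have "card \<Lambda> < card \<Lambda>1" using \<Lambda>1 finite_spectrum_imp_finite psubset_card_mono by blast
  then have "\<Lambda>' \<noteq> \<Lambda>" unfolding \<Lambda>'_def using card_image[OF inj] by force
  moreover have "a \<ge> int (P K')" if "a \<in> \<Lambda>' - \<Lambda>" for a
    using that z(1) by (auto simp: \<Lambda>'_def f_def split: if_splits)
  moreover have "good t c K' (of_int a)" if a: "a \<in> \<Lambda>'" for a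
  proof (cases "a \<in> \<Lambda>")
    case True
    have "8 * pi * C * \<bar>real t * of_int a\<bar> \<le> B1" unfolding B1_def
      using True finite_spectrum_imp_finite[OF S] C_ge by (intro member_le_sum[of a \<Lambda> "\<lambda>a. 8 * pi * C * \<bar>real t * of_int a\<bar>"]) auto
    also have "\<dots> \<le> real (P (Suc K'))" using big(2) P_mono[of K' "Suc K'"] by linarith
    finally have "norm (G K' j (real t * of_int a)) \<ge> 1/2" for j by (rule norm_G_ge_half)
    then show ?thesis unfolding good_def using c by (meson always_eventually order.trans)
  next
    case False
    then show ?thesis using a z(2) by (auto simp: \<Lambda>'_def f_def split: if_splits)
  qed
  ultimately show ?thesis using S' sub big by blast
qed

text \<open>\<tau> r is the scaling served at step r. \<open>R\<close> is the demand of an adversary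
  who sees the set built so far; the diagonal argument supplies it. The constant \<open>c t\<close>
  is fixed for t before the sequence is built, so it is the same at all steps that serve t.\<close>

lemma spectrum_sequence:
  fixes R :: "nat \<Rightarrow> int set \<Rightarrow> real"
  assumes \<tau>: "\<And>r. \<tau> r \<in> E"
  obtains K \<Lambda> c where "\<And>t. t \<in> E \<Longrightarrow> c t > (0::real)" "\<And>r. K r < K (Suc r)" "\<And>r. finite_spectrum (K r) (\<Lambda> r)"
    "\<And>r. \<Lambda> r \<subset> \<Lambda> (Suc r)" "\<And>r a. a \<in> \<Lambda> (Suc r) - \<Lambda> r \<Longrightarrow> a \<ge> int (P (K (Suc r)))"
    "\<And>r. real (P (K (Suc r))) > R r (\<Lambda> r)"
    "\<And>r a. a \<in> \<Lambda> (Suc r) \<Longrightarrow> good (\<tau> r) (c (\<tau> r)) (K (Suc r)) (of_int a)"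
proof -
  have "\<forall>t\<in>E. \<exists>c. c > 0 \<and> c \<le> 1/2 \<and> (\<forall>k0. \<exists>k\<ge>k0. \<forall>lam::int. \<exists>z::int. lam + int (P k) * z \<ge> int (P k) \<and> good t c k (of_int (lam + int (P k) * z)))"
  proof
    fix t assume "t \<in> E"
    then obtain \<epsilon> where \<epsilon>: "\<epsilon> > 0" "\<forall>k0. \<exists>k\<ge>k0. \<forall>lam::int. \<exists>z::int. lam + int (P k) * z \<ge> int (P k) \<and> good t \<epsilon> k (of_int (lam + int (P k) * z))"
      using equi_positive by blast
    \<comment> \<open>The cap 1/2 is what old frequencies achieve in \<open>spectrum_step\<close>,
      where only \<open>norm_G_ge_half\<close> is available for them.\<close>
    have mono: "good t (min \<epsilon> (1/2)) k x" if "good t \<epsilon> k x" for k x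
      using that unfolding good_def by (rule eventually_mono) auto
    show "\<exists>c. c > 0 \<and> c \<le> 1/2 \<and> (\<forall>k0. \<exists>k\<ge>k0. \<forall>lam::int. \<exists>z::int. lam + int (P k) * z \<ge> int (P k) \<and> good t c k (of_int (lam + int (P k) * z)))"
      using \<epsilon> mono by (intro exI[of _ "min \<epsilon> (1/2)"] conjI) (simp, simp, meson)
  qed
  then obtain c where c: "\<And>t. t \<in> E \<Longrightarrow> c t > 0" "\<And>t. t \<in> E \<Longrightarrow> c t \<le> 1/2"
    "\<And>t. t \<in> E \<Longrightarrow> \<forall>k0. \<exists>k\<ge>k0. \<forall>lam::int. \<exists>z::int. lam + int (P k) * z \<ge> int (P k) \<and> good t (c t) k (of_int (lam + int (P k) * z))"
    by metis
  define Q where "Q r s s' \<longleftrightarrow> (case s of (K, \<Lambda>) \<Rightarrow> case s' of (K', \<Lambda>') \<Rightarrow>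
     K < K' \<and> \<Lambda> \<subset> \<Lambda>' \<and> (\<forall>a\<in>\<Lambda>' - \<Lambda>. a \<ge> int (P K')) \<and> real (P K') > R r \<Lambda> \<and> (\<forall>a\<in>\<Lambda>'. good (\<tau> r) (c (\<tau> r)) K' (of_int a)))"
    for r s s'
  have "\<exists>f. \<forall>r. finite_spectrum (fst (f r)) (snd (f r)) \<and> Q r (f r) (f (Suc r))"
  proof (rule dependent_nat_choice)
    show "\<exists>x. finite_spectrum (fst x) (snd x)" using finite_spectrum_0 by auto
  next
    fix x r assume "finite_spectrum (fst x) (snd x)"
    then show "\<exists>y. finite_spectrum (fst y) (snd y) \<and> Q r x y"
      using spectrum_step[OF _ \<tau>[of r] c(2)[OF \<tau>] c(3)[OF \<tau>], of "fst x" "snd x" "R r (snd x)"]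
      by (auto simp: Q_def split_beta)
  qed
  then obtain f where f: "\<And>r. finite_spectrum (fst (f r)) (snd (f r))" "\<And>r. Q r (f r) (f (Suc r))" by blast
  show ?thesis
    by (rule that[of c "\<lambda>r. fst (f r)" "\<lambda>r. snd (f r)"]) (use c(1) f in \<open>auto simp: Q_def split_beta\<close>)
qed

section \<open>Completeness and orthogonality of the limit set\<close>

text \<open>Goodness is arranged at \<xi> = 0 only, while completeness concerns every \<xi>. By the
  Lipschitz bound, a fixed \<xi> changes the tail by at most c / 2 once the level is deep
  enough.\<close>

lemma good_perturb:
  assumes g: "good t c k x" and c: "c > 0" and large: "8 * pi * C * \<bar>\<xi>\<bar> / c \<le> real (P k)"
  shows "\<forall>\<^sub>F j in sequentially. norm (G k j (\<xi> + real t * x)) \<ge> c / 2"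
  using g unfolding good_def
proof (rule eventually_mono)
  fix j assume j: "norm (G k j (real t * x)) \<ge> c"
  have "8 * pi * C * \<bar>\<xi>\<bar> \<le> c * real (P k)" using large c by (simp add: field_simps)
  also have "\<dots> \<le> c * real (P (Suc k))" using c P_mono[of k "Suc k"] by (intro mult_left_mono) auto
  finally have "4 * pi * C * \<bar>\<xi>\<bar> / real (P (Suc k)) \<le> c / 2" using P_pos[of "Suc k"] by (simp add: field_simps)
  moreover have "norm (G k j (\<xi> + real t * x) - G k j (real t * x)) \<le> 4 * pi * C * \<bar>\<xi>\<bar> / real (P (Suc k))"
    using norm_G_diff_le[of k j "\<xi> + real t * x" "real t * x"] by simp
  ultimately have "norm (G k j (\<xi> + real t * x) - G k j (real t * x)) \<le> c / 2" by linarith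
  moreover have "norm (G k j (real t * x)) \<le> norm (G k j (\<xi> + real t * x)) + norm (G k j (\<xi> + real t * x) - G k j (real t * x))"
    by (metis norm_triangle_sub norm_minus_commute)
  ultimately show "norm (G k j (\<xi> + real t * x)) \<ge> c / 2" using j by linarith
qed

text \<open>If \<open>A r\<close> is the sum over \<open>\<Lambda> r\<close>, the mass \<open>1 - A r\<close> that is missing at step \<open>r\<close> reappears up to a factor
  \<open>(c / 2)\<^sup>2\<close> at a later step with good frequencies. So the limit \<open>l\<close> satisfies \<open>l \<ge> l + (c / 2)\<^sup>2 * (1 - l)\<close>.\<close>

lemma spectrum_complete:
  fixes \<phi> :: "real \<Rightarrow> complex"
  assumes \<phi>: "\<And>\<xi>. (\<lambda>j. G 0 j \<xi>) \<longlonglongrightarrow> \<phi> \<xi>"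
    and t: "t \<in> E" and c: "c > 0"
    and K: "\<And>r. K r < K (Suc r)" and S: "\<And>r. finite_spectrum (K r) (\<Lambda> r)" and \<Lambda>: "\<And>r. \<Lambda> r \<subset> \<Lambda> (Suc r)"
    and gd: "\<And>N. \<exists>r\<ge>N. \<forall>a\<in>\<Lambda> r. good t c (K r) (of_int a)"
  shows "(\<lambda>r. \<Sum>a\<in>\<Lambda> r. (norm (\<phi> (\<xi> + real t * of_int a)))\<^sup>2) \<longlonglongrightarrow> 1"
proof -
  define A where "A r = (\<Sum>a\<in>\<Lambda> r. (norm (\<phi> (\<xi> + real t * of_int a)))\<^sup>2)" for r
  \<comment> \<open>\<open>T s s\<close> = 1 by the finite Parseval identity, and
    \<open>T r s\<close> tends to \<open>A r\<close> as s grows; comparing the two isolates the mass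
    outside \<Lambda> r.\<close>
  define T where "T r s = (\<Sum>a\<in>\<Lambda> r. (norm (G 0 (K s) (\<xi> + real t * of_int a)))\<^sup>2)" for r s
  have K_mono: "strict_mono K" using K by (simp add: strict_mono_Suc_iff)
  have \<Lambda>_mono: "\<Lambda> r \<subseteq> \<Lambda> s" if "r \<le> s" for r s
    using lift_Suc_mono_le[of \<Lambda>, OF _ that] \<Lambda> by blast
  have fin: "finite (\<Lambda> r)" for r using S finite_spectrum_imp_finite by blast
  have T_le: "T r s \<le> 1" if "r \<le> s" for r s
  proof -
    have "T r s \<le> T s s" unfolding T_def by (intro sum_mono2 fin \<Lambda>_mono that) auto
    also have "T s s = 1" unfolding T_def by (rule finite_spectrum_sum[OF S t])
    finally show ?thesis .
  qed
  have T_lim: "T r \<longlonglongrightarrow> A r" for r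
    unfolding T_def A_def
    by (intro tendsto_sum tendsto_power tendsto_norm)
      (use LIMSEQ_subseq_LIMSEQ[OF \<phi> K_mono] in \<open>simp add: o_def\<close>)
  have A_le: "A r \<le> 1" for r
    by (rule LIMSEQ_le_const2[OF T_lim]) (use T_le in auto)
  have "incseq A" unfolding incseq_def A_def by (auto intro!: sum_mono2 fin \<Lambda>_mono)
  moreover have "Bseq A"
    by (rule BseqI'[of _ 1]) (use A_le in \<open>auto simp: A_def sum_nonneg\<close>)
  ultimately obtain l where l: "A \<longlonglongrightarrow> l" "\<And>r. A r \<le> l"
    using incseq_convergent[of A 1] A_le by metis
  have l_le: "l \<le> 1" by (rule LIMSEQ_le_const2[OF l(1)]) (use A_le in auto)
  have main: "l \<ge> A r + (c / 2)\<^sup>2 * (1 - A r)" for r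
  proof (rule field_le_epsilon)
    fix e :: real assume e: "e > 0"
    define \<delta> where "\<delta> = e / (c / 2)\<^sup>2"
    have \<delta>: "\<delta> > 0" using e c by (simp add: \<delta>_def)
    obtain N where N: "\<And>s. s \<ge> N \<Longrightarrow> T r s < A r + \<delta>"
      using order_tendstoD(2)[OF T_lim, of r "A r + \<delta>"] \<delta> by (auto simp: eventually_sequentially)
    \<comment> \<open>The summands provide \<open>T r s < A r + \<delta>\<close>, the inclusion
      \<Lambda> r \<subseteq> \<Lambda> s, and the depth that \<open>good_perturb\<close> demands
      for \<xi>.\<close>
    define N' where "N' = N + r + nat \<lceil>8 * pi * C * \<bar>\<xi>\<bar> / c\<rceil>"
    obtain s where s: "s \<ge> N'" "\<forall>a\<in>\<Lambda> s. good t c (K s) (of_int a)" using gd by blast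
    have "s \<le> K s" using K_mono by (rule strict_mono_imp_increasing)
    then have "s \<le> P (K s)" using P_ge[of "K s"] by linarith
    then have big: "8 * pi * C * \<bar>\<xi>\<bar> / c \<le> real (P (K s))" using s(1) unfolding N'_def by linarith
    \<comment> \<open>In the limit the product is its part up to level \<open>K s\<close> times a
      tail, and goodness keeps the tail at least c / 2.\<close>
    have lower: "(c / 2)\<^sup>2 * (norm (G 0 (K s) (\<xi> + real t * of_int a)))\<^sup>2 \<le> (norm (\<phi> (\<xi> + real t * of_int a)))\<^sup>2"
      if a: "a \<in> \<Lambda> s" for a
    proof -
      let ?y = "\<xi> + real t * of_int a"
      have "\<forall>\<^sub>F j in sequentially. c / 2 * norm (G 0 (K s) ?y) \<le> norm (G 0 j ?y)"
        using good_perturb[OF s(2)[rule_format, OF a] c big] eventually_ge_at_top[of "K s"]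
      proof eventually_elim
        case (elim j)
        have "norm (G 0 j ?y) = norm (G (K s) j ?y) * norm (G 0 (K s) ?y)"
          using elim(2) by (subst G_split[of 0 "K s" j]) (auto simp: norm_mult)
        then show ?case using mult_right_mono[OF elim(1), of "norm (G 0 (K s) ?y)"] by simp
      qed
      then have "c / 2 * norm (G 0 (K s) ?y) \<le> norm (\<phi> ?y)"
        by (intro tendsto_lowerbound[OF tendsto_norm[OF \<phi>]]) auto
      then have "(c / 2 * norm (G 0 (K s) ?y))\<^sup>2 \<le> (norm (\<phi> ?y))\<^sup>2" using c by (intro power_mono) auto
      then show ?thesis by (simp only: power_mult_distrib)
    qed
    have rs: "\<Lambda> r \<subseteq> \<Lambda> s" using s(1) by (intro \<Lambda>_mono) (simp add: N'_def)
    have "T s s = T r s + (\<Sum>a\<in>\<Lambda> s - \<Lambda> r. (norm (G 0 (K s) (\<xi> + real t * of_int a)))\<^sup>2)"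
      unfolding T_def by (subst sum.subset_diff[OF rs fin]) (rule add.commute)
    moreover have "T s s = 1" unfolding T_def by (rule finite_spectrum_sum[OF S t])
    ultimately have rest: "(\<Sum>a\<in>\<Lambda> s - \<Lambda> r. (norm (G 0 (K s) (\<xi> + real t * of_int a)))\<^sup>2) = 1 - T r s" by simp
    have "A s = A r + (\<Sum>a\<in>\<Lambda> s - \<Lambda> r. (norm (\<phi> (\<xi> + real t * of_int a)))\<^sup>2)"
      unfolding A_def by (subst sum.subset_diff[OF rs fin]) (rule add.commute)
    also have "\<dots> \<ge> A r + (\<Sum>a\<in>\<Lambda> s - \<Lambda> r. (c / 2)\<^sup>2 * (norm (G 0 (K s) (\<xi> + real t * of_int a)))\<^sup>2)"
      by (intro add_left_mono sum_mono lower) auto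
    finally have "A s \<ge> A r + (c / 2)\<^sup>2 * (1 - T r s)"
      unfolding sum_distrib_left[symmetric] rest .
    moreover have "(c / 2)\<^sup>2 * (1 - A r - \<delta>) \<le> (c / 2)\<^sup>2 * (1 - T r s)"
      using N[of s] s(1) by (intro mult_left_mono) (auto simp: N'_def)
    moreover have "(c / 2)\<^sup>2 * (1 - A r - \<delta>) = (c / 2)\<^sup>2 * (1 - A r) - e"
      using c by (simp add: \<delta>_def right_diff_distrib)
    ultimately show "A r + (c / 2)\<^sup>2 * (1 - A r) \<le> l + e" using l(2)[of s] by linarith
  qed
  have "l \<ge> l + (c / 2)\<^sup>2 * (1 - l)"
    by (rule LIMSEQ_le_const2[of "\<lambda>r. A r + (c / 2)\<^sup>2 * (1 - A r)"])
      (use main l(1) in \<open>auto intro!: tendsto_intros\<close>)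
  then have "(c / 2)\<^sup>2 * (1 - l) \<le> 0" by simp
  then have "1 - l \<le> 0" using c by (simp add: mult_le_0_iff)
  then have "l = 1" using l_le by simp
  then show ?thesis using l(1) unfolding A_def by simp
qed

lemma spectrum_orthogonal:
  fixes \<phi> :: "real \<Rightarrow> complex"
  assumes \<phi>: "\<And>\<xi>. (\<lambda>j. G 0 j \<xi>) \<longlonglongrightarrow> \<phi> \<xi>"
    and t: "t \<in> E" and S: "finite_spectrum K \<Lambda>" and ab: "a \<in> \<Lambda>" "b \<in> \<Lambda>" "a \<noteq> b"
  shows "\<phi> (real t * of_int (a - b)) = 0"
proof -
  have "\<forall>\<^sub>F j in sequentially. G 0 j (real t * of_int (a - b)) = 0"
    using eventually_ge_at_top[of K]
  proof eventually_elim
    case (elim j)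
    then show ?case using finite_spectrum_orthogonal[OF S t ab] by (subst G_split[of 0 K j]) auto
  qed
  then have "(\<lambda>j. G 0 j (real t * of_int (a - b))) \<longlonglongrightarrow> 0" by (rule tendsto_eventually)
  then show ?thesis using \<phi> LIMSEQ_unique by blast
qed

text \<open>\<open>F\<close> is an arbitrary countable family of sets to be avoided; having a
  solution for each \<open>F\<close> is the form in which uncountability is proved. \<phi> is any
  pointwise limit, so no measure is involved yet.\<close>

theorem spectrum_exists:
  fixes \<phi> :: "real \<Rightarrow> complex" and F :: "nat \<Rightarrow> real set"
  assumes \<phi>: "\<And>\<xi>. (\<lambda>j. G 0 j \<xi>) \<longlonglongrightarrow> \<phi> \<xi>"
  obtains \<Lambda> :: "nat \<Rightarrow> int set" where "\<And>r. finite (\<Lambda> r)" "incseq \<Lambda>"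
    "\<And>t a b. t \<in> E \<Longrightarrow> a \<in> (\<Union>r. \<Lambda> r) \<Longrightarrow> b \<in> (\<Union>r. \<Lambda> r) \<Longrightarrow> a \<noteq> b \<Longrightarrow> \<phi> (real t * of_int (a - b)) = 0"
    "\<And>t \<xi>. t \<in> E \<Longrightarrow> (\<lambda>r. \<Sum>a\<in>\<Lambda> r. (norm (\<phi> (\<xi> + real t * of_int a)))\<^sup>2) \<longlonglongrightarrow> 1"
    "\<And>r. real_of_int ` (\<Union>r. \<Lambda> r) \<noteq> F r"
proof -
  \<comment> \<open>Every t in E is the first component of infinitely many codes, hence is served
    infinitely often; 1 fills the codes whose first component lies outside E.\<close>
  define \<tau> where "\<tau> r = (if fst (prod_decode r) \<in> E then fst (prod_decode r) else 1)" for r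
  have \<tau>: "\<tau> r \<in> E" for r using one_E by (simp add: \<tau>_def)
  have \<tau>_inf: "\<exists>r\<ge>N. \<tau> r = t" if "t \<in> E" for t N
    by (rule exI[of _ "prod_encode (t, N)"]) (use that le_prod_encode_2 in \<open>simp add: \<tau>_def\<close>)
  \<comment> \<open>All elements added after step \<open>r\<close> exceed \<open>\<bar>y r (\<Lambda> r)\<bar>\<close>, so this number of \<open>F r\<close> never enters the spectrum.
    It is junk if \<open>F r \<subseteq> \<Lambda> r\<close>; then the spectrum differs from \<open>F r\<close> because \<open>\<Lambda>\<close> grows strictly.\<close>
  define y where "y r \<Lambda> = (SOME y. y \<in> F r - real_of_int ` \<Lambda>)" for r \<Lambda>
  obtain K \<Lambda> c where *: "\<And>t. t \<in> E \<Longrightarrow> c t > (0::real)" "\<And>r. K r < K (Suc r)" "\<And>r. finite_spectrum (K r) (\<Lambda> r)"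
    "\<And>r. \<Lambda> r \<subset> \<Lambda> (Suc r)" "\<And>r a. a \<in> \<Lambda> (Suc r) - \<Lambda> r \<Longrightarrow> a \<ge> int (P (K (Suc r)))"
    "\<And>r. real (P (K (Suc r))) > \<bar>y r (\<Lambda> r)\<bar>"
    "\<And>r a. a \<in> \<Lambda> (Suc r) \<Longrightarrow> good (\<tau> r) (c (\<tau> r)) (K (Suc r)) (of_int a)"
    using spectrum_sequence[of \<tau> "\<lambda>r \<Lambda>. \<bar>y r \<Lambda>\<bar>"] \<tau> by metis
  have mono: "\<Lambda> r \<subseteq> \<Lambda> s" if "r \<le> s" for r s
    using lift_Suc_mono_le[of \<Lambda>, OF _ that] *(4) by blast
  have K_mono: "K r \<le> K s" if "r \<le> s" for r s
    using lift_Suc_mono_le[of K, OF _ that] *(2) less_imp_le by blast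
  show ?thesis
  proof (rule that[of \<Lambda>])
    show "finite (\<Lambda> r)" for r using *(3) finite_spectrum_imp_finite by blast
    show "incseq \<Lambda>" using mono by (auto simp: incseq_def)
    show "\<phi> (real t * of_int (a - b)) = 0"
      if t: "t \<in> E" and ab: "a \<in> (\<Union>r. \<Lambda> r)" "b \<in> (\<Union>r. \<Lambda> r)" "a \<noteq> b" for t a b
    proof -
      obtain r s where "a \<in> \<Lambda> r" "b \<in> \<Lambda> s" using ab by blast
      then have "a \<in> \<Lambda> (max r s)" "b \<in> \<Lambda> (max r s)" using mono[of r "max r s"] mono[of s "max r s"] by auto
      then show ?thesis using spectrum_orthogonal[OF \<phi> t *(3)] ab(3) by blast
    qed
    show "(\<lambda>r. \<Sum>a\<in>\<Lambda> r. (norm (\<phi> (\<xi> + real t * of_int a)))\<^sup>2) \<longlonglongrightarrow> 1" if t: "t \<in> E" for t \<xi>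
    proof (rule spectrum_complete[where K = K and \<Lambda> = \<Lambda>, OF \<phi> t *(1)[OF t] *(2) *(3) *(4)])
      fix N
      obtain r where "r \<ge> N" "\<tau> r = t" using \<tau>_inf[OF t] by blast
      \<comment> \<open>The scaling \<tau> r is served in passing from r to Suc r, hence the witness
        Suc r.\<close>
      then show "\<exists>r\<ge>N. \<forall>a\<in>\<Lambda> r. good t (c t) (K r) (of_int a)"
        using *(7)[of _ r] by (intro exI[of _ "Suc r"]) auto
    qed
    show "real_of_int ` (\<Union>r. \<Lambda> r) \<noteq> F r" for r
    proof
      assume eq: "real_of_int ` (\<Union>r. \<Lambda> r) = F r"
      obtain a where "a \<in> \<Lambda> (Suc r)" "a \<notin> \<Lambda> r" using *(4)[of r] by blast
      then have "of_int a \<in> F r - real_of_int ` \<Lambda> r" using eq by auto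
      then have y: "y r (\<Lambda> r) \<in> F r - real_of_int ` \<Lambda> r" unfolding y_def by (rule someI)
      then obtain b s where b: "y r (\<Lambda> r) = of_int b" "b \<in> \<Lambda> s" "b \<notin> \<Lambda> r" unfolding eq[symmetric] by auto
      \<comment> \<open>b enters at a stage after r, so the lower bound for new elements applies and
        contradicts that \<open>P (K (Suc r))\<close> exceeds the modulus of
        \<open>y r (\<Lambda> r)\<close>.\<close>
      define u where "u = (LEAST u. b \<in> \<Lambda> u)"
      have u: "b \<in> \<Lambda> u" "\<And>v. v < u \<Longrightarrow> b \<notin> \<Lambda> v"
        unfolding u_def using LeastI[of "\<lambda>u. b \<in> \<Lambda> u", OF b(2)] not_less_Least by blast+
      have ur: "u > r" using u(1) b(3) mono[of u r] by (meson not_le subsetD)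
      then obtain v where v: "u = Suc v" by (cases u) auto
      then have "b \<in> \<Lambda> (Suc v) - \<Lambda> v" using u by auto
      then have "b \<ge> int (P (K (Suc v)))" by (rule *(5))
      moreover have "P (K (Suc r)) \<le> P (K (Suc v))" using ur v by (intro P_mono K_mono) auto
      ultimately have "b \<ge> int (P (K (Suc r)))" by linarith
      then have "real_of_int b \<ge> real (P (K (Suc r)))" by (metis of_int_le_iff of_int_of_nat_eq)
      then show False using *(6)[of r] b(1) by simp
    qed
  qed
qed

end

section \<open>Density of exponentials\<close>

lemma norm_diff_sq_le: "(norm (x - y :: complex))\<^sup>2 \<le> 2 * (norm x)\<^sup>2 + 2 * (norm y)\<^sup>2"
proof -
  have "norm (x - y) \<le> norm x + norm y" by (rule norm_triangle_ineq4)
  then have "(norm (x - y))\<^sup>2 \<le> (norm x + norm y)\<^sup>2" by (intro power_mono) auto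
  also have "\<dots> \<le> 2 * (norm x)\<^sup>2 + 2 * (norm y)\<^sup>2"
    using sum_squares_ge_zero[of "norm x - norm y" 0] by (simp add: power2_eq_square algebra_simps)
  finally show ?thesis .
qed

lemma square_integrable_cmult:
  assumes "square_integrable M f"
  shows "square_integrable M (\<lambda>x. c * f x)"
  using assms unfolding square_integrable_def by (auto simp: norm_mult power_mult_distrib)

lemma square_integrable_diff:
  assumes "square_integrable M f" "square_integrable M g"
  shows "square_integrable M (\<lambda>x. f x - g x)"
proof -
  have [measurable]: "f \<in> borel_measurable M" "g \<in> borel_measurable M"
    using assms by (auto simp: square_integrable_def)
  have "integrable M (\<lambda>x. 2 * (norm (f x))\<^sup>2 + 2 * (norm (g x))\<^sup>2)"
    using assms by (auto simp: square_integrable_def)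
  then have "integrable M (\<lambda>x. (norm (f x - g x))\<^sup>2)"
    by (rule Bochner_Integration.integrable_bound) (auto simp: norm_diff_sq_le)
  then show ?thesis by (simp add: square_integrable_def)
qed

lemma square_integrable_add:
  assumes "square_integrable M f" "square_integrable M g"
  shows "square_integrable M (\<lambda>x. f x + g x)"
  using square_integrable_diff[OF assms(1) square_integrable_cmult[OF assms(2), of "-1"]] by simp

lemma (in finite_measure) square_integrable_AE_bounded:
  assumes "f \<in> borel_measurable M" "AE x in M. norm (f x) \<le> B"
  shows "square_integrable M f"
proof -
  have "integrable M (\<lambda>x. (norm (f x))\<^sup>2)"
  proof (rule integrable_const_bound[of _ "B\<^sup>2"])
    show "AE x in M. norm ((norm (f x))\<^sup>2) \<le> B\<^sup>2"
      using assms(2) by eventually_elim (simp add: power_mono)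
  qed (use assms(1) in measurable)
  then show ?thesis using assms(1) by (simp add: square_integrable_def)
qed

text \<open>Closed subspaces of L2, for functions in place of classes. The last clause also gives
  invariance under changes on null sets.\<close>

definition L2_closed :: "'a measure \<Rightarrow> ('a \<Rightarrow> complex) set \<Rightarrow> bool" where
  "L2_closed M V \<longleftrightarrow> (\<forall>f\<in>V. square_integrable M f) \<and> (\<forall>f\<in>V. \<forall>g\<in>V. (\<lambda>x. f x + g x) \<in> V) \<and>
     (\<forall>c. \<forall>f\<in>V. (\<lambda>x. c * f x) \<in> V) \<and>
     (\<forall>f. square_integrable M f \<longrightarrow> (\<forall>\<epsilon>>0. \<exists>g\<in>V. (\<integral>x. (norm (f x - g x))\<^sup>2 \<partial>M) < \<epsilon>) \<longrightarrow> f \<in> V)"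

lemma L2_closed_square_integrable: "L2_closed M V \<Longrightarrow> f \<in> V \<Longrightarrow> square_integrable M f"
  by (simp add: L2_closed_def)

lemma L2_closed_add: "L2_closed M V \<Longrightarrow> f \<in> V \<Longrightarrow> g \<in> V \<Longrightarrow> (\<lambda>x. f x + g x) \<in> V"
  by (simp add: L2_closed_def)

lemma L2_closed_cmult: "L2_closed M V \<Longrightarrow> f \<in> V \<Longrightarrow> (\<lambda>x. c * f x) \<in> V"
  by (simp add: L2_closed_def)

lemma L2_closed_diff: "L2_closed M V \<Longrightarrow> f \<in> V \<Longrightarrow> g \<in> V \<Longrightarrow> (\<lambda>x. f x - g x) \<in> V"
  using L2_closed_add[of M V f "\<lambda>x. - 1 * g x"] L2_closed_cmult[of M V g "-1"] by simp

lemma L2_closed_sum: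
  assumes "L2_closed M V" "(\<lambda>x. 0) \<in> V" "finite I" "\<And>i. i \<in> I \<Longrightarrow> f i \<in> V"
  shows "(\<lambda>x. \<Sum>i\<in>I. f i x) \<in> V"
  using assms(3,4) by (induction I rule: finite_induct) (auto intro: L2_closed_add[OF assms(1)] assms(2))

lemma L2_closed_limit:
  assumes "L2_closed M V" "square_integrable M f"
    and "\<And>\<epsilon>. \<epsilon> > 0 \<Longrightarrow> \<exists>g\<in>V. (\<integral>x. (norm (f x - g x))\<^sup>2 \<partial>M) < \<epsilon>"
  shows "f \<in> V"
  using assms by (simp add: L2_closed_def)

lemma L2_closed_dominated:
  assumes V: "L2_closed M V" and f: "f \<in> borel_measurable M" and g: "\<And>n. g n \<in> V"
    and lim: "\<And>x. (\<lambda>n. g n x) \<longlonglongrightarrow> f x"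
    and h: "integrable M (\<lambda>x. (h x)\<^sup>2)" "\<And>n x. norm (g n x) \<le> h x"
  shows "f \<in> V"
proof -
  have [measurable]: "f \<in> borel_measurable M" by fact
  have gs: "square_integrable M (g n)" for n using V g by (rule L2_closed_square_integrable)
  then have [measurable]: "g n \<in> borel_measurable M" for n by (auto simp: square_integrable_def)
  have fh: "norm (f x) \<le> h x" for x
    by (rule LIMSEQ_le_const2[OF tendsto_norm[OF lim]]) (use h in auto)
  have "integrable M (\<lambda>x. (norm (f x))\<^sup>2)"
    by (rule Bochner_Integration.integrable_bound[OF h(1)]) (auto simp: fh intro!: power_mono)
  then have fs: "square_integrable M f" by (simp add: square_integrable_def)
  have "(\<lambda>n. \<integral>x. (norm (f x - g n x))\<^sup>2 \<partial>M) \<longlonglongrightarrow> (\<integral>x. 0 \<partial>M)"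
  proof (rule integral_dominated_convergence)
    show "integrable M (\<lambda>x. 4 * (h x)\<^sup>2)" using h by simp
    show "AE x in M. (\<lambda>n. (norm (f x - g n x))\<^sup>2) \<longlonglongrightarrow> 0"
    proof (rule AE_I2)
      fix x
      have "(\<lambda>n. (norm (f x - g n x))\<^sup>2) \<longlonglongrightarrow> (norm (f x - f x))\<^sup>2"
        by (intro tendsto_intros lim)
      then show "(\<lambda>n. (norm (f x - g n x))\<^sup>2) \<longlonglongrightarrow> 0" by simp
    qed
    show "AE x in M. norm ((norm (f x - g n x))\<^sup>2) \<le> 4 * (h x)\<^sup>2" for n
    proof (rule AE_I2)
      fix x
      have "(norm (f x))\<^sup>2 \<le> (h x)\<^sup>2" "(norm (g n x))\<^sup>2 \<le> (h x)\<^sup>2"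
        using fh h(2) by (auto intro!: power_mono)
      then show "norm ((norm (f x - g n x))\<^sup>2) \<le> 4 * (h x)\<^sup>2"
        using norm_diff_sq_le[of "f x" "g n x"] by simp
    qed
  qed auto
  then have lim0: "(\<lambda>n. \<integral>x. (norm (f x - g n x))\<^sup>2 \<partial>M) \<longlonglongrightarrow> 0" by simp
  show ?thesis
  proof (rule L2_closed_limit[OF V fs])
    fix \<epsilon> :: real assume "\<epsilon> > 0"
    then have "\<forall>\<^sub>F n in sequentially. (\<integral>x. (norm (f x - g n x))\<^sup>2 \<partial>M) < \<epsilon>"
      using order_tendstoD(2)[OF lim0] by simp
    then show "\<exists>g\<in>V. (\<integral>x. (norm (f x - g x))\<^sup>2 \<partial>M) < \<epsilon>"
      using g by (auto simp: eventually_sequentially)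
  qed
qed

section \<open>Trigonometric polynomials\<close>

inductive_set trig_polys :: "(real \<Rightarrow> complex) set" where
  exponential: "(\<lambda>x. ec (\<xi> * x)) \<in> trig_polys"
| cmult: "f \<in> trig_polys \<Longrightarrow> (\<lambda>x. c * f x) \<in> trig_polys"
| add: "f \<in> trig_polys \<Longrightarrow> g \<in> trig_polys \<Longrightarrow> (\<lambda>x. f x + g x) \<in> trig_polys"

lemma trig_polys_const: "(\<lambda>x. c) \<in> trig_polys"
  using trig_polys.cmult[OF trig_polys.exponential[of 0], of c] by simp

lemma trig_polys_mult:
  assumes "f \<in> trig_polys" "g \<in> trig_polys"
  shows "(\<lambda>x. f x * g x) \<in> trig_polys"
  using assms
proof (induction f rule: trig_polys.induct)
  case (exponential \<xi>)
  from exponential show ?case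
  proof (induction g rule: trig_polys.induct)
    case (exponential \<eta>)
    show ?case using trig_polys.exponential[of "\<xi> + \<eta>"] by (simp add: distrib_right ec_add)
  next
    case (cmult g c)
    then show ?case using trig_polys.cmult[of _ c] by (simp add: mult.left_commute)
  next
    case (add g h)
    then show ?case using trig_polys.add by (simp add: distrib_left)
  qed
next
  case (cmult f c)
  then show ?case using trig_polys.cmult[of _ c] by (simp add: mult.assoc)
next
  case (add f h)
  then show ?case using trig_polys.add by (simp add: distrib_right)
qed

lemma continuous_ec: "continuous_on A (\<lambda>x. ec (\<xi> * x))"
  unfolding ec_def by (intro continuous_intros)

lemma trig_polys_continuous: "f \<in> trig_polys \<Longrightarrow> continuous_on A f"
  by (induction f rule: trig_polys.induct) (auto intro!: continuous_intros continuous_ec)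

lemma trig_polys_sin: "(\<lambda>x. complex_of_real (sin (2 * pi * s * x))) \<in> trig_polys"
proof -
  have "complex_of_real (sin (2 * pi * s * x)) = (\<i> / 2) * ec (s * x) + (- \<i> / 2) * ec ((- s) * x)" for x
  proof -
    define \<theta> where "\<theta> = 2 * pi * s * x"
    have "ec (s * x) = cis (- \<theta>)" "ec ((- s) * x) = cis \<theta>"
      by (simp_all only: ec_iexp cis_conv_exp \<theta>_def) (simp_all add: mult.assoc)
    moreover have "complex_of_real (sin \<theta>) = (\<i> / 2) * cis (- \<theta>) + (- \<i> / 2) * cis \<theta>"
      by (simp add: complex_eq_iff)
    ultimately show ?thesis by (simp only: \<theta>_def)
  qed
  then show ?thesis
    using trig_polys.add[OF trig_polys.cmult[OF trig_polys.exponential[of s], of "\<i> / 2"]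
        trig_polys.cmult[OF trig_polys.exponential[of "- s"], of "- \<i> / 2"]] by simp
qed

lemma trig_polys_dense:
  fixes f :: "real \<Rightarrow> real"
  assumes f: "continuous_on {-R..R} f" and R: "R > 0" and e: "e > 0"
  obtains g where "(\<lambda>x. complex_of_real (g x)) \<in> trig_polys" "\<And>x. x \<in> {-R..R} \<Longrightarrow> \<bar>f x - g x\<bar> < e"
proof -
  let ?A = "{g :: real \<Rightarrow> real. (\<lambda>x. complex_of_real (g x)) \<in> trig_polys}"
  interpret function_ring_on ?A "{-R..R}"
  proof
    fix g assume "g \<in> ?A"
    then have "continuous_on {-R..R} (\<lambda>x. Re (complex_of_real (g x)))"
      by (intro continuous_intros trig_polys_continuous) simp
    then show "continuous_on {-R..R} g" by simp
  next
    fix x y :: real assume xy: "x \<in> {-R..R}" "y \<in> {-R..R}" "x \<noteq> y"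
    \<comment> \<open>On [-R, R] the argument of the sine then stays within [-pi / 4, pi / 4], where
      the sine is injective.\<close>
    define s where "s = 1 / (8 * R)"
    have "(\<lambda>x. sin (2 * pi * s * x)) \<in> ?A" using trig_polys_sin by simp
    moreover have "sin (2 * pi * s * x) \<noteq> sin (2 * pi * s * y)"
    proof
      assume eq: "sin (2 * pi * s * x) = sin (2 * pi * s * y)"
      have le: "- (pi / 2) \<le> 2 * pi * s * z \<and> 2 * pi * s * z \<le> pi / 2" if "z \<in> {-R..R}" for z
      proof -
        have "\<bar>z\<bar> \<le> R" using that by auto
        have "\<bar>2 * pi * s * z\<bar> = 2 * pi * s * \<bar>z\<bar>" using R by (simp add: abs_mult s_def)
        also have "\<dots> \<le> 2 * pi * s * R" using \<open>\<bar>z\<bar> \<le> R\<close> R by (intro mult_left_mono) (auto simp: s_def)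
        also have "\<dots> = pi / 4" using R by (simp add: s_def)
        finally have "\<bar>2 * pi * s * z\<bar> \<le> pi / 4" .
        then show ?thesis using pi_gt_zero unfolding abs_le_iff by linarith
      qed
      have "2 * pi * s * x = 2 * pi * s * y"
        by (rule sin_inj_pi[OF conjunct1[OF le[OF xy(1)]] conjunct2[OF le[OF xy(1)]]
              conjunct1[OF le[OF xy(2)]] conjunct2[OF le[OF xy(2)]] eq])
      then show False using xy(3) R unfolding s_def by simp
    qed
    ultimately show "\<exists>f\<in>?A. f x \<noteq> f y" by (intro bexI[of _ "\<lambda>x. sin (2 * pi * s * x)"])
  next
    show "(\<lambda>_. c) \<in> ?A" for c using trig_polys_const by simp
  next
    fix f g assume "f \<in> ?A" "g \<in> ?A"
    then have fg: "(\<lambda>x. complex_of_real (f x)) \<in> trig_polys" "(\<lambda>x. complex_of_real (g x)) \<in> trig_polys" by auto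
    show "(\<lambda>x. f x + g x) \<in> ?A" using trig_polys.add[OF fg] by simp
    show "(\<lambda>x. f x * g x) \<in> ?A" using trig_polys_mult[OF fg] by simp
  qed simp
  show ?thesis using Stone_Weierstrass_basic[OF f e] that by auto
qed

text \<open>Bounded support makes uniform approximation by trigonometric polynomials enough for
  continuous functions. Indicators of rays are limits of ramps, Borel sets follow by Dynkin's
  argument, and general functions by monotone approximation and splitting into parts.\<close>

lemma L2_closed_exponentials_eq:
  fixes M :: "real measure"
  assumes M: "real_distribution M" and supp: "AE x in M. \<bar>x\<bar> \<le> R"
    and V: "L2_closed M V" and ec: "\<And>\<xi>. (\<lambda>x. ec (\<xi> * x)) \<in> V"
    and f: "square_integrable M f"
  shows "f \<in> V"
proof -
  interpret real_distribution M by (rule M)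
  define R' where "R' = max R 1"
  have R': "R' > 0" by (simp add: R'_def)
  have supp': "AE x in M. x \<in> {-R'..R'}" using supp by eventually_elim (auto simp: R'_def)
  have trig: "g \<in> V" if "g \<in> trig_polys" for g
    using that
  proof (induction g rule: trig_polys.induct)
    case (exponential \<xi>)
    show ?case by (rule ec)
  next
    case (cmult f c)
    show ?case by (rule L2_closed_cmult[OF V cmult.IH])
  next
    case (add f g)
    show ?case by (rule L2_closed_add[OF V add.IH])
  qed
  have const: "(\<lambda>x. c) \<in> V" for c by (intro trig trig_polys_const)
  have cont: "(\<lambda>x. complex_of_real (h x)) \<in> V" if h: "continuous_on UNIV h" for h :: "real \<Rightarrow> real"
  proof (rule L2_closed_limit[OF V])
    have hm [measurable]: "h \<in> borel_measurable M" using h by (simp add: borel_measurable_continuous_onI)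
    have hc: "continuous_on {-R'..R'} h" using h continuous_on_subset by blast
    have "bounded (h ` {-R'..R'})" by (intro compact_imp_bounded compact_continuous_image hc) simp
    then obtain B where "\<forall>y\<in>h ` {-R'..R'}. norm y \<le> B" unfolding bounded_iff ..
    then have B: "\<bar>h x\<bar> \<le> B" if "x \<in> {-R'..R'}" for x using that by simp
    show hs: "square_integrable M (\<lambda>x. complex_of_real (h x))"
    proof (rule square_integrable_AE_bounded)
      show "AE x in M. norm (complex_of_real (h x)) \<le> B"
        using supp' by eventually_elim (simp add: B)
    qed simp
    fix \<epsilon> :: real assume \<epsilon>: "\<epsilon> > 0"
    define e where "e = sqrt (\<epsilon> / 2)"
    have e: "e > 0" "e\<^sup>2 = \<epsilon> / 2" using \<epsilon> by (auto simp: e_def)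
    obtain g where g: "(\<lambda>x. complex_of_real (g x)) \<in> trig_polys" "\<And>x. x \<in> {-R'..R'} \<Longrightarrow> \<bar>h x - g x\<bar> < e"
      using trig_polys_dense[OF hc R' e(1)] by blast
    have gV: "(\<lambda>x. complex_of_real (g x)) \<in> V" by (rule trig[OF g(1)])
    have "(\<integral>x. (norm (complex_of_real (h x) - complex_of_real (g x)))\<^sup>2 \<partial>M) \<le> (\<integral>x. e\<^sup>2 \<partial>M)"
    proof (rule integral_mono_AE)
      show "integrable M (\<lambda>x. (norm (complex_of_real (h x) - complex_of_real (g x)))\<^sup>2)"
        using square_integrable_diff[OF hs L2_closed_square_integrable[OF V gV]]
        unfolding square_integrable_def by (rule conjunct2)
      show "AE x in M. (norm (complex_of_real (h x) - complex_of_real (g x)))\<^sup>2 \<le> e\<^sup>2"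
        using supp'
      proof eventually_elim
        case (elim x)
        then have "norm (complex_of_real (h x) - complex_of_real (g x)) \<le> e"
          using g(2)[of x] by (simp only: of_real_diff[symmetric] norm_of_real less_imp_le)
        then show ?case by (intro power_mono) auto
      qed
    qed simp
    also have "\<dots> < \<epsilon>" using e \<epsilon> prob_space[unfolded space_eq_univ] by simp
    finally show "\<exists>g\<in>V. (\<integral>x. (norm (complex_of_real (h x) - g x))\<^sup>2 \<partial>M) < \<epsilon>"
      using gV by (intro bexI[of _ "\<lambda>x. complex_of_real (g x)"])
  qed
  have ray: "(\<lambda>x. complex_of_real (indicator {..a} x)) \<in> V" for a :: real
  proof (rule L2_closed_dominated[OF V])
    show "(\<lambda>x. complex_of_real (cts_step a (a + inverse (real (Suc n))) x)) \<in> V" for n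
    proof (rule cont)
      have "uniformly_continuous_on UNIV (cts_step a (a + inverse (real (Suc n))))"
        by (rule cts_step_uniformly_continuous) simp
      then show "continuous_on UNIV (cts_step a (a + inverse (real (Suc n))))"
        by (rule uniformly_continuous_imp_continuous)
    qed
    show "(\<lambda>n. complex_of_real (cts_step a (a + inverse (real (Suc n))) x)) \<longlonglongrightarrow> complex_of_real (indicator {..a} x)" for x
    proof (intro tendsto_of_real tendsto_eventually)
      show "\<forall>\<^sub>F n in sequentially. cts_step a (a + inverse (real (Suc n))) x = indicator {..a} x"
      proof (cases "x \<le> a")
        case False
        then have "\<forall>\<^sub>F n in sequentially. inverse (real (Suc n)) < x - a"
          using order_tendstoD(2)[OF LIMSEQ_inverse_real_of_nat, of "x - a"] by simp
        then show ?thesis by eventually_elim (use False in \<open>auto simp: cts_step_def\<close>)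
      qed (auto simp: cts_step_def)
    qed
    show "norm (complex_of_real (cts_step a (a + inverse (real (Suc n))) x)) \<le> 1" for n x
      by (auto simp: cts_step_def divide_le_eq_1)
  qed auto
  have borel: "(\<lambda>x. complex_of_real (indicator A x)) \<in> V" if "A \<in> sets borel" for A :: "real set"
  proof -
    have "Int_stable (range (\<lambda>a::real. {..a}))" by (auto simp: Int_stable_def)
    moreover have "range (\<lambda>a::real. {..a}) \<subseteq> Pow UNIV" by simp
    moreover have "A \<in> sigma_sets UNIV (range (\<lambda>a::real. {..a}))" using that by (simp add: borel_eq_atMost)
    ultimately show ?thesis
    proof (induction A rule: sigma_sets_induct_disjoint)
      case (basic A)
      then show ?case using ray by auto
    next
      case empty
      then show ?case using const[of 0] by simp
    next
      case (compl A)
      have "(\<lambda>x. 1 - complex_of_real (indicator A x)) \<in> V"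
        by (rule L2_closed_diff[OF V const compl(2)])
      then show ?case by (simp add: indicator_diff)
    next
      case (union A)
      have meas: "A i \<in> sets borel" for i using union(2) by (auto simp: borel_eq_atMost)
      show ?case
      proof (rule L2_closed_dominated[OF V])
        show "(\<lambda>x. \<Sum>i<n. complex_of_real (indicator (A i) x)) \<in> V" for n
          by (intro L2_closed_sum[OF V] const union(3)) auto
        \<comment> \<open>Disjointness turns partial sums into indicators of partial unions, so 1
          dominates them all.\<close>
        have sum_eq: "(\<Sum>i<n. complex_of_real (indicator (A i) x)) = complex_of_real (indicator (\<Union>i<n. A i) x)" for n x
        proof -
          have "indicat_real (\<Union>i<n. A i) x = (\<Sum>i<n. indicator (A i) x)"
            by (rule indicator_UN_disjoint) (use union(1) in \<open>auto simp: disjoint_family_on_def\<close>)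
          then show ?thesis by simp
        qed
        have "(\<lambda>n. complex_of_real (indicator (\<Union>i<n. A i) x)) \<longlonglongrightarrow> complex_of_real (indicator (\<Union>i. A i) x)" for x
          by (intro tendsto_of_real LIMSEQ_indicator_UN)
        then show "(\<lambda>n. \<Sum>i<n. complex_of_real (indicator (A i) x)) \<longlonglongrightarrow> complex_of_real (indicator (\<Union>i. A i) x)" for x
          by (simp add: sum_eq)
        show "norm (\<Sum>i<n. complex_of_real (indicator (A i) x)) \<le> 1" for n x
          unfolding sum_eq by (simp add: indicator_def)
      qed (use meas in auto)
    qed
  qed
  \<comment> \<open>Square integrability is carried through the induction as a premise: by
    nonnegativity, summands and approximants are dominated by u and inherit it.\<close>
  have nonneg: "(\<lambda>x. complex_of_real (u x)) \<in> V"
    if "u \<in> borel_measurable M" "\<And>x. 0 \<le> u x" "integrable M (\<lambda>x. (u x)\<^sup>2)" for u :: "real \<Rightarrow> real"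
    using that
  proof (induction u rule: borel_measurable_induct_real)
    case (set A)
    then show ?case using borel by simp
  next
    case (mult u c)
    show ?case
    proof (cases "c = 0")
      case True
      then show ?thesis using const[of 0] by simp
    next
      case False
      then have "integrable M (\<lambda>x. (u x)\<^sup>2)" using mult.prems by (simp add: power_mult_distrib)
      then show ?thesis using L2_closed_cmult[OF V mult.IH, of "complex_of_real c"] by simp
    qed
  next
    case (add u v)
    have [measurable]: "u \<in> borel_measurable M" "v \<in> borel_measurable M" by fact+
    have "(u x)\<^sup>2 \<le> (v x + u x)\<^sup>2" "(v x)\<^sup>2 \<le> (v x + u x)\<^sup>2" for x
      using add.hyps(2)[of x] add.hyps(4)[of x] by (intro power_mono; simp)+
    then have "integrable M (\<lambda>x. (u x)\<^sup>2)" "integrable M (\<lambda>x. (v x)\<^sup>2)"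
      by (auto intro!: Bochner_Integration.integrable_bound[OF add.prems])
    then show ?case using L2_closed_add[OF V] add.IH by simp
  next
    case (seq U)
    have meas [measurable]: "U i \<in> borel_measurable M" for i by fact
    have lim: "(\<lambda>i. U i x) \<longlonglongrightarrow> u x" for x using seq.hyps(4)[of x] by (simp add: space_eq_univ)
    have le: "U i x \<le> u x" for i x
      using seq.hyps(3) lim by (intro incseq_le) (auto simp: incseq_def le_fun_def)
    show ?case
    proof (rule L2_closed_dominated[OF V])
      have "u \<in> borel_measurable M"
        by (rule borel_measurable_LIMSEQ_real[of _ U]) (use lim in auto)
      then show "(\<lambda>x. complex_of_real (u x)) \<in> borel_measurable M" by simp
      show "(\<lambda>x. complex_of_real (U n x)) \<in> V" for n
        by (rule seq.IH, rule Bochner_Integration.integrable_bound[OF seq.prems])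
          (auto intro!: power_mono le seq.hyps(2))
      show "(\<lambda>n. complex_of_real (U n x)) \<longlonglongrightarrow> complex_of_real (u x)" for x
        by (intro tendsto_of_real lim)
      show "norm (complex_of_real (U n x)) \<le> u x" for n x
        using le seq.hyps(2) by simp
    qed (rule seq.prems)
  qed
  have real: "(\<lambda>x. complex_of_real (u x)) \<in> V"
    if [measurable]: "u \<in> borel_measurable M" and int: "integrable M (\<lambda>x. (u x)\<^sup>2)" for u :: "real \<Rightarrow> real"
  proof -
    have "(max 0 (u x))\<^sup>2 \<le> (u x)\<^sup>2" "(max 0 (- u x))\<^sup>2 \<le> (u x)\<^sup>2" for x
      by (auto simp: max_def)
    then have "integrable M (\<lambda>x. (max 0 (u x))\<^sup>2)" "integrable M (\<lambda>x. (max 0 (- u x))\<^sup>2)"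
      by (auto intro!: Bochner_Integration.integrable_bound[OF int])
    then have "(\<lambda>x. complex_of_real (max 0 (u x))) \<in> V" "(\<lambda>x. complex_of_real (max 0 (- u x))) \<in> V"
      by (auto intro!: nonneg)
    from L2_closed_diff[OF V this] have "(\<lambda>x. complex_of_real (max 0 (u x) - max 0 (- u x))) \<in> V" by simp
    moreover have "max 0 (u x) - max 0 (- u x) = u x" for x by (simp add: max_def)
    ultimately show ?thesis by simp
  qed
  have [measurable]: "f \<in> borel_measurable M" and fint: "integrable M (\<lambda>x. (norm (f x))\<^sup>2)"
    using f by (auto simp: square_integrable_def)
  have "(Re z)\<^sup>2 \<le> (norm z)\<^sup>2" "(Im z)\<^sup>2 \<le> (norm z)\<^sup>2" for z
    by (auto simp: cmod_power2)
  then have "integrable M (\<lambda>x. (Re (f x))\<^sup>2)" "integrable M (\<lambda>x. (Im (f x))\<^sup>2)"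
    by (auto intro!: Bochner_Integration.integrable_bound[OF fint])
  then have "(\<lambda>x. complex_of_real (Re (f x))) \<in> V" "(\<lambda>x. complex_of_real (Im (f x))) \<in> V"
    by (auto intro!: real)
  then have "(\<lambda>x. complex_of_real (Re (f x)) + \<i> * complex_of_real (Im (f x))) \<in> V"
    by (intro L2_closed_add[OF V] L2_closed_cmult[OF V])
  then show ?thesis by (simp flip: complex_eq)
qed

section \<open>Closed spans and the completeness criterion\<close>

text \<open>The functions that satisfy the density clause of \<open>L2_orthonormal_basis\<close> for
  the exponentials.\<close>

definition span_closure :: "real measure \<Rightarrow> real set \<Rightarrow> (real \<Rightarrow> complex) set" where
  "span_closure M \<Lambda> = {f. square_integrable M f \<and>
     (\<forall>\<epsilon>>0. \<exists>F c. finite F \<and> F \<subseteq> \<Lambda> \<and> (\<integral>x. (norm (f x - (\<Sum>l\<in>F. c l * ec (l * x))))\<^sup>2 \<partial>M) < \<epsilon>)}"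

lemma square_integrable_ec_sum:
  assumes "real_distribution M"
  shows "square_integrable M (\<lambda>x. \<Sum>l\<in>F. c l * ec (l * x))"
proof -
  interpret real_distribution M by fact
  have m: "(\<lambda>x. ec (l * x)) \<in> borel_measurable M" for l
    using continuous_ec[of UNIV l] by (simp add: borel_measurable_continuous_onI)
  show ?thesis
  proof (rule square_integrable_AE_bounded)
    show "(\<lambda>x. \<Sum>l\<in>F. c l * ec (l * x)) \<in> borel_measurable M" using m by simp
    show "AE x in M. norm (\<Sum>l\<in>F. c l * ec (l * x)) \<le> (\<Sum>l\<in>F. norm (c l))"
      by (intro AE_I2 sum_norm_le) (simp add: norm_mult)
  qed
qed

lemma L2_approx_trans:
  assumes "square_integrable M f" "square_integrable M g" "square_integrable M h"
    and "(\<integral>x. (norm (f x - g x))\<^sup>2 \<partial>M) < \<epsilon> / 4" "(\<integral>x. (norm (g x - h x))\<^sup>2 \<partial>M) < \<epsilon> / 4"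
  shows "(\<integral>x. (norm (f x - h x))\<^sup>2 \<partial>M) < \<epsilon>"
proof -
  have int: "integrable M (\<lambda>x. (norm (f x - h x))\<^sup>2)" "integrable M (\<lambda>x. (norm (f x - g x))\<^sup>2)"
    "integrable M (\<lambda>x. (norm (g x - h x))\<^sup>2)"
    using square_integrable_diff assms(1-3) by (auto simp: square_integrable_def)
  have "(\<integral>x. (norm (f x - h x))\<^sup>2 \<partial>M) \<le> (\<integral>x. 2 * (norm (f x - g x))\<^sup>2 + 2 * (norm (g x - h x))\<^sup>2 \<partial>M)"
  proof (rule integral_mono)
    fix x
    show "(norm (f x - h x))\<^sup>2 \<le> 2 * (norm (f x - g x))\<^sup>2 + 2 * (norm (g x - h x))\<^sup>2"
      using norm_diff_sq_le[of "f x - g x" "h x - g x"] by (simp add: norm_minus_commute)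
  qed (use int in auto)
  also have "\<dots> = 2 * (\<integral>x. (norm (f x - g x))\<^sup>2 \<partial>M) + 2 * (\<integral>x. (norm (g x - h x))\<^sup>2 \<partial>M)"
    using int by simp
  finally show ?thesis using assms(4,5) by linarith
qed

lemma span_closure_L2_closed:
  assumes M: "real_distribution M"
  shows "L2_closed M (span_closure M \<Lambda>)"
  unfolding L2_closed_def
proof (intro conjI ballI allI impI)
  fix f assume "f \<in> span_closure M \<Lambda>"
  then show "square_integrable M f" by (simp add: span_closure_def)
next
  fix f g assume fg: "f \<in> span_closure M \<Lambda>" "g \<in> span_closure M \<Lambda>"
  then have sq: "square_integrable M f" "square_integrable M g" by (auto simp: span_closure_def)
  show "(\<lambda>x. f x + g x) \<in> span_closure M \<Lambda>" unfolding span_closure_def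
  proof (intro CollectI conjI allI impI square_integrable_add sq)
    fix \<epsilon> :: real assume "\<epsilon> > 0"
    then have e: "\<epsilon> / 4 > 0" by simp
    obtain F c where F: "finite F" "F \<subseteq> \<Lambda>" "(\<integral>x. (norm (f x - (\<Sum>l\<in>F. c l * ec (l * x))))\<^sup>2 \<partial>M) < \<epsilon> / 4"
      using fg(1) e unfolding span_closure_def by blast
    obtain F' c' where F': "finite F'" "F' \<subseteq> \<Lambda>" "(\<integral>x. (norm (g x - (\<Sum>l\<in>F'. c' l * ec (l * x))))\<^sup>2 \<partial>M) < \<epsilon> / 4"
      using fg(2) e unfolding span_closure_def by blast
    define d where "d l = (if l \<in> F then c l else 0) + (if l \<in> F' then c' l else 0)" for l
    have d: "(\<Sum>l\<in>F \<union> F'. d l * ec (l * x)) = (\<Sum>l\<in>F. c l * ec (l * x)) + (\<Sum>l\<in>F'. c' l * ec (l * x))" for x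
    proof -
      have "(\<Sum>l\<in>F. c l * ec (l * x)) = (\<Sum>l\<in>F \<union> F'. (if l \<in> F then c l else 0) * ec (l * x))"
        using F(1) F'(1) by (intro sum.mono_neutral_cong_left) auto
      moreover have "(\<Sum>l\<in>F'. c' l * ec (l * x)) = (\<Sum>l\<in>F \<union> F'. (if l \<in> F' then c' l else 0) * ec (l * x))"
        using F(1) F'(1) by (intro sum.mono_neutral_cong_left) auto
      ultimately show ?thesis by (simp add: d_def distrib_right sum.distrib)
    qed
    let ?p = "\<lambda>x. \<Sum>l\<in>F. c l * ec (l * x)" and ?q = "\<lambda>x. \<Sum>l\<in>F'. c' l * ec (l * x)"
    have "(\<integral>x. (norm ((f x + g x) - (?p x + ?q x)))\<^sup>2 \<partial>M) < \<epsilon>"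
    proof (rule L2_approx_trans[where g = "\<lambda>x. ?p x + g x"])
      have "(norm (f x + g x - (?p x + g x)))\<^sup>2 = (norm (f x - ?p x))\<^sup>2" for x by simp
      then show "(\<integral>x. (norm (f x + g x - (?p x + g x)))\<^sup>2 \<partial>M) < \<epsilon> / 4" using F(3) by simp
      have "(norm (?p x + g x - (?p x + ?q x)))\<^sup>2 = (norm (g x - ?q x))\<^sup>2" for x by simp
      then show "(\<integral>x. (norm (?p x + g x - (?p x + ?q x)))\<^sup>2 \<partial>M) < \<epsilon> / 4" using F'(3) by simp
    qed (intro square_integrable_add sq square_integrable_ec_sum M)+
    then show "\<exists>F c. finite F \<and> F \<subseteq> \<Lambda> \<and> (\<integral>x. (norm ((f x + g x) - (\<Sum>l\<in>F. c l * ec (l * x))))\<^sup>2 \<partial>M) < \<epsilon>"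
      using F F' by (intro exI[of _ "F \<union> F'"] exI[of _ d]) (auto simp: d)
  qed
next
  fix b f assume f: "f \<in> span_closure M \<Lambda>"
  then have sq: "square_integrable M f" by (auto simp: span_closure_def)
  show "(\<lambda>x. b * f x) \<in> span_closure M \<Lambda>" unfolding span_closure_def
  proof (intro CollectI conjI allI impI square_integrable_cmult sq)
    fix \<epsilon> :: real assume \<epsilon>: "\<epsilon> > 0"
    \<comment> \<open>The added 1 keeps the quotient below meaningful for b = 0.\<close>
    have pos: "(norm b)\<^sup>2 + 1 > 0" by (simp add: add_nonneg_pos)
    then have "\<epsilon> / ((norm b)\<^sup>2 + 1) > 0" using \<epsilon> by simp
    then obtain F c where F: "finite F" "F \<subseteq> \<Lambda>" "(\<integral>x. (norm (f x - (\<Sum>l\<in>F. c l * ec (l * x))))\<^sup>2 \<partial>M) < \<epsilon> / ((norm b)\<^sup>2 + 1)"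
      using f unfolding span_closure_def by blast
    have "b * f x - (\<Sum>l\<in>F. (b * c l) * ec (l * x)) = b * (f x - (\<Sum>l\<in>F. c l * ec (l * x)))" for x
      by (simp add: right_diff_distrib sum_distrib_left mult.assoc)
    then have "(\<integral>x. (norm (b * f x - (\<Sum>l\<in>F. (b * c l) * ec (l * x))))\<^sup>2 \<partial>M) = (norm b)\<^sup>2 * (\<integral>x. (norm (f x - (\<Sum>l\<in>F. c l * ec (l * x))))\<^sup>2 \<partial>M)"
      by (simp add: norm_mult power_mult_distrib)
    also have "\<dots> \<le> (norm b)\<^sup>2 * (\<epsilon> / ((norm b)\<^sup>2 + 1))"
      using F(3) by (intro mult_left_mono) auto
    also have "\<dots> < \<epsilon>"
      using \<epsilon> by (simp only: times_divide_eq_right pos_divide_less_eq[OF pos]) (simp add: algebra_simps)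
    finally show "\<exists>F c. finite F \<and> F \<subseteq> \<Lambda> \<and> (\<integral>x. (norm (b * f x - (\<Sum>l\<in>F. c l * ec (l * x))))\<^sup>2 \<partial>M) < \<epsilon>"
      using F by (intro exI[of _ F] exI[of _ "\<lambda>l. b * c l"]) simp
  qed
next
  fix f assume sq: "square_integrable M f"
    and ap: "\<forall>\<epsilon>>0. \<exists>g\<in>span_closure M \<Lambda>. (\<integral>x. (norm (f x - g x))\<^sup>2 \<partial>M) < \<epsilon>"
  show "f \<in> span_closure M \<Lambda>" unfolding span_closure_def
  proof (intro CollectI conjI allI impI sq)
    fix \<epsilon> :: real assume "\<epsilon> > 0"
    then have e: "\<epsilon> / 4 > 0" by simp
    obtain g where g: "g \<in> span_closure M \<Lambda>" "(\<integral>x. (norm (f x - g x))\<^sup>2 \<partial>M) < \<epsilon> / 4" using ap e by blast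
    obtain F c where F: "finite F" "F \<subseteq> \<Lambda>" "(\<integral>x. (norm (g x - (\<Sum>l\<in>F. c l * ec (l * x))))\<^sup>2 \<partial>M) < \<epsilon> / 4"
      using g(1) e unfolding span_closure_def by blast
    have "(\<integral>x. (norm (f x - (\<Sum>l\<in>F. c l * ec (l * x))))\<^sup>2 \<partial>M) < \<epsilon>"
      by (rule L2_approx_trans[OF sq _ square_integrable_ec_sum[OF M] g(2) F(3)]) (use g in \<open>simp add: span_closure_def\<close>)
    then show "\<exists>F c. finite F \<and> F \<subseteq> \<Lambda> \<and> (\<integral>x. (norm (f x - (\<Sum>l\<in>F. c l * ec (l * x))))\<^sup>2 \<partial>M) < \<epsilon>"
      using F by blast
  qed
qed

definition fourier :: "real measure \<Rightarrow> real \<Rightarrow> complex" where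
  "fourier M y = (\<integral>x. ec (y * x) \<partial>M)"

lemma fourier_char: "fourier M y = char M (- 2 * pi * y)"
  by (simp add: fourier_def char_def ec_iexp mult.assoc)

lemma integrable_ec:
  assumes "real_distribution M"
  shows "integrable M (\<lambda>x. ec (y * x))"
proof -
  interpret real_distribution M by fact
  have "(\<lambda>x. ec (y * x)) \<in> borel_measurable M"
    using continuous_ec[of UNIV y] by (simp add: borel_measurable_continuous_onI)
  then show ?thesis by (intro integrable_const_bound[of _ 1]) auto
qed

lemma fourier_uminus: "fourier M (- y) = cnj (fourier M y)"
  by (simp add: fourier_def ec_uminus)

lemma fourier_0: "real_distribution M \<Longrightarrow> fourier M 0 = 1"
  by (simp add: fourier_char real_distribution.char_zero)

text \<open>Pythagoras for the orthogonal projection of an exponential to the span of F: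
  \<open>fourier M (y - a)\<close> is its inner product with the exponential at a.\<close>

lemma projection_error:
  assumes M: "real_distribution M" and F: "finite F"
    and orth: "\<And>a b. a \<in> F \<Longrightarrow> b \<in> F \<Longrightarrow> a \<noteq> b \<Longrightarrow> fourier M (a - b) = 0"
  shows "(\<integral>x. (norm (ec (y * x) - (\<Sum>a\<in>F. fourier M (y - a) * ec (a * x))))\<^sup>2 \<partial>M)
    = 1 - (\<Sum>a\<in>F. (norm (fourier M (y - a)))\<^sup>2)"
proof -
  interpret real_distribution M by (rule M)
  let ?c = "\<lambda>a. fourier M (y - a)"
  let ?s = "\<lambda>x. \<Sum>a\<in>F. ?c a * ec (a * x)"
  note int = integrable_ec[OF M]
  \<comment> \<open>The constant 1 is written \<open>ec (0 * x)\<close> so that every term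
    integrates to a value of \<open>fourier M\<close>.\<close>
  have pt: "complex_of_real ((norm (ec (y * x) - ?s x))\<^sup>2) =
      ec (0 * x) - (\<Sum>a\<in>F. cnj (?c a) * ec ((y - a) * x)) - (\<Sum>a\<in>F. ?c a * ec ((a - y) * x))
      + (\<Sum>a\<in>F. \<Sum>b\<in>F. ?c a * cnj (?c b) * ec ((a - b) * x))" for x
  proof -
    have "complex_of_real ((norm (ec (y * x) - ?s x))\<^sup>2) = (ec (y * x) - ?s x) * cnj (ec (y * x) - ?s x)"
      by (rule complex_norm_square)
    also have "\<dots> = ec (y * x) * cnj (ec (y * x)) - ec (y * x) * cnj (?s x) - ?s x * cnj (ec (y * x)) + ?s x * cnj (?s x)"
      by (simp add: algebra_simps)
    also have "ec (y * x) * cnj (ec (y * x)) = ec (0 * x)"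
      by (simp flip: ec_diff)
    also have "ec (y * x) * cnj (?s x) = (\<Sum>a\<in>F. cnj (?c a) * ec ((y - a) * x))"
      unfolding left_diff_distrib ec_diff cnj_sum sum_distrib_left
      by (rule sum.cong) (auto simp: mult_ac)
    also have "?s x * cnj (ec (y * x)) = (\<Sum>a\<in>F. ?c a * ec ((a - y) * x))"
      unfolding left_diff_distrib ec_diff sum_distrib_right
      by (rule sum.cong) (auto simp: mult_ac)
    also have "?s x * cnj (?s x) = (\<Sum>a\<in>F. \<Sum>b\<in>F. ?c a * cnj (?c b) * ec ((a - b) * x))"
      unfolding left_diff_distrib ec_diff cnj_sum sum_product
      by (intro sum.cong) (auto simp: mult_ac)
    finally show ?thesis .
  qed
  have sq: "?c a * cnj (?c a) = complex_of_real ((norm (?c a))\<^sup>2)" for a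
    by (rule complex_norm_square[symmetric])
  have "complex_of_real (\<integral>x. (norm (ec (y * x) - ?s x))\<^sup>2 \<partial>M) = (\<integral>x. complex_of_real ((norm (ec (y * x) - ?s x))\<^sup>2) \<partial>M)"
    by (rule integral_complex_of_real[symmetric])
  also have "\<dots> = fourier M 0 - (\<Sum>a\<in>F. cnj (?c a) * ?c a) - (\<Sum>a\<in>F. ?c a * fourier M (a - y))
      + (\<Sum>a\<in>F. \<Sum>b\<in>F. ?c a * cnj (?c b) * fourier M (a - b))"
  proof -
    have J: "(\<integral>x. ec (z * x) \<partial>M) = fourier M z" for z by (simp add: fourier_def)
    have "(\<integral>x. ec (0 * x) - (\<Sum>a\<in>F. cnj (c a) * ec ((y - a) * x)) - (\<Sum>a\<in>F. c a * ec ((a - y) * x))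
        + (\<Sum>a\<in>F. \<Sum>b\<in>F. c a * cnj (c b) * ec ((a - b) * x)) \<partial>M)
      = fourier M 0 - (\<Sum>a\<in>F. cnj (c a) * fourier M (y - a)) - (\<Sum>a\<in>F. c a * fourier M (a - y))
        + (\<Sum>a\<in>F. \<Sum>b\<in>F. c a * cnj (c b) * fourier M (a - b))" for c
      unfolding J[symmetric] by (simp add: int)
    then show ?thesis unfolding pt .
  qed
  also have "(\<Sum>a\<in>F. \<Sum>b\<in>F. ?c a * cnj (?c b) * fourier M (a - b)) = (\<Sum>a\<in>F. \<Sum>b\<in>F. if b = a then ?c a * cnj (?c a) else 0)"
    by (intro sum.cong refl) (auto simp: orth fourier_0[OF M])
  also have "\<dots> = (\<Sum>a\<in>F. ?c a * cnj (?c a))"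
    using F by simp
  also have "(\<Sum>a\<in>F. ?c a * fourier M (a - y)) = (\<Sum>a\<in>F. ?c a * cnj (?c a))"
    using fourier_uminus[of M "y - _"] by (intro sum.cong refl) (metis minus_diff_eq)
  also have "fourier M 0 - (\<Sum>a\<in>F. cnj (?c a) * ?c a) - (\<Sum>a\<in>F. ?c a * cnj (?c a)) + (\<Sum>a\<in>F. ?c a * cnj (?c a)) = 1 - (\<Sum>a\<in>F. ?c a * cnj (?c a))"
    by (simp add: fourier_0[OF M] mult.commute)
  also have "\<dots> = complex_of_real (1 - (\<Sum>a\<in>F. (norm (?c a))\<^sup>2))"
    unfolding sq by simp
  finally show ?thesis by (simp only: of_real_eq_iff)
qed

text \<open>By \<open>projection_error\<close>, \<open>complete\<close> says that the distance of
  each exponential from the span of \<open>A r\<close> tends to 0. The closed span then contains all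
  exponentials and hence all of L2.\<close>

lemma is_spectrumI:
  assumes M: "real_distribution M" and supp: "AE x in M. \<bar>x\<bar> \<le> R"
    and fin: "\<And>r. finite (A r :: real set)"
    and orth: "\<And>a b. a \<in> (\<Union>r. A r) \<Longrightarrow> b \<in> (\<Union>r. A r) \<Longrightarrow> a \<noteq> b \<Longrightarrow> fourier M (a - b) = 0"
    and complete: "\<And>y. (\<lambda>r. \<Sum>a\<in>A r. (norm (fourier M (y + a)))\<^sup>2) \<longlonglongrightarrow> 1"
  shows "is_spectrum M (\<Union>r. A r)"
proof -
  let ?\<Lambda> = "\<Union>r. A r"
  note V = span_closure_L2_closed[OF M, of ?\<Lambda>]
  have sq_ec: "square_integrable M (\<lambda>x. ec (y * x))" for y
    using square_integrable_ec_sum[OF M, where F = "{y}" and c = "\<lambda>_. 1"] by simp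
  have ec: "(\<lambda>x. ec (y * x)) \<in> span_closure M ?\<Lambda>" for y
    unfolding span_closure_def
  proof (intro CollectI conjI allI impI sq_ec)
    fix \<epsilon> :: real assume "\<epsilon> > 0"
    then have "\<forall>\<^sub>F r in sequentially. 1 - \<epsilon> < (\<Sum>a\<in>A r. (norm (fourier M (- y + a)))\<^sup>2)"
      using order_tendstoD(1)[OF complete[of "- y"], of "1 - \<epsilon>"] by simp
    then obtain r where r: "1 - \<epsilon> < (\<Sum>a\<in>A r. (norm (fourier M (- y + a)))\<^sup>2)"
      by (auto simp: eventually_sequentially)
    have "norm (fourier M (- y + a)) = norm (fourier M (y - a))" for a
      using fourier_uminus[of M "y - a"] by simp
    then have "(\<Sum>a\<in>A r. (norm (fourier M (y - a)))\<^sup>2) > 1 - \<epsilon>" using r by simp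
    moreover have "(\<integral>x. (norm (ec (y * x) - (\<Sum>a\<in>A r. fourier M (y - a) * ec (a * x))))\<^sup>2 \<partial>M)
        = 1 - (\<Sum>a\<in>A r. (norm (fourier M (y - a)))\<^sup>2)"
      by (rule projection_error[OF M fin]) (rule orth; blast)
    ultimately show "\<exists>F c. finite F \<and> F \<subseteq> ?\<Lambda> \<and> (\<integral>x. (norm (ec (y * x) - (\<Sum>l\<in>F. c l * ec (l * x))))\<^sup>2 \<partial>M) < \<epsilon>"
      using fin by (intro exI[of _ "A r"] exI[of _ "\<lambda>a. fourier M (y - a)"]) auto
  qed
  have eq: "exp (- 2 * complex_of_real pi * \<i> * complex_of_real l * complex_of_real x) = ec (l * x)" for l x
    by (simp add: ec_def mult.assoc)
  have prod: "(\<integral>x. ec (a * x) * cnj (ec (b * x)) \<partial>M) = fourier M (a - b)" for a b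
    by (simp add: fourier_def left_diff_distrib ec_diff)
  show ?thesis
    unfolding is_spectrum_def L2_orthonormal_basis_def eq
  proof (intro conjI ballI allI impI)
    show "countable ?\<Lambda>" by (rule countable_UN) (auto intro: countable_finite fin)
    show "square_integrable M (\<lambda>x. ec (i * x))" for i by (rule sq_ec)
    show "(\<integral>x. ec (i * x) * cnj (ec (j * x)) \<partial>M) = (if i = j then 1 else 0)" if "i \<in> ?\<Lambda>" "j \<in> ?\<Lambda>" for i j
      unfolding prod using orth[OF that] by (auto simp: fourier_0[OF M])
    fix f and \<epsilon> :: real assume f: "square_integrable M f" and "0 < \<epsilon>"
    have "f \<in> span_closure M ?\<Lambda>" by (rule L2_closed_exponentials_eq[OF M supp V ec f])
    then show "\<exists>F c. finite F \<and> F \<subseteq> ?\<Lambda> \<and> (\<integral>x. (norm (f x - (\<Sum>i\<in>F. c i * ec (i * x))))\<^sup>2 \<partial>M) < \<epsilon>"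
      using \<open>0 < \<epsilon>\<close> unfolding span_closure_def by blast
  qed
qed

section \<open>The random convolution as a series\<close>

text \<open>The geometric bound makes the series converge at every point, and dominated convergence
  passes to characteristic functions; Levy's continuity theorem then gives the weak limit. Factors
  are indexed from 1, so the series runs over \<open>X (Suc k)\<close>.\<close>

lemma (in prob_space) infinite_convolution_eq_distr:
  fixes X :: "nat \<Rightarrow> 'a \<Rightarrow> real"
  assumes indep: "indep_vars (\<lambda>_. borel) X {1..}"
    and bound: "\<And>k u. k \<ge> 1 \<Longrightarrow> u \<in> space M \<Longrightarrow> \<bar>X k u\<bar> \<le> C / 2 ^ k"
    and \<nu>: "\<And>k. k \<ge> 1 \<Longrightarrow> \<nu> k = distr M borel (X k)"
  shows "infinite_convolution \<nu> = distr M borel (\<lambda>u. \<Sum>k. X (Suc k) u)"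
    and "\<And>s. (\<lambda>k. \<Prod>i<k. char (\<nu> (Suc i)) s) \<longlonglongrightarrow> char (distr M borel (\<lambda>u. \<Sum>k. X (Suc k) u)) s"
    and "\<And>u. u \<in> space M \<Longrightarrow> \<bar>\<Sum>k. X (Suc k) u\<bar> \<le> C"
    and "random_variable borel (\<lambda>u. \<Sum>k. X (Suc k) u)"
proof -
  have rv [measurable]: "random_variable borel (X (Suc k))" for k
    using indep by (auto simp: indep_vars_def)
  define T where "T u = (\<Sum>k. X (Suc k) u)" for u
  define S where "S k u = (\<Sum>i\<in>{1..k}. X i u)" for k u
  have S_alt: "S k u = (\<Sum>i<k. X (Suc i) u)" for k u
    unfolding S_def by (rule sum.reindex_bij_witness[of _ Suc "\<lambda>i. i - 1"]) auto
  have S_rv [measurable]: "random_variable borel (S k)" for k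
    unfolding S_alt[abs_def] by measurable
  have geo: "(\<lambda>k. C / 2 ^ Suc k) sums C"
    using sums_mult[OF power_half_series, of C] by (simp add: power_divide)
  have summ: "summable (\<lambda>k. X (Suc k) u)" if "u \<in> space M" for u
    by (rule summable_comparison_test'[OF sums_summable[OF geo], of 0]) (use bound[OF _ that] in \<open>simp del: power_Suc\<close>)
  have T_lim: "(\<lambda>k. S k u) \<longlonglongrightarrow> T u" if "u \<in> space M" for u
    unfolding S_alt T_def using summable_LIMSEQ[OF summ[OF that]] .
  have T_rv [measurable]: "random_variable borel T"
    by (rule borel_measurable_LIMSEQ_real[of _ S]) (use T_lim in auto)
  show rv_T: "random_variable borel (\<lambda>u. \<Sum>k. X (Suc k) u)" using T_rv by (simp add: T_def[abs_def])
  show "\<bar>\<Sum>k. X (Suc k) u\<bar> \<le> C" if u: "u \<in> space M" for u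
  proof -
    have sa: "summable (\<lambda>k. \<bar>X (Suc k) u\<bar>)"
      by (rule summable_comparison_test'[OF sums_summable[OF geo], of 0]) (use bound[OF _ u] in \<open>simp del: power_Suc\<close>)
    have "\<bar>\<Sum>k. X (Suc k) u\<bar> \<le> (\<Sum>k. \<bar>X (Suc k) u\<bar>)" by (rule summable_rabs[OF sa])
    also have "\<dots> \<le> (\<Sum>k. C / 2 ^ Suc k)"
      by (rule suminf_le[OF _ sa sums_summable[OF geo]]) (use bound[OF _ u] in \<open>simp del: power_Suc\<close>)
    also have "\<dots> = C" by (rule sums_unique[OF geo, symmetric])
    finally show ?thesis .
  qed
  have fin: "finite_convolution \<nu> k = distr M borel (S k)" for k
  proof (induction k)
    case 0
    have "S 0 = (\<lambda>u. 0)" by (simp add: S_def[abs_def])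
    then show ?case by (simp add: distr_const)
  next
    case (Suc k)
    have "indep_var borel (X (Suc k)) borel (\<lambda>u. \<Sum>i\<in>{1..k}. X i u)"
      by (rule indep_vars_sum) (auto intro: indep_vars_subset[OF indep])
    then have iv: "indep_var borel (X (Suc k)) borel (S k)" by (simp add: S_def[abs_def])
    have "distr M borel (\<lambda>u. X (Suc k) u + S k u) = convolution (distr M borel (X (Suc k))) (distr M borel (S k))"
      by (rule sum_indep_random_variable[OF iv]) auto
    also have "\<dots> = convolution (distr M borel (S k)) (distr M borel (X (Suc k)))"
      by (rule convolution_commutative) (auto intro!: prob_space.finite_measure prob_space_distr)
    also have "(\<lambda>u. X (Suc k) u + S k u) = S (Suc k)"
      by (auto simp: S_def)
    finally show ?case by (simp add: Suc \<nu>)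
  qed
  have rdS: "real_distribution (finite_convolution \<nu> k)" for k
    unfolding fin by (rule real_distribution_distr) simp
  have rdT: "real_distribution (distr M borel T)" by (rule real_distribution_distr) simp
  have char_lim: "(\<lambda>k. char (finite_convolution \<nu> k) s) \<longlonglongrightarrow> char (distr M borel T) s" for s
  proof -
    have "(\<lambda>k. \<integral>u. iexp (s * S k u) \<partial>M) \<longlonglongrightarrow> (\<integral>u. iexp (s * T u) \<partial>M)"
    proof (rule integral_dominated_convergence[where w = "\<lambda>_. 1"])
      show "AE u in M. (\<lambda>k. iexp (s * S k u)) \<longlonglongrightarrow> iexp (s * T u)"
        by (intro AE_I2 tendsto_intros T_lim)
    qed auto
    then show ?thesis by (simp add: fin char_def integral_distr)
  qed
  have conv: "weak_conv_m (finite_convolution \<nu>) (distr M borel T)"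
    by (rule levy_continuity[OF rdS rdT char_lim])
  have "infinite_convolution \<nu> = distr M borel T"
    unfolding infinite_convolution_def
  proof (rule the_equality)
    show "real_distribution (distr M borel T) \<and> weak_conv_m (finite_convolution \<nu>) (distr M borel T)"
      using rdT conv by blast
    \<comment> \<open>\<open>THE\<close> calls for uniqueness: any two weak limits share their
      characteristic function.\<close>
    fix \<mu> assume \<mu>: "real_distribution \<mu> \<and> weak_conv_m (finite_convolution \<nu>) \<mu>"
    have "char \<mu> s = char (distr M borel T) s" for s
    proof (rule LIMSEQ_unique[OF _ char_lim])
      show "(\<lambda>k. char (finite_convolution \<nu> k) s) \<longlonglongrightarrow> char \<mu> s"
        by (rule levy_continuity1[OF rdS]) (use \<mu> in auto)
    qed
    then show "\<mu> = distr M borel T" using Levy_uniqueness[of \<mu>, OF _ rdT] \<mu> by blast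
  qed
  then show "infinite_convolution \<nu> = distr M borel (\<lambda>u. \<Sum>k. X (Suc k) u)" by (simp add: T_def[abs_def])
  have "char (finite_convolution \<nu> k) s = (\<Prod>i<k. char (\<nu> (Suc i)) s)" for k s
  proof -
    have "char (finite_convolution \<nu> k) s = (\<Prod>i\<in>{1..k}. char (distr M borel (X i)) s)"
      unfolding fin S_def[abs_def] by (rule char_distr_sum, rule indep_vars_subset[OF indep]) auto
    also have "\<dots> = (\<Prod>i<k. char (\<nu> (Suc i)) s)"
      by (rule prod.reindex_bij_witness[of _ Suc "\<lambda>i. i - 1"]) (auto simp: \<nu>)
    finally show ?thesis .
  qed
  then show "(\<lambda>k. \<Prod>i<k. char (\<nu> (Suc i)) s) \<longlonglongrightarrow> char (distr M borel (\<lambda>u. \<Sum>k. X (Suc k) u)) s" for s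
    using char_lim[of s] by (simp add: T_def[abs_def])
qed

lemma char_uniform_atomic:
  assumes "finite D" "D \<noteq> {}"
  shows "char (uniform_atomic D) s = (\<Sum>d\<in>D. iexp (s * d)) / of_nat (card D)"
proof -
  have "char (uniform_atomic D) s = (\<integral>x. iexp (s * x) \<partial>measure_pmf (pmf_of_set D))"
    unfolding uniform_atomic_def char_def by (rule integral_distr) auto
  also have "\<dots> = (\<Sum>d\<in>D. iexp (s * d)) / of_nat (card D)"
    unfolding sum_divide_distrib using assms
    by (subst integral_measure_pmf[where A = D])
      (auto simp: scaleR_conv_of_real intro!: sum.cong split: if_splits)
  finally show ?thesis .
qed

lemma uniform_atomic_image:
  fixes f :: "'a \<Rightarrow> real"
  assumes "finite B" "B \<noteq> {}" "inj_on f B"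
  shows "uniform_atomic (f ` B) = distr (measure_pmf (pmf_of_set B)) borel f"
proof -
  have "measure_pmf (pmf_of_set (f ` B)) = distr (measure_pmf (pmf_of_set B)) (count_space UNIV) f"
    using map_pmf_of_set_inj[OF assms(3,2,1)] by (metis map_pmf_rep_eq)
  then show ?thesis unfolding uniform_atomic_def by (subst \<open>measure_pmf (pmf_of_set (f ` B)) = _\<close>, subst distr_distr) (auto simp: o_def)
qed

section \<open>Common spectra of a Moran measure\<close>

lemma (in moran) common_spectrum_exists:
  assumes \<mu>: "real_distribution \<mu>" and supp: "AE x in \<mu>. \<bar>x\<bar> \<le> R"
    and lim: "\<And>\<xi>. (\<lambda>j. G 0 j \<xi>) \<longlonglongrightarrow> fourier \<mu> \<xi>"
  obtains \<Lambda> :: "real set" where "\<And>t. t \<in> E \<Longrightarrow> is_spectrum \<mu> ((\<lambda>x. real t * x) ` \<Lambda>)" "\<Lambda> \<notin> range (F :: nat \<Rightarrow> real set)"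
proof -
  obtain \<Lambda> where fin: "\<And>r. finite (\<Lambda> r)" and mono: "incseq \<Lambda>"
    and orth: "\<And>t a b. t \<in> E \<Longrightarrow> a \<in> (\<Union>r. \<Lambda> r) \<Longrightarrow> b \<in> (\<Union>r. \<Lambda> r) \<Longrightarrow> a \<noteq> b \<Longrightarrow> fourier \<mu> (real t * of_int (a - b)) = 0"
    and complete: "\<And>t \<xi>. t \<in> E \<Longrightarrow> (\<lambda>r. \<Sum>a\<in>\<Lambda> r. (norm (fourier \<mu> (\<xi> + real t * of_int a)))\<^sup>2) \<longlonglongrightarrow> 1"
    and avoid: "\<And>r. real_of_int ` (\<Union>r. \<Lambda> r) \<noteq> F r"
    by (rule spectrum_exists[OF lim, where F = F]) blast
  show ?thesis
  proof (rule that[of "real_of_int ` (\<Union>r. \<Lambda> r)"])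
    show "real_of_int ` (\<Union>r. \<Lambda> r) \<notin> range F" using avoid by blast
    fix t assume t: "t \<in> E"
    let ?A = "\<lambda>r. (\<lambda>a. real t * of_int a) ` \<Lambda> r"
    have inj: "inj_on (\<lambda>a. real t * real_of_int a) (\<Lambda> r)" for r
      using E(2)[OF t] by (auto simp: inj_on_def)
    have "is_spectrum \<mu> (\<Union>r. ?A r)"
    proof (rule is_spectrumI[OF \<mu> supp])
      show "finite (?A r)" for r using fin by simp
      fix x y assume xy: "x \<in> (\<Union>r. ?A r)" "y \<in> (\<Union>r. ?A r)" "x \<noteq> y"
      then obtain a b where ab: "a \<in> (\<Union>r. \<Lambda> r)" "b \<in> (\<Union>r. \<Lambda> r)" "x = real t * of_int a" "y = real t * of_int b" by blast
      then have "a \<noteq> b" using xy(3) by blast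
      then show "fourier \<mu> (x - y) = 0"
        using orth[OF t ab(1,2)] ab(3,4) by (simp add: right_diff_distrib)
    next
      show "(\<lambda>r. \<Sum>a\<in>?A r. (norm (fourier \<mu> (y + a)))\<^sup>2) \<longlonglongrightarrow> 1" for y
        unfolding sum.reindex[OF inj] o_def by (rule complete[OF t])
    qed
    moreover have "(\<Union>r. ?A r) = (\<lambda>x. real t * x) ` real_of_int ` (\<Union>r. \<Lambda> r)" by (auto simp: image_image)
    ultimately show "is_spectrum \<mu> ((\<lambda>x. real t * x) ` real_of_int ` (\<Union>r. \<Lambda> r))" by simp
  qed
qed

section \<open>Hadamard sets for powers of the base\<close>

text \<open>Reduces integer numerators to the natural exponents of
  \<open>vanishing_root_sum_galois\<close>.\<close>

lemma ec_divide_power: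
  assumes "N > 0"
  shows "ec (of_int a / real N) = ec (1 / real N) ^ nat (a mod int N)"
proof -
  have "of_int a / real N = of_int (a mod int N) / real N + of_int (a div int N)"
  proof -
    have "real_of_int a = of_int (int N * (a div int N) + a mod int N)" by simp
    then have "real_of_int a = real N * of_int (a div int N) + of_int (a mod int N)" by (simp only: of_int_add of_int_mult of_int_of_nat_eq)
    then show ?thesis using assms by (simp add: field_simps)
  qed
  then have "ec (of_int a / real N) = ec (of_int (a mod int N) / real N)" by (simp add: ec_add_Ints)
  also have "\<dots> = ec (real (nat (a mod int N)) * (1 / real N))" using assms by simp
  finally show ?thesis by (simp only: ec_mult_nat)
qed

lemma vanishing_ec_sum:
  fixes a :: "'i \<Rightarrow> int"
  assumes N: "N > 0" and I: "finite I" and t: "coprime t N" "t > 0"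
    and zero: "(\<Sum>i\<in>I. ec (of_int (a i) / real N)) = 0"
  shows "(\<Sum>i\<in>I. ec (real t * of_int (a i) / real N)) = 0"
proof -
  let ?b = "\<lambda>i. nat (a i mod int N)"
  have "(\<Sum>i\<in>I. ec (1 / real N) ^ ?b i) = 0" using zero by (simp add: ec_divide_power[OF N])
  moreover have "ec (1 / real N) ^ N = 1"
    using N by (simp flip: ec_mult_nat) (metis ec_of_int of_int_1)
  ultimately have "(\<Sum>i\<in>I. ec (1 / real N) ^ (t * ?b i)) = 0"
    by (intro vanishing_root_sum_galois[OF N _ I t])
  moreover have "ec (real t * of_int (a i) / real N) = ec (1 / real N) ^ (t * ?b i)" for i
    using ec_mult_nat[of t "of_int (a i) / real N"] by (simp add: ec_divide_power[OF N] mult.commute[of t] power_mult)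
  ultimately show ?thesis by simp
qed

text \<open>Orthogonality of rows and columns depends only on differences, so L may be translated to
  contain 0. Digits congruent modulo N would give equal rows, which are not orthogonal.\<close>

lemma admissible_pair_sums:
  assumes "admissible_pair N B"
  obtains L :: "int set" where "finite L" "0 \<in> L"
    "\<And>b b'. b \<in> B \<Longrightarrow> b' \<in> B \<Longrightarrow> b \<noteq> b' \<Longrightarrow> (\<Sum>l\<in>L. ec (of_int ((b - b') * l) / real N)) = 0"
    "\<And>l l'. l \<in> L \<Longrightarrow> l' \<in> L \<Longrightarrow> l \<noteq> l' \<Longrightarrow> (\<Sum>b\<in>B. ec (of_int (b * (l - l')) / real N)) = 0"
    "card L = card B" "inj_on (\<lambda>b. b mod int N) B"
proof -
  have N: "N \<ge> 2" and B: "finite B" "card B \<ge> 2" using assms by (auto simp: admissible_pair_def)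
  define s where "s = complex_of_real (1 / sqrt (real (card B)))"
  have s: "s * cnj s = 1 / of_nat (card B)"
    using B by (simp add: s_def flip: of_real_mult real_sqrt_mult)
  obtain L :: "int set" where "unitary_matrix_on B L (\<lambda>b l. s * exp (- 2 * complex_of_real pi * \<i> * of_int b * of_int l / of_nat N))"
    using assms unfolding admissible_pair_def s_def by blast
  moreover have "exp (- 2 * complex_of_real pi * \<i> * of_int b * of_int l / of_nat N) = ec (of_int (b * l) / real N)" for b l
    by (simp add: ec_def mult.assoc)
  ultimately have L: "unitary_matrix_on B L (\<lambda>b l. s * ec (of_int (b * l) / real N))" by (simp del: of_int_mult)
  then have fin: "finite L" by (simp add: unitary_matrix_on_def)
  have n: "of_nat (card B) \<noteq> (0::complex)" using B by auto
  have row: "(\<Sum>l\<in>L. ec (of_int ((b - b') * l) / real N)) = (if b = b' then of_nat (card B) else 0)"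
    if "b \<in> B" "b' \<in> B" for b b'
  proof -
    have "(\<Sum>l\<in>L. (s * ec (of_int (b * l) / real N)) * cnj (s * ec (of_int (b' * l) / real N))) = (if b = b' then 1 else 0)"
      using L that by (simp add: unitary_matrix_on_def)
    also have "(\<Sum>l\<in>L. (s * ec (of_int (b * l) / real N)) * cnj (s * ec (of_int (b' * l) / real N))) = (\<Sum>l\<in>L. (s * cnj s) * ec (of_int ((b - b') * l) / real N))"
      by (intro sum.cong refl) (simp add: left_diff_distrib diff_divide_distrib ec_diff)
    finally show ?thesis using n by (simp add: s field_simps flip: sum_distrib_left sum_divide_distrib split: if_splits)
  qed
  have col: "(\<Sum>b\<in>B. ec (of_int (b * (l - l')) / real N)) = 0"
    if "l \<in> L" "l' \<in> L" "l \<noteq> l'" for l l'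
  proof -
    have "(\<Sum>b\<in>B. cnj (s * ec (of_int (b * l') / real N)) * (s * ec (of_int (b * l) / real N))) = 0"
      using L that by (simp add: unitary_matrix_on_def)
    also have "(\<Sum>b\<in>B. cnj (s * ec (of_int (b * l') / real N)) * (s * ec (of_int (b * l) / real N))) = (\<Sum>b\<in>B. (s * cnj s) * ec (of_int (b * (l - l')) / real N))"
      by (intro sum.cong refl) (simp add: right_diff_distrib diff_divide_distrib ec_diff)
    finally show ?thesis using n by (simp add: s flip: sum_distrib_left sum_divide_distrib)
  qed
  obtain b0 where b0: "b0 \<in> B" using B by fastforce
  have card: "card L = card B" using row[OF b0 b0] by simp
  have "L \<noteq> {}" using card B by auto
  then obtain l0 where l0: "l0 \<in> L" by blast
  define L' where "L' = (\<lambda>l. l - l0) ` L"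
  have inj: "inj_on (\<lambda>l. l - l0) L" by (simp add: inj_on_def)
  show ?thesis
  proof (rule that[of L'])
    show "finite L'" "0 \<in> L'" using fin l0 by (auto simp: L'_def)
    show "card L' = card B" using card card_image[OF inj] by (simp add: L'_def)
    fix b b' assume b: "b \<in> B" "b' \<in> B" "b \<noteq> b'"
    have "(\<Sum>l\<in>L'. ec (of_int ((b - b') * l) / real N)) = (\<Sum>l\<in>L. ec (of_int ((b - b') * l) / real N) * cnj (ec (of_int ((b - b') * l0) / real N)))"
      unfolding L'_def sum.reindex[OF inj] o_def right_diff_distrib of_int_diff diff_divide_distrib ec_diff ..
    also have "\<dots> = 0" using row[OF b(1,2)] b(3) by (simp flip: sum_distrib_right)
    finally show "(\<Sum>l\<in>L'. ec (of_int ((b - b') * l) / real N)) = 0" .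
  next
    fix l l' assume "l \<in> L'" "l' \<in> L'" "l \<noteq> l'"
    then obtain k k' where "k \<in> L" "k' \<in> L" "k \<noteq> k'" "l = k - l0" "l' = k' - l0" by (auto simp: L'_def)
    then show "(\<Sum>b\<in>B. ec (of_int (b * (l - l')) / real N)) = 0" using col[of k k'] by simp
  next
    show "inj_on (\<lambda>b. b mod int N) B"
    proof (rule inj_onI, rule ccontr)
      fix b b' assume b: "b \<in> B" "b' \<in> B" "b mod int N = b' mod int N" "b \<noteq> b'"
      then obtain q where q: "b - b' = int N * q" by (metis mod_eq_dvd_iff dvdE)
      have "of_int ((b - b') * l) / real N = of_int (q * l)" for l using N by (simp add: q)
      then have "(\<Sum>l\<in>L. ec (of_int ((b - b') * l) / real N)) = of_nat (card L)" by (simp del: of_int_mult)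
      then show False using row[OF b(1,2)] b(4) card n by simp
    qed
  qed
qed

text \<open>Multiplying a Hadamard set for N by N ^ (n - 1) restores the denominator N, so the
  matrix is the old one. Conjugation by t keeps its sums zero, and L is chosen before t.\<close>

lemma admissible_pair_power:
  assumes adm: "admissible_pair N B" and n: "n > 0"
  shows "\<exists>L. finite L \<and> 0 \<in> L \<and>
    (\<forall>t b b'. coprime t N \<longrightarrow> t > 0 \<longrightarrow> b \<in> B \<longrightarrow> b' \<in> B \<longrightarrow>
       (\<Sum>l\<in>L. ec (real t * of_int (b - b') * of_int l / real (N ^ n))) = (if b = b' then of_nat (card B) else 0)) \<and>
    (\<forall>t l l'. coprime t N \<longrightarrow> t > 0 \<longrightarrow> l \<in> L \<longrightarrow> l' \<in> L \<longrightarrow> l \<noteq> l' \<longrightarrow>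
       digit_mask B (real t * of_int (l - l') / real (N ^ n)) = 0)"
proof -
  have N: "N > 0" and B: "finite B" using adm by (auto simp: admissible_pair_def)
  obtain L where L: "finite L" "0 \<in> L"
    "\<And>b b'. b \<in> B \<Longrightarrow> b' \<in> B \<Longrightarrow> b \<noteq> b' \<Longrightarrow> (\<Sum>l\<in>L. ec (of_int ((b - b') * l) / real N)) = 0"
    "\<And>l l'. l \<in> L \<Longrightarrow> l' \<in> L \<Longrightarrow> l \<noteq> l' \<Longrightarrow> (\<Sum>b\<in>B. ec (of_int (b * (l - l')) / real N)) = 0"
    "card L = card B"
    using admissible_pair_sums[OF adm] by metis
  define f where "f l = int (N ^ (n - 1)) * l" for l
  have inj: "inj_on f L" using N by (auto simp: f_def inj_on_def)
  have pow: "real (N ^ n) = real (N ^ (n - 1)) * real N" using n by (cases n) auto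
  have f: "x * of_int (f l) / real (N ^ n) = x * of_int l / real N" for x l
    using N unfolding pow by (simp add: f_def)
  show ?thesis
  proof (intro exI[of _ "f ` L"] conjI allI impI)
    show "finite (f ` L)" using L(1) by simp
    show "0 \<in> f ` L" using L(2) by (force simp: f_def)
    fix t b b' assume t: "coprime t N" "t > 0" and b: "b \<in> B" "b' \<in> B"
    have "(\<Sum>l\<in>f ` L. ec (real t * of_int (b - b') * of_int l / real (N ^ n))) = (\<Sum>l\<in>L. ec (real t * of_int ((b - b') * l) / real N))"
      unfolding sum.reindex[OF inj] o_def f by (simp add: mult.assoc)
    also have "\<dots> = (if b = b' then of_nat (card B) else 0)"
    proof (cases "b = b'")
      case False
      then show ?thesis using vanishing_ec_sum[OF N L(1) t L(3)[OF b False]] by (simp del: of_int_mult)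
    qed (simp add: L(5))
    finally show "(\<Sum>l\<in>f ` L. ec (real t * of_int (b - b') * of_int l / real (N ^ n))) = (if b = b' then of_nat (card B) else 0)" .
  next
    fix t l l' assume t: "coprime t N" "t > 0" and l: "l \<in> f ` L" "l' \<in> f ` L" "l \<noteq> l'"
    then obtain k k' where k: "k \<in> L" "k' \<in> L" "k \<noteq> k'" "l = f k" "l' = f k'" by blast
    have diff: "f k - f k' = f (k - k')" by (simp add: f_def right_diff_distrib)
    have "(\<Sum>b\<in>B. ec (of_int b * (real t * of_int (l - l') / real (N ^ n)))) = (\<Sum>b\<in>B. ec (real t * of_int (b * (k - k')) / real N))"
      unfolding k diff f by (simp add: mult_ac)
    also have "\<dots> = 0" by (rule vanishing_ec_sum[OF N B t L(4)[OF k(1-3)]])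
    finally show "digit_mask B (real t * of_int (l - l') / real (N ^ n)) = 0" by (simp add: digit_mask_def)
  qed
qed

section \<open>Random digits that do not depend on the symbol sequence\<close>

text \<open>\<open>u (k, j)\<close> is the digit that place k uses when its symbol is j. The measure
  is a probability measure for every \<open>B\<close>, since \<open>pmf_of_set\<close> is a pmf even
  where its value is unspecified.\<close>

definition seed_space :: "(nat \<Rightarrow> int set) \<Rightarrow> (nat \<times> nat \<Rightarrow> int) measure" where
  "seed_space B = Pi\<^sub>M UNIV (\<lambda>p. measure_pmf (pmf_of_set (B (snd p))))"

text \<open>Digits are truncated at \<open>C\<close> so that the series converges at every seed, also on the null set
  where a seed is not a digit.\<close>

definition digit_term :: "(nat \<Rightarrow> nat) \<Rightarrow> (nat \<Rightarrow> nat) \<Rightarrow> real \<Rightarrow> (nat \<Rightarrow> nat) \<Rightarrow> nat \<Rightarrow> (nat \<times> nat \<Rightarrow> int) \<Rightarrow> real" where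
  "digit_term N n C \<omega> k u = (\<Prod>i=1..k. 1 / real (N (\<omega> i)) ^ n i) *
     (if \<bar>real_of_int (u (k, \<omega> k))\<bar> \<le> C then of_int (u (k, \<omega> k)) else 0)"

definition digit_series :: "(nat \<Rightarrow> nat) \<Rightarrow> (nat \<Rightarrow> nat) \<Rightarrow> real \<Rightarrow> (nat \<Rightarrow> nat) \<Rightarrow> (nat \<times> nat \<Rightarrow> int) \<Rightarrow> real" where
  "digit_series N n C \<omega> u = (\<Sum>k. digit_term N n C \<omega> (Suc k) u)"

lemma prob_space_seed_space: "prob_space (seed_space B)"
  unfolding seed_space_def by (intro prob_space_PiM measure_pmf.prob_space_axioms)

lemma space_seed_space [simp]: "space (seed_space B) = UNIV"
  by (simp add: seed_space_def space_PiM)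

text \<open>The target q is arbitrary because all pmfs on the integers carry the full power set as
  \<sigma>-algebra.\<close>

lemma measurable_seed: "(\<lambda>u. u p) \<in> measurable (seed_space B) (measure_pmf q)"
proof -
  have "(\<lambda>u. u p) \<in> measurable (seed_space B) (measure_pmf (pmf_of_set (B (snd p))))"
    unfolding seed_space_def by (rule measurable_component_singleton) simp
  then show ?thesis by simp
qed

lemma distr_seed: "distr (seed_space B) (measure_pmf (pmf_of_set (B j))) (\<lambda>u. u (k, j)) = measure_pmf (pmf_of_set (B j))"
proof -
  interpret product_prob_space "\<lambda>p. measure_pmf (pmf_of_set (B (snd p)))" "UNIV :: (nat \<times> nat) set"
    by (intro product_prob_spaceI measure_pmf.prob_space_axioms)
  show ?thesis using PiM_component[of "(k, j)"] by (simp add: seed_space_def)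
qed

text \<open>k \<mapsto> (k, \<omega> k) is injective, so the seeds that are read are distinct
  coordinates of a product measure.\<close>

lemma indep_seeds:
  "prob_space.indep_vars (seed_space B) (\<lambda>k. measure_pmf (pmf_of_set (B (\<omega> k)))) (\<lambda>k u. u (k, \<omega> k)) {1..}"
proof -
  interpret prob_space "seed_space B" by (rule prob_space_seed_space)
  have "distr (seed_space B) (Pi\<^sub>M {1::nat..} (\<lambda>k. measure_pmf (pmf_of_set (B (snd (k, \<omega> k)))))) (\<lambda>u. \<lambda>k\<in>{1..}. u (k, \<omega> k))
    = Pi\<^sub>M {1..} (\<lambda>k. measure_pmf (pmf_of_set (B (snd (k, \<omega> k)))))"
    unfolding seed_space_def
    by (rule distr_PiM_reindex) (simp_all add: inj_on_def measure_pmf.prob_space_axioms)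
  then have "distr (seed_space B) (Pi\<^sub>M {1::nat..} (\<lambda>k. measure_pmf (pmf_of_set (B (\<omega> k))))) (\<lambda>u. \<lambda>k\<in>{1..}. u (k, \<omega> k))
    = Pi\<^sub>M {1..} (\<lambda>k. distr (seed_space B) (measure_pmf (pmf_of_set (B (\<omega> k)))) (\<lambda>u. u (k, \<omega> k)))"
    by (simp only: snd_conv distr_seed)
  moreover have "{1::nat..} \<noteq> {}" by auto
  ultimately show ?thesis
    using measurable_seed by (subst indep_vars_iff_distr_eq_PiM') assumption+
qed

lemma measurable_symbol [measurable]:
  assumes "k \<ge> 1"
  shows "(\<lambda>\<omega>. \<omega> k) \<in> measurable (symbol_space m) (count_space {1..m})"
  unfolding symbol_space_def using assms by (intro measurable_component_singleton) simp

text \<open>\<omega> enters only through finitely many symbols with countably many values, so each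
  may be frozen when measurability is checked.\<close>

lemma measurable_digit_term:
  assumes k: "k \<ge> 1"
  shows "(\<lambda>p. digit_term N n C (fst p) k (snd p)) \<in> borel_measurable (symbol_space m \<Otimes>\<^sub>M seed_space B)"
proof -
  have sym: "(\<lambda>p. fst p i) \<in> measurable (symbol_space m \<Otimes>\<^sub>M seed_space B) (count_space {1..m})" if "i \<ge> 1" for i
    using measurable_compose[OF measurable_fst measurable_symbol[OF that]] .
  have w: "(\<lambda>p. \<Prod>i=1..k. 1 / real (N (fst p i)) ^ n i) \<in> borel_measurable (symbol_space m \<Otimes>\<^sub>M seed_space B)"
  proof (rule borel_measurable_prod)
    fix i assume "i \<in> {1..k}"
    then have "i \<ge> 1" by simp
    show "(\<lambda>p. 1 / real (N (fst p i)) ^ n i) \<in> borel_measurable (symbol_space m \<Otimes>\<^sub>M seed_space B)"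
      by (rule measurable_compose_countable'[OF _ sym[OF \<open>i \<ge> 1\<close>]]) auto
  qed
  have d: "(\<lambda>p. if \<bar>real_of_int (snd p (k, fst p k))\<bar> \<le> C then real_of_int (snd p (k, fst p k)) else 0)
      \<in> borel_measurable (symbol_space m \<Otimes>\<^sub>M seed_space B)"
  proof (rule measurable_compose_countable'[OF _ sym[OF k]])
    fix j
    have "(\<lambda>p. snd p (k, j)) \<in> measurable (symbol_space m \<Otimes>\<^sub>M seed_space B) (count_space UNIV)"
      using measurable_compose[OF measurable_snd measurable_seed[of "(k, j)" B "return_pmf 0"]] by simp
    then show "(\<lambda>p. if \<bar>real_of_int (snd p (k, j))\<bar> \<le> C then real_of_int (snd p (k, j)) else 0)
      \<in> borel_measurable (symbol_space m \<Otimes>\<^sub>M seed_space B)"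
      by (rule measurable_compose) simp
  qed simp
  show ?thesis unfolding digit_term_def by (intro borel_measurable_times w d)
qed

section \<open>Application to the random convolution\<close>

theorem corollary1p6:
  fixes m :: nat and N :: "nat \<Rightarrow> nat" and B :: "nat \<Rightarrow> int set" and n :: "nat \<Rightarrow> nat"
  assumes "m \<ge> 1"
    and "\<And>k. k \<in> {1..m} \<Longrightarrow> admissible_pair (N k) (B k)"
    and "\<And>k. k \<in> {1..m} \<Longrightarrow> card (B k) < N k"
    and "\<And>k. k \<ge> 1 \<Longrightarrow> n k > 0"
  shows "spectral_random_measure (symbol_space m) (random_convolution N B n) \<and>
         aleph1_spectral_eigen_set (symbol_space m) (random_convolution N B n)
           (coprime_scalings m N)"
proof -
  note m = assms(1) and adm = assms(2) and card_less = assms(3) and n = assms(4)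
  let ?J = "{1..m}"
  have B: "finite (B j)" "card (B j) \<ge> 2" "N j \<ge> 2" if "j \<in> ?J" for j
    using adm[OF that] by (auto simp: admissible_pair_def)
  have B_ne: "B j \<noteq> {}" if "j \<in> ?J" for j using B(2)[OF that] by auto
  have sym: "\<omega> k \<in> ?J" if "\<omega> \<in> space (symbol_space m)" "k \<ge> 1" for \<omega> k
    using that by (auto simp: symbol_space_def space_PiM PiE_iff)
  define C where "C = Max ((\<lambda>b. \<bar>real_of_int b\<bar>) ` (\<Union>j\<in>?J. B j))"
  have C: "\<bar>real_of_int b\<bar> \<le> C" if "j \<in> ?J" "b \<in> B j" for b j
    unfolding C_def
  proof (rule Max_ge)
    show "finite ((\<lambda>b. \<bar>real_of_int b\<bar>) ` (\<Union>j\<in>?J. B j))" using B(1) by blast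
    have "b \<in> (\<Union>j\<in>?J. B j)" using that by blast
    then show "\<bar>real_of_int b\<bar> \<in> (\<lambda>b. \<bar>real_of_int b\<bar>) ` (\<Union>j\<in>?J. B j)" by (rule imageI)
  qed
  have C_ge: "C \<ge> 0"
  proof -
    obtain b where "b \<in> B 1" using B_ne[of 1] m by auto
    then have "\<bar>real_of_int b\<bar> \<le> C" using C[of 1] m by auto
    then show ?thesis by linarith
  qed
  let ?S = "seed_space B"
  interpret prob_space ?S by (rule prob_space_seed_space)
  let ?w = "\<lambda>\<omega> k. \<Prod>i=1..k. 1 / real (N (\<omega> i)) ^ n i"
  let ?\<nu> = "\<lambda>\<omega> k. uniform_atomic ((\<lambda>b. ?w \<omega> k * of_int b) ` B (\<omega> k))"
  have w_pos: "?w \<omega> k > 0" if "\<omega> \<in> space (symbol_space m)" for \<omega> k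
    using B(3)[OF sym[OF that]] by (intro prod_pos) (force simp: zero_less_power)
  have w_nz: "?w \<omega> k \<noteq> 0" if "\<omega> \<in> space (symbol_space m)" for \<omega> k
    using w_pos[OF that, of k] by (rule less_imp_neq[symmetric])
  have w_le: "?w \<omega> k \<le> 1 / 2 ^ k" if \<omega>: "\<omega> \<in> space (symbol_space m)" for \<omega> k
  proof -
    have "?w \<omega> k \<le> (\<Prod>i=1..k. 1 / 2)"
    proof (rule prod_mono)
      fix i assume i: "i \<in> {1..k}"
      have "2 \<le> real (N (\<omega> i))" using B(3)[OF sym[OF \<omega>, of i]] i by simp
      also have "\<dots> \<le> real (N (\<omega> i)) ^ n i" using calculation n[of i] i by (intro self_le_power) auto
      finally show "0 \<le> 1 / real (N (\<omega> i)) ^ n i \<and> 1 / real (N (\<omega> i)) ^ n i \<le> 1 / 2"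
        using frac_le[of 1 1 2 "real (N (\<omega> i)) ^ n i"] by simp
    qed
    then show ?thesis by (simp add: power_divide)
  qed
  have digits: "indep_vars (\<lambda>_. borel) (digit_term N n C \<omega>) {1..}" for \<omega>
    unfolding digit_term_def
    by (rule indep_vars_compose2[OF indep_seeds]) auto
  have bound: "\<bar>digit_term N n C \<omega> k u\<bar> \<le> C / 2 ^ k" if \<omega>: "\<omega> \<in> space (symbol_space m)" for \<omega> k u
  proof -
    have "\<bar>digit_term N n C \<omega> k u\<bar> \<le> 1 / 2 ^ k * C"
      unfolding digit_term_def abs_mult using w_le[OF \<omega>] w_pos[OF \<omega>] C_ge
      by (intro mult_mono) (auto simp: less_imp_le abs_of_pos)
    then show ?thesis by simp
  qed
  have \<nu>: "?\<nu> \<omega> k = distr ?S borel (digit_term N n C \<omega> k)"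
    if \<omega>: "\<omega> \<in> space (symbol_space m)" and k: "k \<ge> 1" for \<omega> k
  proof -
    let ?j = "\<omega> k"
    \<comment> \<open>By the choice of \<open>C\<close> the truncation is the identity on actual
      digits, so it does not change the law.\<close>
    let ?f = "\<lambda>b. ?w \<omega> k * (if \<bar>real_of_int b\<bar> \<le> C then of_int b else 0)"
    have j: "?j \<in> ?J" by (rule sym[OF \<omega> k])
    have f: "?f b = ?w \<omega> k * of_int b" if "b \<in> B ?j" for b using C[OF j that] by simp
    have img: "(\<lambda>b. ?w \<omega> k * of_int b) ` B ?j = ?f ` B ?j" by (rule image_cong[OF refl]) (simp only: f)
    have inj: "inj_on ?f (B ?j)"
    proof (rule inj_onI)
      fix b c assume bc: "b \<in> B ?j" "c \<in> B ?j" "?f b = ?f c"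
      then have "?w \<omega> k * of_int b = ?w \<omega> k * of_int c" by (simp only: f)
      then show "b = c" by (simp only: mult_left_cancel[OF w_nz[OF \<omega>]] of_int_eq_iff)
    qed
    have "?\<nu> \<omega> k = distr (measure_pmf (pmf_of_set (B ?j))) borel ?f"
      unfolding img by (rule uniform_atomic_image[OF B(1)[OF j] B_ne[OF j] inj])
    also have "\<dots> = distr (distr ?S (measure_pmf (pmf_of_set (B ?j))) (\<lambda>u. u (k, ?j))) borel ?f"
      by (simp only: distr_seed)
    also have "\<dots> = distr ?S borel (?f \<circ> (\<lambda>u. u (k, ?j)))"
      by (intro distr_distr measurable_seed) simp
    also have "?f \<circ> (\<lambda>u. u (k, ?j)) = digit_term N n C \<omega> k"
      by (auto simp: digit_term_def)
    finally show ?thesis .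
  qed
  have conv: "random_convolution N B n \<omega> = distr ?S borel (digit_series N n C \<omega>)"
    and char_lim: "\<And>s. (\<lambda>k. \<Prod>i<k. char (?\<nu> \<omega> (Suc i)) s) \<longlonglongrightarrow> char (random_convolution N B n \<omega>) s"
    and series_bound: "\<And>u. \<bar>digit_series N n C \<omega> u\<bar> \<le> C"
    and series_rv: "random_variable borel (digit_series N n C \<omega>)"
    if \<omega>: "\<omega> \<in> space (symbol_space m)" for \<omega>
  proof -
    note * = infinite_convolution_eq_distr[where X = "digit_term N n C \<omega>" and C = C and \<nu> = "?\<nu> \<omega>", OF digits bound[OF \<omega>] \<nu>[OF \<omega>]]
    show eq: "random_convolution N B n \<omega> = distr ?S borel (digit_series N n C \<omega>)"
      unfolding random_convolution_def digit_series_def[abs_def] by (rule *(1))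
    show "(\<lambda>k. \<Prod>i<k. char (?\<nu> \<omega> (Suc i)) s) \<longlonglongrightarrow> char (random_convolution N B n \<omega>) s" for s
      unfolding eq digit_series_def[abs_def] by (rule *(2))
    show "\<bar>digit_series N n C \<omega> u\<bar> \<le> C" for u
      unfolding digit_series_def by (rule *(3)) simp_all
    show "random_variable borel (digit_series N n C \<omega>)"
      unfolding digit_series_def[abs_def] by (rule *(4))
  qed
  have rd: "real_distribution (random_convolution N B n \<omega>)" if \<omega>: "\<omega> \<in> space (symbol_space m)" for \<omega>
    unfolding conv[OF \<omega>] by (rule real_distribution_distr[OF series_rv[OF \<omega>]])
  have supp: "AE x in random_convolution N B n \<omega>. \<bar>x\<bar> \<le> C" if \<omega>: "\<omega> \<in> space (symbol_space m)" for \<omega>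
    unfolding conv[OF \<omega>] using series_bound[OF \<omega>] series_rv[OF \<omega>] by (subst AE_distr_iff) auto
  have random: "random_measure (symbol_space m) (random_convolution N B n)"
    unfolding random_measure_def
  proof (intro conjI ballI)
    show "sets (random_convolution N B n \<omega>) = sets borel" if "\<omega> \<in> space (symbol_space m)" for \<omega>
      using conv[OF that] by simp
    fix A :: "real set" assume A: "A \<in> sets borel"
    let ?g = "\<lambda>p. digit_series N n C (fst p) (snd p)"
    have g: "?g \<in> borel_measurable (symbol_space m \<Otimes>\<^sub>M ?S)"
      unfolding digit_series_def
    proof (rule borel_measurable_LIMSEQ_real)
      fix p assume "p \<in> space (symbol_space m \<Otimes>\<^sub>M ?S)"
      then have \<omega>: "fst p \<in> space (symbol_space m)" by (auto simp: space_pair_measure)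
      have geo: "summable (\<lambda>k. C / 2 ^ Suc k)"
        using sums_summable[OF sums_mult[OF power_half_series, of C]] by (simp add: power_divide)
      have "summable (\<lambda>k. digit_term N n C (fst p) (Suc k) (snd p))"
        by (rule summable_comparison_test'[OF geo, of 0]) (use bound[OF \<omega>] in \<open>simp del: power_Suc\<close>)
      then show "(\<lambda>k. \<Sum>i<k. digit_term N n C (fst p) (Suc i) (snd p)) \<longlonglongrightarrow> (\<Sum>k. digit_term N n C (fst p) (Suc k) (snd p))"
        by (rule summable_LIMSEQ)
    qed (intro borel_measurable_sum measurable_digit_term, simp)
    \<comment> \<open>The mass of A is the seed measure of the \<omega>-section of a jointly
      measurable set.\<close>
    have "(\<lambda>\<omega>. emeasure ?S (Pair \<omega> -` (?g -` A \<inter> space (symbol_space m \<Otimes>\<^sub>M ?S)))) \<in> borel_measurable (symbol_space m)"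
      by (rule measurable_emeasure_Pair) (rule measurable_sets[OF g A])
    moreover have "emeasure (random_convolution N B n \<omega>) A = emeasure ?S (Pair \<omega> -` (?g -` A \<inter> space (symbol_space m \<Otimes>\<^sub>M ?S)))"
      if \<omega>: "\<omega> \<in> space (symbol_space m)" for \<omega>
    proof -
      have "Pair \<omega> -` (?g -` A \<inter> space (symbol_space m \<Otimes>\<^sub>M ?S)) = digit_series N n C \<omega> -` A \<inter> space ?S"
        using \<omega> by (auto simp: space_pair_measure)
      then show ?thesis unfolding conv[OF \<omega>] using emeasure_distr[OF series_rv[OF \<omega>] A] by simp
    qed
    ultimately show "(\<lambda>\<omega>. emeasure (random_convolution N B n \<omega>) A) \<in> borel_measurable (symbol_space m)"
      by (subst measurable_cong) auto
  qed
  define E where "E = {t. t > 0 \<and> (\<forall>k\<in>?J. gcd t (N k) = 1)}"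
  have E: "coprime_scalings m N = real ` E" by (auto simp: coprime_scalings_def E_def)
  have one_E: "1 \<in> E" by (simp add: E_def)
  define H where "H k j L \<longleftrightarrow> finite L \<and> 0 \<in> L \<and>
    (\<forall>t b b'. coprime t (N j) \<longrightarrow> t > 0 \<longrightarrow> b \<in> B j \<longrightarrow> b' \<in> B j \<longrightarrow>
       (\<Sum>l\<in>L. ec (real t * of_int (b - b') * of_int l / real (N j ^ n k))) = (if b = b' then of_nat (card (B j)) else 0)) \<and>
    (\<forall>t l l'. coprime t (N j) \<longrightarrow> t > 0 \<longrightarrow> l \<in> L \<longrightarrow> l' \<in> L \<longrightarrow> l \<noteq> l' \<longrightarrow>
       digit_mask (B j) (real t * of_int (l - l') / real (N j ^ n k)) = 0)" for k j L
  \<comment> \<open>Chosen before \<omega> and t: one Hadamard set per place and symbol has to serve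
    all scalings.\<close>
  define L where "L k j = (SOME L. H k j L)" for k j
  have L: "H k j (L k j)" if "k \<ge> 1" "j \<in> ?J" for k j
    unfolding L_def H_def by (rule someI_ex[OF admissible_pair_power[OF adm[OF that(2)] n[OF that(1)]]])
  \<comment> \<open>Finitely many pairs give one ratio below 1, and raising N to a power preserves
    the inequality.\<close>
  define \<rho> where "\<rho> = Max ((\<lambda>j. real (card (B j)) / real (N j)) ` ?J)"
  have \<rho>_less: "\<rho> < 1" unfolding \<rho>_def using m card_less B(3) by (subst Max_less_iff) (auto simp: divide_less_eq)
  have \<rho>: "real (card (B j)) \<le> \<rho> * real (N j)" if "j \<in> ?J" for j
  proof -
    have "real (card (B j)) / real (N j) \<le> \<rho>" unfolding \<rho>_def using that by (intro Max_ge) auto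
    then show ?thesis using B(3)[OF that] by (simp add: divide_le_eq)
  qed
  have common: "\<exists>\<Lambda>. (\<forall>t\<in>E. is_spectrum (random_convolution N B n \<omega>) ((\<lambda>x. real t * x) ` \<Lambda>)) \<and> \<Lambda> \<notin> range F"
    if \<omega>: "\<omega> \<in> space (symbol_space m)" for \<omega> and F :: "nat \<Rightarrow> real set"
  proof -
    have j: "\<omega> (Suc k) \<in> ?J" for k by (rule sym[OF \<omega>]) simp
    have pow: "N (\<omega> (Suc k)) dvd N (\<omega> (Suc k)) ^ n (Suc k)" "N (\<omega> (Suc k)) \<le> N (\<omega> (Suc k)) ^ n (Suc k)" for k
      using n[of "Suc k"] B(3)[OF j[of k]] by (auto intro: self_le_power dvd_power)
    interpret moran "\<lambda>k. B (\<omega> (Suc k))" "\<lambda>k. N (\<omega> (Suc k)) ^ n (Suc k)" "\<lambda>k. L (Suc k) (\<omega> (Suc k))" E C \<rho>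
    proof
      fix k
      show "finite (B (\<omega> (Suc k)))" "2 \<le> card (B (\<omega> (Suc k)))" using B j by blast+
      show "2 \<le> N (\<omega> (Suc k)) ^ n (Suc k)" using pow(2)[of k] B(3)[OF j[of k]] by linarith
      show "\<bar>real_of_int d\<bar> \<le> C" if "d \<in> B (\<omega> (Suc k))" for d by (rule C[OF j that])
      have "real (card (B (\<omega> (Suc k)))) \<le> \<rho> * real (N (\<omega> (Suc k)))" by (rule \<rho>[OF j])
      also have "\<dots> \<le> \<rho> * real (N (\<omega> (Suc k)) ^ n (Suc k))"
      proof (rule mult_left_mono)
        have "0 \<le> \<rho> * real (N (\<omega> (Suc k)))" using \<rho>[OF j[of k]] by linarith
        then show "0 \<le> \<rho>" using B(3)[OF j[of k]] by (simp add: zero_le_mult_iff)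
      qed (use pow in simp)
      finally show "real (card (B (\<omega> (Suc k)))) \<le> \<rho> * real (N (\<omega> (Suc k)) ^ n (Suc k))" .
      have "inj_on (\<lambda>b. b mod int (N (\<omega> (Suc k)))) (B (\<omega> (Suc k)))"
        using admissible_pair_sums[OF adm[OF j[of k]]] by metis
      moreover have "int (N (\<omega> (Suc k))) dvd int (N (\<omega> (Suc k)) ^ n (Suc k))" using pow(1)[of k] by (simp only: of_nat_dvd_iff)
      ultimately show "inj_on (\<lambda>d. d mod int (N (\<omega> (Suc k)) ^ n (Suc k))) (B (\<omega> (Suc k)))"
        by (auto simp: inj_on_def) (metis mod_mod_cancel)
      have H: "H (Suc k) (\<omega> (Suc k)) (L (Suc k) (\<omega> (Suc k)))" by (rule L[OF _ j]) simp
      then show "finite (L (Suc k) (\<omega> (Suc k)))" "0 \<in> L (Suc k) (\<omega> (Suc k))" by (auto simp: H_def)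
      fix t assume "t \<in> E"
      then have t: "coprime t (N (\<omega> (Suc k)))" "t > 0" using j[of k] by (auto simp: E_def coprime_iff_gcd_eq_1)
      then show "coprime t (N (\<omega> (Suc k)) ^ n (Suc k))" "t > 0" by simp_all
      show "(\<Sum>l\<in>L (Suc k) (\<omega> (Suc k)). ec (real t * of_int (d - d') * of_int l / real (N (\<omega> (Suc k)) ^ n (Suc k))))
          = (if d = d' then of_nat (card (B (\<omega> (Suc k)))) else 0)"
        if "d \<in> B (\<omega> (Suc k))" "d' \<in> B (\<omega> (Suc k))" for d d'
        using H t that unfolding H_def by blast
      show "digit_mask (B (\<omega> (Suc k))) (real t * of_int (l - l') / real (N (\<omega> (Suc k)) ^ n (Suc k))) = 0"
        if "l \<in> L (Suc k) (\<omega> (Suc k))" "l' \<in> L (Suc k) (\<omega> (Suc k))" "l \<noteq> l'" for l l'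
        using H t that unfolding H_def by blast
    qed (use \<rho>_less one_E in auto)
    have w: "?w \<omega> (Suc i) = 1 / real (P (Suc i))" for i
    proof -
      have "(\<Prod>i=1..k. 1 / real (N (\<omega> i)) ^ n i) = (\<Prod>i<k. 1 / real (N (\<omega> (Suc i))) ^ n (Suc i))" for k
        by (rule prod.reindex_bij_witness[of _ Suc "\<lambda>i. i - 1"]) auto
      then show ?thesis by (simp add: P_def prod_dividef)
    qed
    \<comment> \<open>The argument \<open>- 2 * pi * \<xi>\<close> converts \<open>char\<close> to
      the normalisation of \<open>ec\<close>, as in \<open>fourier_char\<close>.\<close>
    have char: "char (?\<nu> \<omega> (Suc i)) (- 2 * pi * \<xi>) = digit_mask (B (\<omega> (Suc i))) (\<xi> / real (P (Suc i)))" for i \<xi>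
    proof -
      have inj: "inj_on (\<lambda>b. ?w \<omega> (Suc i) * real_of_int b) (B (\<omega> (Suc i)))"
        by (rule inj_onI) (simp only: mult_left_cancel[OF w_nz[OF \<omega>]] of_int_eq_iff)
      have "char (?\<nu> \<omega> (Suc i)) (- 2 * pi * \<xi>) =
          (\<Sum>b\<in>B (\<omega> (Suc i)). iexp (- 2 * pi * \<xi> * (?w \<omega> (Suc i) * real_of_int b))) / of_nat (card (B (\<omega> (Suc i))))"
        using B(1)[OF j[of i]] B_ne[OF j[of i]]
        by (subst char_uniform_atomic) (simp_all only: finite_imageI image_is_empty sum.reindex[OF inj] card_image[OF inj] o_def not_False_eq_True)
      then show ?thesis unfolding digit_mask_def ec_iexp w by (simp add: mult_ac)
    qed
    have lim: "(\<lambda>j. G 0 j \<xi>) \<longlonglongrightarrow> fourier (random_convolution N B n \<omega>) \<xi>" for \<xi>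
      using char_lim[OF \<omega>, of "- 2 * pi * \<xi>"] unfolding char G_def fourier_char lessThan_atLeast0 .
    show ?thesis
      by (rule common_spectrum_exists[OF rd[OF \<omega>] supp[OF \<omega>] lim, where F = F]) blast
  qed
  have "spectral_measure (random_convolution N B n \<omega>)" if \<omega>: "\<omega> \<in> space (symbol_space m)" for \<omega>
    unfolding spectral_measure_def using rd[OF \<omega>] common[OF \<omega>] one_E by blast
  moreover have "uncountable {\<Lambda>. \<forall>t\<in>real ` E. is_spectrum (random_convolution N B n \<omega>) ((\<lambda>x. t * x) ` \<Lambda>)}"
    if \<omega>: "\<omega> \<in> space (symbol_space m)" for \<omega>
  proof
    let ?A = "{\<Lambda>. \<forall>t\<in>real ` E. is_spectrum (random_convolution N B n \<omega>) ((\<lambda>x. t * x) ` \<Lambda>)}"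
    assume "countable ?A"
    \<comment> \<open>A countable family lies in the range of a sequence, which is handed to
      \<open>common\<close> as the family to avoid.\<close>
    then have sub: "?A \<subseteq> range (from_nat_into ?A)" using subset_range_from_nat_into by blast
    obtain \<Lambda> where "\<forall>t\<in>E. is_spectrum (random_convolution N B n \<omega>) ((\<lambda>x. real t * x) ` \<Lambda>)" "\<Lambda> \<notin> range (from_nat_into ?A)"
      using common[OF \<omega>] by blast
    then show False using sub by auto
  qed
  ultimately show ?thesis
    unfolding spectral_random_measure_def aleph1_spectral_eigen_set_def E using random one_E by force
qed

end
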